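(* Let $r\ge1$, let $\lambda^1,\dots,\lambda^r$ be partitions, and let $N\ge\max_i\ell(\lambda^i)$. Then the cumulant of interpolation Macdonald polynomials satisfies \[\kappa^{\mathcal{J}}(\lambda^1,\dots,\lambda^r)=O_1\left((q-1)^{r-1}\right).\] That is, every coefficient of $\kappa^{\mathcal{J}}(\lambda^1,\dots,\lambda^r)/(q-1)^{r-1}$ in the monomial basis, viewed as a rational function of $q$ over $\mathbb{Q}(t)$, has no pole at $q=1$.
   Context: A partition $\lambda$ is a weakly decreasing finite sequence of positive integers, extended by zeros, with length $\ell(\lambda)$ and size $|\lambda|$. For partitions $\lambda,\mu$, $\lambda\oplus\mu:=(\lambda_1+\mu_1,\lambda_2+\mu_2,\dots)$. For $I\subseteq[r]$, set $\lambda^I:=\bigoplus_{i\in I}\lambda^i$. Interpolation Macdonald polynomials (Sahi) in $N$ variables are defined as follows. For a partition $\lambda$ with $\ell(\lambda)\le N$, $\mathcal{J}^{(q,t)}_\lambda(x_1,\dots,x_N)$ is the unique symmetric polynomial over $\mathbb{Q}(q,t)$ of degree $|\lambda|$ such that: - its coefficient of the monomial symmetric function $m_\lambda$ equals that of the Macdonald integral form $J^{(q,t)}_\lambda$, namely $\prod_{\square\in\lambda}(1-q^{a(\square)}t^{\ell(\square)+1})$, where $a(\square)$ and $\ell(\square)$ are the arm- and leg-length of the box; - $\mathcal{J}^{(q,t)}_\lambda(q^{\mu_1}t^{N-1},q^{\mu_2}t^{N-2},\dots,q^{\mu_N}t^0)=0$ for every partition $\mu\ne\lambda$ with $|\mu|\le|\lambda|$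 and $\ell(\mu)\le N$. $\mathcal{P}([r])$ is the lattice of set partitions of $[r]$ under refinement, and $\mu(\pi,\{[r]\})=(-1)^{\#\pi-1}(\#\pi-1)!$ is its Möbius function, where $\#\pi$ is the number of blocks. The cumulant is \[\kappa^{\mathcal{J}}(\lambda^1,\dots,\lambda^r):=\sum_{\pi\in\mathcal{P}([r])}\mu(\pi,\{[r]\})\prod_{B\in\pi}\mathcal{J}^{(q,t)}_{\lambda^B}.\] *)

theory Defs
  imports
    "HOL-Computational_Algebra.Fraction_Field"
    "HOL-Computational_Algebra.Polynomial"
    "HOL-Combinatorics.Permutations"
    "HOL-Library.Poly_Mapping"
    "HOL-Library.More_List"
    "HOL-Library.Disjoint_Sets"
begin

section \<open>The field of rational functions in \<open>q\<close> and \<open>t\<close>\<close>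

text \<open>The field \<open>\<rat>(q,t)\<close> is built as \<open>\<rat>(t)(q)\<close>, so that an element is literally a
  rational function of \<open>q\<close> over \<open>\<rat>(t)\<close>.\<close>

type_synonym ratt = "rat poly fract"
type_synonym ratqt = "ratt poly fract"

definition qq :: ratqt where
  "qq = Fraction_Field.Fract [:0, 1:] 1"

definition tt :: ratqt where
  "tt = Fraction_Field.Fract [:Fraction_Field.Fract [:0, 1:] 1:] 1"

definition no_pole_at_one :: "ratqt \<Rightarrow> bool" where
  "no_pole_at_one f \<longleftrightarrow> (\<exists>a b :: ratt poly. poly b 1 \<noteq> 0 \<and> f = Fraction_Field.Fract a b)"


section \<open>Partitions\<close>

text \<open>The extension of a partition by zeros is \<^term>\<open>nth_default 0 \<nu>\<close>; parts are indexed
  from \<open>0\<close>.\<close>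

definition is_partition :: "nat list \<Rightarrow> bool" where
  "is_partition \<nu> \<longleftrightarrow> sorted_wrt (\<ge>) \<nu> \<and> (\<forall>k\<in>set \<nu>. 0 < k)"

text \<open>The partition \<open>\<lambda>\<^sup>I\<close>, the componentwise sum over \<open>i \<in> I\<close> of the partitions \<open>\<Lambda> i\<close>.\<close>

definition oplus_family :: "nat set \<Rightarrow> (nat \<Rightarrow> nat list) \<Rightarrow> nat list" where
  "oplus_family I \<Lambda> =
     map (\<lambda>k. \<Sum>i\<in>I. nth_default 0 (\<Lambda> i) k) [0..<Max (insert 0 ((\<lambda>i. length (\<Lambda> i)) ` I))]"

definition arm :: "nat list \<Rightarrow> nat \<Rightarrow> nat \<Rightarrow> nat" where
  "arm \<nu> i j = card {j'. j < j' \<and> j' < nth_default 0 \<nu> i}"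

definition leg :: "nat list \<Rightarrow> nat \<Rightarrow> nat \<Rightarrow> nat" where
  "leg \<nu> i j = card {i'. i < i' \<and> j < nth_default 0 \<nu> i'}"

definition integral_form_coeff :: "nat list \<Rightarrow> ratqt" where
  "integral_form_coeff \<nu> =
     (\<Prod>i<length \<nu>. \<Prod>j<\<nu> ! i. 1 - qq ^ arm \<nu> i j * tt ^ (leg \<nu> i j + 1))"


section \<open>Symmetric polynomials in \<open>N\<close> variables\<close>

text \<open>A monomial is its exponent vector \<^typ>\<open>nat \<Rightarrow>\<^sub>0 nat\<close>; the variables
  \<open>x\<^sub>1, \<dots>, x\<^sub>N\<close> have the indices \<open>0, \<dots>, N - 1\<close>.\<close>

type_synonym 'a mpol = "(nat \<Rightarrow>\<^sub>0 nat) \<Rightarrow>\<^sub>0 'a"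

definition in_vars :: "nat \<Rightarrow> 'a::zero mpol \<Rightarrow> bool" where
  "in_vars N p \<longleftrightarrow> (\<forall>m\<in>Poly_Mapping.keys p. Poly_Mapping.keys m \<subseteq> {..<N})"

definition total_degree :: "'a::zero mpol \<Rightarrow> nat" where
  "total_degree p =
     Max (insert 0 ((\<lambda>m. \<Sum>i\<in>Poly_Mapping.keys m. Poly_Mapping.lookup m i) ` Poly_Mapping.keys p))"

definition mpeval :: "(nat \<Rightarrow> 'a) \<Rightarrow> 'a::comm_semiring_1 mpol \<Rightarrow> 'a" where
  "mpeval x p = (\<Sum>m\<in>Poly_Mapping.keys p.
     Poly_Mapping.lookup p m * (\<Prod>i\<in>Poly_Mapping.keys m. x i ^ Poly_Mapping.lookup m i))"

definition is_symmetric :: "nat \<Rightarrow> 'a::zero mpol \<Rightarrow> bool" where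
  "is_symmetric N p \<longleftrightarrow> in_vars N p \<and>
     (\<forall>\<sigma>. \<sigma> permutes {..<N} \<longrightarrow>
        (\<forall>m. Poly_Mapping.lookup p (Poly_Mapping.map_key \<sigma> m) = Poly_Mapping.lookup p m))"

definition orbit_monomials :: "nat \<Rightarrow> nat list \<Rightarrow> (nat \<Rightarrow>\<^sub>0 nat) set" where
  "orbit_monomials N \<mu> =
     {Poly_Mapping.map_key \<sigma> (Poly_Mapping.nth \<mu>) | \<sigma>. \<sigma> permutes {..<N}}"

definition monomial_sym :: "nat \<Rightarrow> nat list \<Rightarrow> 'a::comm_semiring_1 mpol" where
  "monomial_sym N \<mu> = (\<Sum>m\<in>orbit_monomials N \<mu>. Poly_Mapping.single m 1)"

text \<open>The coefficient of \<open>m\<^sub>\<mu>\<close> in a symmetric polynomial is the coefficient of the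
  monomial \<open>x\<^sub>1\<^bsup>\<mu>\<^sub>1\<^esup> x\<^sub>2\<^bsup>\<mu>\<^sub>2\<^esup> \<dots>\<close>; see \<open>monomial_expansion\<close> below.\<close>

definition mcoeff :: "'a::zero mpol \<Rightarrow> nat list \<Rightarrow> 'a" where
  "mcoeff p \<mu> = Poly_Mapping.lookup p (Poly_Mapping.nth \<mu>)"

lemma keys_subset_imp_orbit:
  assumes "Poly_Mapping.keys m \<subseteq> {..<N}"
  shows "\<exists>\<mu>. is_partition \<mu> \<and> length \<mu> \<le> N \<and> m \<in> orbit_monomials N \<mu>"
proof -
  define xs where "xs = map (Poly_Mapping.lookup m) [0..<N]"
  define ys where "ys = rev (sort xs)"
  define \<mu> where "\<mu> = takeWhile (\<lambda>k. 0 < k) ys"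
  have len: "length ys = N" by (simp add: ys_def xs_def)
  have sys: "sorted_wrt (\<ge>) ys"
    unfolding ys_def sorted_wrt_rev using sorted_sort[of xs] by simp
  have eq: "ys = \<mu> @ dropWhile (\<lambda>k. 0 < k) ys" by (simp add: \<mu>_def)
  have "sorted_wrt (\<ge>) \<mu>" using sys by (subst (asm) eq) (simp only: sorted_wrt_append)
  then have part: "is_partition \<mu>"
    unfolding is_partition_def using set_takeWhileD[of _ "\<lambda>k. 0 < k" ys] by (auto simp: \<mu>_def)
  have "\<forall>k\<in>set (dropWhile (\<lambda>k. 0 < k) ys). k = 0"
  proof (cases "dropWhile (\<lambda>k. 0 < k) ys")
    case (Cons a zs)
    then have "a = 0" using hd_dropWhile[of "\<lambda>k. 0 < k" ys] by simp
    moreover have "sorted_wrt (\<ge>) (a # zs)" using sys by (subst (asm) eq) (simp only: sorted_wrt_append Cons)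
    ultimately show ?thesis using Cons by auto
  qed (simp only: list.set ball_empty)
  then have "dropWhile (\<lambda>k. 0 < k) ys = replicate (length (dropWhile (\<lambda>k. 0 < k) ys)) 0"
    by (simp only: replicate_length_same)
  then have "\<exists>n. dropWhile (\<lambda>k. 0 < k) ys = replicate n 0" ..
  then obtain n where n: "dropWhile (\<lambda>k. 0 < k) ys = replicate n 0" ..
  have "ys = \<mu> @ replicate n 0" using eq unfolding n .
  then have nth: "Poly_Mapping.nth ys = Poly_Mapping.nth \<mu>" by (simp only: nth_trailing_zeros)
  have "mset xs = mset ys" by (simp add: ys_def)
  then obtain \<sigma> where \<sigma>: "\<sigma> permutes {..<length ys}" "permute_list \<sigma> ys = xs"
    using mset_eq_permutation by blast
  have "Poly_Mapping.lookup m i = nth_default 0 ys (\<sigma> i)" for i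
  proof (cases "i < N")
    case True
    then have "\<sigma> i < N" using \<sigma>(1) len permutes_in_image by fastforce
    then have "nth_default 0 ys (\<sigma> i) = ys ! \<sigma> i" by (simp add: nth_default_def len)
    also have "\<dots> = xs ! i" using permute_list_nth[OF \<sigma>(1), of i] \<sigma>(2) True len by simp
    finally show ?thesis using True by (simp add: xs_def)
  next
    case False
    then have "\<sigma> i = i" using \<sigma>(1) len by (simp add: permutes_def)
    moreover have "Poly_Mapping.lookup m i = 0" using False assms
      by (metis in_keys_iff lessThan_iff subsetD)
    ultimately show ?thesis using False by (simp add: nth_default_def len)
  qed
  then have "m = Poly_Mapping.map_key \<sigma> (Poly_Mapping.nth ys)"
    using \<sigma>(1) by (intro poly_mapping_eqI) (simp add: map_key.rep_eq permutes_inj)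
  then have "m \<in> orbit_monomials N \<mu>" using \<sigma>(1) len nth by (auto simp: orbit_monomials_def)
  moreover have "length \<mu> \<le> N" using length_takeWhile_le[of "\<lambda>k. 0 < k" ys] by (simp only: \<mu>_def len)
  ultimately show ?thesis using part by blast
qed

lemma orbit_mset:
  assumes "m \<in> orbit_monomials N \<mu>" "length \<mu> \<le> N"
  shows "image_mset (Poly_Mapping.lookup m) (mset_set {..<N}) = mset \<mu> + replicate_mset (N - length \<mu>) 0"
proof -
  obtain \<sigma> where \<sigma>: "\<sigma> permutes {..<N}" "m = Poly_Mapping.map_key \<sigma> (Poly_Mapping.nth \<mu>)"
    using assms(1) by (auto simp: orbit_monomials_def)
  have "image_mset (Poly_Mapping.lookup m) (mset_set {..<N})
      = image_mset (nth_default 0 \<mu>) (image_mset \<sigma> (mset_set {..<N}))"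
    using \<sigma> by (simp add: map_key.rep_eq permutes_inj comp_def multiset.map_comp)
  also have "image_mset \<sigma> (mset_set {..<N}) = mset_set {..<N}"
    using \<sigma>(1) by (simp add: image_mset_mset_set permutes_inj_on permutes_image)
  also have "image_mset (nth_default 0 \<mu>) (mset_set {..<N}) = mset (map (nth_default 0 \<mu>) [0..<N])"
    by (simp add: atLeast_upt[symmetric] flip: mset_set_set lessThan_atLeast0)
  also have "map (nth_default 0 \<mu>) [0..<N] = \<mu> @ replicate (N - length \<mu>) 0"
    using assms(2) by (intro nth_equalityI) (auto simp: nth_default_def nth_append)
  finally show ?thesis by simp
qed

lemma orbit_unique:
  assumes "m \<in> orbit_monomials N \<mu>" "m \<in> orbit_monomials N \<nu>"
    and "is_partition \<mu>" "is_partition \<nu>" "length \<mu> \<le> N" "length \<nu> \<le> N"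
  shows "\<mu> = \<nu>"
proof -
  have pos: "filter_mset (\<lambda>k. 0 < k) (mset \<mu> + replicate_mset n 0) = mset \<mu>"
    if "is_partition \<mu>" for \<mu> n
  proof -
    have "filter_mset (\<lambda>k. 0 < k) (mset \<mu>) = mset \<mu>"
      using that by (subst filter_mset_eq_conv) (auto simp: is_partition_def)
    moreover have "filter_mset (\<lambda>k. 0 < k) (replicate_mset n (0::nat)) = {#}"
      by (rule multiset_eqI) (simp only: count_filter_mset count_replicate_mset count_empty, simp)
    ultimately show ?thesis by (simp only: filter_union_mset add_0_right)
  qed
  have "mset \<mu> = filter_mset (\<lambda>k. 0 < k) (mset \<mu> + replicate_mset (N - length \<mu>) 0)"
    by (simp only: pos assms(3))
  also have "\<dots> = filter_mset (\<lambda>k. 0 < k) (mset \<nu> + replicate_mset (N - length \<nu>) 0)"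
    by (simp only: flip: orbit_mset[OF assms(1,5)] orbit_mset[OF assms(2,6)])
  also have "\<dots> = mset \<nu>"
    by (simp only: pos assms(4))
  finally have "mset \<mu> = mset \<nu>" .
  moreover have "sorted (rev \<mu>)" "sorted (rev \<nu>)"
    using assms(3,4) by (simp_all add: is_partition_def sorted_wrt_rev)
  ultimately show ?thesis by (metis mset_rev properties_for_sort rev_rev_ident)
qed

lemma finite_orbit_monomials: "finite (orbit_monomials N \<mu>)"
proof -
  have "orbit_monomials N \<mu> =
      (\<lambda>\<sigma>. Poly_Mapping.map_key \<sigma> (Poly_Mapping.nth \<mu>)) ` {\<sigma>. \<sigma> permutes {..<N}}"
    by (auto simp: orbit_monomials_def)
  then show ?thesis by (simp add: finite_permutations)
qed

lemma sum_list_orbit: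
  assumes "m \<in> orbit_monomials N \<mu>" "length \<mu> \<le> N" "Poly_Mapping.keys m \<subseteq> {..<N}"
  shows "sum_list \<mu> = (\<Sum>i\<in>Poly_Mapping.keys m. Poly_Mapping.lookup m i)"
proof -
  have "(\<Sum>i\<in>Poly_Mapping.keys m. Poly_Mapping.lookup m i) = (\<Sum>i<N. Poly_Mapping.lookup m i)"
    using assms(3) by (intro sum.mono_neutral_left) (auto simp: in_keys_iff)
  also have "\<dots> = sum_mset (image_mset (Poly_Mapping.lookup m) (mset_set {..<N}))"
    by (simp add: sum_unfold_sum_mset)
  also have "\<dots> = sum_list \<mu>"
    unfolding orbit_mset[OF assms(1,2)] by (simp add: sum_mset_sum_list)
  finally show ?thesis by simp
qed

lemma finite_partitions_bounded:
  "finite {\<mu>. is_partition \<mu> \<and> length \<mu> \<le> N \<and> sum_list \<mu> \<le> d}"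
proof (rule finite_subset)
  show "{\<mu>. is_partition \<mu> \<and> length \<mu> \<le> N \<and> sum_list \<mu> \<le> d}
      \<subseteq> {\<mu>. set \<mu> \<subseteq> {..d} \<and> length \<mu> \<le> N}"
    using member_le_sum_list by (auto intro: order_trans)
qed (rule finite_lists_length_le, simp)

theorem monomial_expansion:
  fixes p :: "'a::comm_semiring_1 mpol"
  assumes "is_symmetric N p"
  shows "p = (\<Sum>\<mu> | is_partition \<mu> \<and> length \<mu> \<le> N \<and> sum_list \<mu> \<le> total_degree p.
                Poly_Mapping.single 0 (mcoeff p \<mu>) * monomial_sym N \<mu>)"
    (is "p = sum ?f ?A")
proof (rule poly_mapping_eqI)
  fix m
  have f: "Poly_Mapping.lookup (?f \<mu>) m = (mcoeff p \<mu> when m \<in> orbit_monomials N \<mu>)" for \<mu>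
  proof -
    have "?f \<mu> = (\<Sum>m\<in>orbit_monomials N \<mu>. Poly_Mapping.single m (mcoeff p \<mu>))"
      by (simp add: monomial_sym_def sum_distrib_left mult_single)
    then show ?thesis
      by (simp add: lookup_sum lookup_single when_def finite_orbit_monomials)
  qed
  have orb: "mcoeff p \<mu> = Poly_Mapping.lookup p m" if "m \<in> orbit_monomials N \<mu>" for \<mu>
    using that assms by (auto simp: orbit_monomials_def is_symmetric_def mcoeff_def)
  show "Poly_Mapping.lookup p m = Poly_Mapping.lookup (sum ?f ?A) m"
  proof (cases "Poly_Mapping.lookup p m = 0")
    case True
    then show ?thesis using orb by (auto simp: lookup_sum f when_def intro!: sum.neutral)
  next
    case False
    then have m: "m \<in> Poly_Mapping.keys p" by (simp add: in_keys_iff)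
    then have k: "Poly_Mapping.keys m \<subseteq> {..<N}"
      using assms by (auto simp: is_symmetric_def in_vars_def)
    obtain \<mu> where \<mu>: "is_partition \<mu>" "length \<mu> \<le> N" "m \<in> orbit_monomials N \<mu>"
      using keys_subset_imp_orbit[OF k] by blast
    have "sum_list \<mu> \<le> total_degree p"
      unfolding sum_list_orbit[OF \<mu>(3,2) k] total_degree_def using m by (intro Max_ge) auto
    then have A: "\<mu> \<in> ?A" using \<mu> by simp
    have "Poly_Mapping.lookup (sum ?f ?A) m
        = (\<Sum>\<nu>\<in>?A. mcoeff p \<nu> when m \<in> orbit_monomials N \<nu>)"
      by (simp add: lookup_sum f)
    also have "\<dots> = (\<Sum>\<nu>\<in>?A. if \<nu> = \<mu> then mcoeff p \<mu> else 0)"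
      using \<mu> orbit_unique by (intro sum.cong) (auto simp: when_def)
    also have "\<dots> = mcoeff p \<mu>" using A finite_partitions_bounded by simp
    finally show ?thesis using orb[OF \<mu>(3)] by simp
  qed
qed


section \<open>Interpolation Macdonald polynomials and their cumulants\<close>

definition is_interp_macdonald :: "nat \<Rightarrow> nat list \<Rightarrow> ratqt mpol \<Rightarrow> bool" where
  "is_interp_macdonald N \<nu> p \<longleftrightarrow>
     is_symmetric N p \<and> total_degree p = sum_list \<nu> \<and>
     mcoeff p \<nu> = integral_form_coeff \<nu> \<and>
     (\<forall>\<mu>. is_partition \<mu> \<and> \<mu> \<noteq> \<nu> \<and> sum_list \<mu> \<le> sum_list \<nu> \<and> length \<mu> \<le> N \<longrightarrow>
        mpeval (\<lambda>i. qq ^ nth_default 0 \<mu> i * tt ^ (N - 1 - i)) p = 0)"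

definition interp_macdonald :: "nat \<Rightarrow> nat list \<Rightarrow> ratqt mpol" where
  "interp_macdonald N \<nu> = (THE p. is_interp_macdonald N \<nu> p)"

definition moebius_top :: "nat set set \<Rightarrow> int" where
  "moebius_top \<pi> = (-1) ^ (card \<pi> - 1) * fact (card \<pi> - 1)"

text \<open>The cumulant \<open>\<kappa>\<^sup>\<J>(\<lambda>\<^sup>1, \<dots>, \<lambda>\<^sup>r)\<close> in \<open>N\<close> variables, where \<open>\<lambda>\<^sup>i\<close> is \<open>\<Lambda> i\<close> for \<open>1 \<le> i \<le> r\<close>.\<close>

definition cumulant :: "nat \<Rightarrow> nat \<Rightarrow> (nat \<Rightarrow> nat list) \<Rightarrow> ratqt mpol" where
  "cumulant N r \<Lambda> = (\<Sum>\<pi> | partition_on {1..r} \<pi>.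
     of_int (moebius_top \<pi>) * (\<Prod>B\<in>\<pi>. interp_macdonald N (oplus_family B \<Lambda>)))"

end

theory Submission
  imports Defs "Jordan_Normal_Form.Determinant"
begin

text \<open>The interpolation polynomial \<open>\<J>\<^bsub>\<lambda>\<^esub>\<close> is an eigenfunction of a difference operator
  \<open>\<Sum>\<^sub>k A\<^sub>k (1 - 1 / x\<^sub>k) (\<tau>\<^sub>k - 1)\<close>, where the ring endomorphism \<open>\<tau>\<^sub>k\<close> replaces \<open>x\<^sub>k\<close> by \<open>x\<^sub>k / q\<close>, with
  eigenvalue \<open>c\<^bsub>\<lambda>\<^esub> = \<Sum>\<^sub>j t\<^sup>j (q\<^bsup>-\<lambda>\<^sub>j\<^esup> - 1)\<close>. For \<open>\<lambda> = \<lambda>\<^sup>I\<close> the factor \<open>q\<^bsup>-\<lambda>\<^sub>j\<^esup>\<close> is multiplicative in \<open>I\<close>. Let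
  \<open>U = exp K\<close> be the generating function of the \<open>\<J>\<close> of the \<open>\<lambda>\<^sup>I\<close> in variables of square zero,
  so that \<open>K\<close> collects the cumulants. Dividing the eigenvalue equations by \<open>U\<close> gives
  \<open>\<Sum>\<^sub>k A\<^sub>k (1 - 1 / x\<^sub>k) (exp (\<tau>\<^sub>k K - K) - 1) = \<Sum>\<^sub>j t\<^sup>j (exp (\<chi>\<^sub>j K - K) - 1)\<close>,
  where \<open>\<chi>\<^sub>j\<close> rescales the variables. All the twists are the identity to first order in \<open>q - 1\<close>,
  so by induction the operator minus its eigenvalue maps the top cumulant to \<open>O((q - 1)\<^sup>r)\<close>. The operator
  is triangular for the lexicographic order, and different eigenvalues differ by \<open>q - 1\<close> times a unit,
  so all coefficients of the cumulant are \<open>O((q - 1)\<^bsup>r-1\<^esup>)\<close> once its coefficient at \<open>\<lambda>\<^bsup>[r]\<^esup>\<close> is.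
  That coefficient is the cumulant of the normalising products, which are products and quotients
  of \<open>q\<close>-Pochhammer symbols in quantities additive in \<open>I\<close>. These are treated one factor at a time.\<close>

section \<open>Cumulants and subset convolution\<close>

text \<open>A power series in variables of square zero is encoded as a function of finite index
  sets, with \<open>\<star>\<close> as product. Evaluation at \<open>insert i I\<close> for
  \<open>i \<notin> I\<close> is the derivative in the variable \<open>i\<close>, so cumulants of
  sets containing \<open>i\<close> form a logarithmic derivative, which a linear equation
  determines. The orders are counted as follows. If a cumulant of size b is O((q-1)^(b-1)), then its
  twisted difference is O((q-1)^b), and a product of twisted differences over the blocks of a set
  partition of I is O((q-1)^|I|). Only the linear term of an exponential can be larger. Inverting on
  that term costs one factor q - 1, because all eigenvalues vanish at q = 1; the first-order part of
  a difference of two of them is a nonzero combination of powers of t with integer coefficients. At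
  the leading exponent the difference is 0, so the coefficient there needs an argument of its own.
  An eigenfunction interpolates because the coefficients of the operator vanish at a node whenever
  the lowered exponents are no longer a partition. Its value at a node is thus tied to values at
  smaller partitions only.\<close>

definition subset_conv :: "(nat set \<Rightarrow> 'c::comm_ring_1) \<Rightarrow> (nat set \<Rightarrow> 'c) \<Rightarrow> nat set \<Rightarrow> 'c"
    (infixl \<open>\<star>\<close> 70) where
  "(f \<star> g) I = (\<Sum>B\<in>Pow I. f B * g (I - B))"

lemma conv_cong:
  assumes "\<And>B. B \<subseteq> I \<Longrightarrow> f B = f' B" "\<And>B. B \<subseteq> I \<Longrightarrow> g B = g' B"
  shows "(f \<star> g) I = (f' \<star> g') I"
  unfolding subset_conv_def by (intro sum.cong) (auto simp: assms)

lemma conv_commute: "(f \<star> g) I = (g \<star> f) I"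
  unfolding subset_conv_def
  by (rule sum.reindex_bij_witness[of _ "\<lambda>B. I - B" "\<lambda>B. I - B"])
     (auto simp: double_diff mult.commute)

lemma conv_assoc:
  assumes "finite I"
  shows "((f \<star> g) \<star> h) I = (f \<star> (g \<star> h)) I"
proof -
  have "((f \<star> g) \<star> h) I = (\<Sum>(A, B)\<in>Sigma (Pow I) Pow. f B * g (A - B) * h (I - A))"
    unfolding subset_conv_def using assms
    by (subst sum.Sigma[symmetric]) (auto simp: sum_distrib_right intro: finite_subset)
  also have "\<dots> = (\<Sum>(B, C)\<in>Sigma (Pow I) (\<lambda>B. Pow (I - B)). f B * (g C * h (I - B - C)))"
    by (rule sum.reindex_bij_witness[of _ "\<lambda>(B, C). (B \<union> C, B)" "\<lambda>(A, B). (B, A - B)"])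
       (auto simp: Un_absorb1 Un_Diff Diff_eq mult.assoc intro!: arg_cong2[of _ _ _ _ "(*)"] arg_cong[of _ _ g] arg_cong[of _ _ h])
  also have "\<dots> = (f \<star> (g \<star> h)) I"
    unfolding subset_conv_def using assms
    by (subst sum.Sigma[symmetric]) (auto simp: sum_distrib_left intro: finite_subset)
  finally show ?thesis .
qed

text \<open>The Leibniz rule for the derivative in the variable \<open>i\<close>: the new element
  goes to one of the two factors.\<close>

lemma conv_insert:
  assumes "finite I" "i \<notin> I"
  shows "(f \<star> g) (insert i I) = ((\<lambda>J. f (insert i J)) \<star> g) I + (f \<star> (\<lambda>J. g (insert i J))) I"
proof -
  have inj: "inj_on (insert i) (Pow I)"
    using assms(2) by (auto simp: inj_on_def)
  have "(f \<star> g) (insert i I) = (\<Sum>B\<in>Pow I. f B * g (insert i I - B))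
      + (\<Sum>B\<in>insert i ` Pow I. f B * g (insert i I - B))"
    unfolding subset_conv_def Pow_insert using assms by (intro sum.union_disjoint) auto
  also have "(\<Sum>B\<in>insert i ` Pow I. f B * g (insert i I - B)) = ((\<lambda>J. f (insert i J)) \<star> g) I"
    unfolding subset_conv_def using assms(2)
    by (subst sum.reindex[OF inj]) (auto intro!: sum.cong arg_cong[of _ _ g])
  also have "(\<Sum>B\<in>Pow I. f B * g (insert i I - B)) = (f \<star> (\<lambda>J. g (insert i J))) I"
    unfolding subset_conv_def using assms(2)
    by (intro sum.cong arg_cong2[of _ _ _ _ "(*)"] arg_cong[of _ _ g]) auto
  finally show ?thesis by (simp add: add.commute)
qed

lemma conv_split_left:
  assumes "finite I"
  shows "(f \<star> g) I = f I * g {} + (\<Sum>B | B \<subset> I. f B * g (I - B))"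
proof -
  have "Pow I = insert I {B. B \<subset> I}" by auto
  moreover have "finite {B. B \<subset> I}"
    using assms by (rule finite_subset[of _ "Pow I", rotated, OF finite_Pow_iff[THEN iffD2]]) auto
  ultimately show ?thesis unfolding subset_conv_def by simp
qed

lemma conv_diff_left: "((\<lambda>B. f B - f' B) \<star> g) I = (f \<star> g) I - (f' \<star> g) I"
  by (simp add: subset_conv_def left_diff_distrib sum_subtractf)

lemma conv_mult_left: "((\<lambda>B. x * f B) \<star> g) I = x * (f \<star> g) I"
  by (simp add: subset_conv_def sum_distrib_left mult.assoc)

lemma conv_sum_left: "((\<lambda>B. \<Sum>k\<in>K. f k B) \<star> g) I = (\<Sum>k\<in>K. (f k \<star> g) I)"
  unfolding subset_conv_def by (simp add: sum_distrib_right sum.swap[of _ K])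

lemma conv_unit_left: "finite I \<Longrightarrow> ((\<lambda>B. if B = {} then 1 else 0) \<star> g) I = g I"
proof -
  assume "finite I"
  have "((\<lambda>B. if B = {} then 1 else 0) \<star> g) I = (\<Sum>B\<in>Pow I. if B = {} then g I else 0)"
    unfolding subset_conv_def by (intro sum.cong) auto
  then show ?thesis using \<open>finite I\<close> by simp
qed

text \<open>A series with constant term 1 can be cancelled: in \<open>(f \<star> g) I\<close> only
  the summand \<open>B = I\<close> involves \<open>f I\<close>, all others involve \<open>f\<close>
  at proper subsets.\<close>

lemma conv_cancel:
  assumes "finite I" "g {} = 1" "\<And>J. J \<subseteq> I \<Longrightarrow> (f \<star> g) J = (f' \<star> g) J"
  shows "f I = f' I"
  using assms(1,3)
proof (induction I rule: finite_psubset_induct)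
  case (psubset I)
  have "f B = f' B" if "B \<subset> I" for B
    using that psubset.prems by (intro psubset.IH) auto
  then have "(\<Sum>B | B \<subset> I. f B * g (I - B)) = (\<Sum>B | B \<subset> I. f' B * g (I - B))"
    by (intro sum.cong) auto
  then show ?case
    using psubset.prems[of I] conv_split_left[OF psubset.hyps, of f g]
      conv_split_left[OF psubset.hyps, of f' g] assms(2) by simp
qed

text \<open>Division of series with denominator of constant term 1, solved for the summand
  \<open>B = I\<close>. The test for finiteness makes the recursion on proper subsets
  terminate.\<close>

function conv_quot :: "(nat set \<Rightarrow> 'c::comm_ring_1) \<Rightarrow> (nat set \<Rightarrow> 'c) \<Rightarrow> nat set \<Rightarrow> 'c" where
  "conv_quot v u I =
     (if finite I then v I - (\<Sum>B\<in>{B. B \<subset> I}. conv_quot v u B * u (I - B)) else 0)"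
  by auto
termination
  by (relation "measure (\<lambda>(v, u, I). card I)") (auto intro: psubset_card_mono)

declare conv_quot.simps[simp del]

lemma conv_quot_conv:
  assumes "finite I" "u {} = 1"
  shows "(conv_quot v u \<star> u) I = v I"
  using assms by (simp add: conv_split_left conv_quot.simps[of v u I])

text \<open>The coefficients of \<open>log U\<close>, over any commutative ring, so that the notion
  serves both for polynomials and for their leading coefficients.\<close>

definition cumul :: "(nat set \<Rightarrow> 'c::comm_ring_1) \<Rightarrow> nat set \<Rightarrow> 'c" where
  "cumul u A = (\<Sum>\<pi> | partition_on A \<pi>. of_int (moebius_top \<pi>) * (\<Prod>B\<in>\<pi>. u B))"

lemma cumul_cong:
  assumes "\<And>B. B \<subseteq> A \<Longrightarrow> u B = u' B"
  shows "cumul u A = cumul u' A"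
  unfolding cumul_def
proof (intro sum.cong arg_cong2[of _ _ _ _ "(*)"] prod.cong refl)
  fix \<pi> B assume "\<pi> \<in> {\<pi>. partition_on A \<pi>}" "B \<in> \<pi>"
  then show "u B = u' B" by (intro assms) (auto simp: partition_on_def)
qed

text \<open>With \<open>k = card \<rho> - 1\<close> the terms are (-1)^k k! and k (-1)^(k-1) (k-1)!,
  which cancel for k > 0. For k = 0 the factor k removes the term with the truncated
  exponent.\<close>

lemma moebius_top_sum:
  assumes "finite \<rho>" "\<rho> \<noteq> {}"
  shows "moebius_top \<rho> + int (card \<rho> - 1) * ((-1) ^ (card \<rho> - 2) * fact (card \<rho> - 2))
       = (if card \<rho> = 1 then 1 else 0)"
proof -
  obtain k where k: "card \<rho> = Suc k" using assms by (cases "card \<rho>") auto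
  show ?thesis unfolding moebius_top_def k by (cases k) (auto simp: algebra_simps)
qed

text \<open>Merging a pair \<open>(\<pi>, J - B)\<close> into a set partition \<open>\<rho>\<close> of \<open>insert i J\<close> reaches each \<open>\<rho>\<close> once
  for every block that avoids \<open>i\<close>, and the coefficients cancel unless \<open>\<rho>\<close> has one block.\<close>

lemma cumul_recursion:
  fixes u :: "nat set \<Rightarrow> 'c::comm_ring_1"
  assumes "finite J" "i \<notin> J" "u {} = 1"
  shows "((\<lambda>B. cumul u (insert i B)) \<star> u) J = u (insert i J)"
proof -
  let ?A = "insert i J"
  let ?P = "\<lambda>A. {\<pi>. partition_on A \<pi>}"
  let ?w = "\<lambda>\<pi>. \<Prod>B\<in>\<pi>. u B"
  have finP: "finite (?P A)" if "finite A" for A :: "nat set"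
    using finitely_many_partition_on[OF that] .
  have fin\<rho>: "finite \<rho>" if "partition_on ?A \<rho>" for \<rho>
    using finite_elements[OF _ that] assms(1) by simp
  \<comment> \<open>Here \<open>card \<rho> - 2\<close> equals \<open>card \<pi> - 1\<close>, since
    \<open>\<rho>\<close> arises from \<open>\<pi>\<close> by adding the nonempty block
    \<open>J - B\<close>. The summand \<open>B = J\<close>, where no block is added, is kept
    apart.\<close>
  have 1: "(\<Sum>B | B \<subset> J. cumul u (insert i B) * u (J - B))
      = (\<Sum>(\<rho>, C)\<in>Sigma (?P ?A) (\<lambda>\<rho>. {C\<in>\<rho>. i \<notin> C}).
           of_int ((-1) ^ (card \<rho> - 2) * fact (card \<rho> - 2)) * ?w \<rho>)"
  proof -
    have "(\<Sum>B | B \<subset> J. cumul u (insert i B) * u (J - B))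
        = (\<Sum>(B, \<pi>)\<in>Sigma {B. B \<subset> J} (\<lambda>B. ?P (insert i B)).
             of_int (moebius_top \<pi>) * ?w \<pi> * u (J - B))"
      using assms(1) unfolding cumul_def sum_distrib_right
      by (subst sum.Sigma) (auto intro!: finP intro: finite_subset)
    also have "\<dots> = (\<Sum>(\<rho>, C)\<in>Sigma (?P ?A) (\<lambda>\<rho>. {C\<in>\<rho>. i \<notin> C}).
           of_int ((-1) ^ (card \<rho> - 2) * fact (card \<rho> - 2)) * ?w \<rho>)"
    proof (rule sum.reindex_bij_witness[of _ "\<lambda>(\<rho>, C). (J - C, \<rho> - {C})"
          "\<lambda>(B, \<pi>). (insert (J - B) \<pi>, J - B)"])
      fix x assume x: "x \<in> Sigma {B. B \<subset> J} (\<lambda>B. ?P (insert i B))"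
      then obtain B \<pi> where [simp]: "x = (B, \<pi>)" and B: "B \<subset> J" and \<pi>: "partition_on (insert i B) \<pi>"
        by auto
      have ni: "J - B \<notin> \<pi>" using B \<pi> assms(2) by (auto simp: partition_on_def)
      have D: "disjnt (J - B) (\<Union>\<pi>)"
        using \<pi> assms(2) partition_onD1[OF \<pi>] by (auto simp: disjnt_def)
      have ins: "partition_on ?A (insert (J - B) \<pi>)"
        using D \<pi> B assms(2) by (subst partition_on_insert) (auto simp: insert_Diff_if double_diff)
      have dd: "J - (J - B) = B" using B by auto
      show "(\<lambda>(\<rho>, C). (J - C, \<rho> - {C})) ((\<lambda>(B, \<pi>). (insert (J - B) \<pi>, J - B)) x) = x"
        using ni dd by simp
      show "(\<lambda>(B, \<pi>). (insert (J - B) \<pi>, J - B)) x \<in> Sigma (?P ?A) (\<lambda>\<rho>. {C\<in>\<rho>. i \<notin> C})"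
        using ins assms(2) by auto
      have fin: "finite \<pi>" using fin\<rho>[OF ins] by simp
      have pos: "card \<pi> \<noteq> 0" using fin \<pi> by (auto simp: partition_on_def)
      show "(case (\<lambda>(B, \<pi>). (insert (J - B) \<pi>, J - B)) x of (\<rho>, C) \<Rightarrow>
            of_int ((-1) ^ (card \<rho> - 2) * fact (card \<rho> - 2)) * ?w \<rho>)
          = (case x of (B, \<pi>) \<Rightarrow> of_int (moebius_top \<pi>) * ?w \<pi> * u (J - B))"
        using fin ni pos by (simp add: moebius_top_def algebra_simps)
    next
      fix y assume y: "y \<in> Sigma (?P ?A) (\<lambda>\<rho>. {C\<in>\<rho>. i \<notin> C})"
      then obtain \<rho> C where [simp]: "y = (\<rho>, C)" and \<rho>: "partition_on ?A \<rho>" and C: "C \<in> \<rho>" "i \<notin> C"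
        by auto
      have sub: "C \<subseteq> J" "C \<noteq> {}" using C \<rho> by (auto simp: partition_on_def)
      have dd: "J - (J - C) = C" using sub by auto
      have "disjnt C (\<Union>(\<rho> - {C}))"
        using pairwiseD[OF partition_onD2[OF \<rho>] C(1)] by (auto simp: disjnt_Union2)
      moreover have "insert C (\<rho> - {C}) = \<rho>" using C by auto
      ultimately have "partition_on (?A - C) (\<rho> - {C})"
        using \<rho> partition_on_insert[of C "\<rho> - {C}" ?A] by simp
      moreover have "?A - C = insert i (J - C)" using C by auto
      ultimately show "(\<lambda>(\<rho>, C). (J - C, \<rho> - {C})) y \<in> Sigma {B. B \<subset> J} (\<lambda>B. ?P (insert i B))"
        using sub by auto
      show "(\<lambda>(B, \<pi>). (insert (J - B) \<pi>, J - B)) ((\<lambda>(\<rho>, C). (J - C, \<rho> - {C})) y) = y"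
        using dd C by auto
    qed
    finally show ?thesis .
  qed
  also have "\<dots> = (\<Sum>\<rho> | partition_on ?A \<rho>. of_nat (card {C\<in>\<rho>. i \<notin> C}) *
           (of_int ((-1) ^ (card \<rho> - 2) * fact (card \<rho> - 2)) * ?w \<rho>))"
    using assms(1) fin\<rho> by (subst sum.Sigma[symmetric]) (auto intro!: finP)
  also have "\<dots> = (\<Sum>\<rho> | partition_on ?A \<rho>. of_int (int (card \<rho> - 1)
           * ((-1) ^ (card \<rho> - 2) * fact (card \<rho> - 2))) * ?w \<rho>)"
  proof (intro sum.cong refl)
    fix \<rho> assume "\<rho> \<in> ?P ?A"
    then have \<rho>: "partition_on ?A \<rho>" by simp
    then obtain B where B: "B \<in> \<rho>" "i \<in> B" using partition_onD1[OF \<rho>] by blast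
    have "{C\<in>\<rho>. i \<notin> C} = \<rho> - {B}"
      using \<rho> B unfolding partition_on_def pairwise_def disjnt_def by blast
    then have "card {C\<in>\<rho>. i \<notin> C} = card \<rho> - 1" using B fin\<rho>[OF \<rho>] by simp
    then show "of_nat (card {C\<in>\<rho>. i \<notin> C}) *
           (of_int ((-1) ^ (card \<rho> - 2) * fact (card \<rho> - 2)) * ?w \<rho>)
        = of_int (int (card \<rho> - 1) * ((-1) ^ (card \<rho> - 2) * fact (card \<rho> - 2))) * ?w \<rho>"
      by (simp add: algebra_simps)
  qed
  finally have "((\<lambda>B. cumul u (insert i B)) \<star> u) J
      = (\<Sum>\<rho> | partition_on ?A \<rho>. of_int (moebius_top \<rho> +
           int (card \<rho> - 1) * ((-1) ^ (card \<rho> - 2) * fact (card \<rho> - 2))) * ?w \<rho>)"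
    unfolding conv_split_left[OF assms(1)] using assms(3)
    by (simp only: cumul_def mult_1_right of_int_add distrib_right sum.distrib)
  also have "\<dots> = (\<Sum>\<rho> | partition_on ?A \<rho>. if \<rho> = {?A} then u ?A else 0)"
  proof (intro sum.cong refl)
    fix \<rho> assume "\<rho> \<in> ?P ?A"
    then have \<rho>: "partition_on ?A \<rho>" by simp
    have ne: "\<rho> \<noteq> {}" using \<rho> by (auto simp: partition_on_def)
    have "card \<rho> = 1 \<longleftrightarrow> \<rho> = {?A}"
      using \<rho> by (auto simp: card_1_singleton_iff partition_on_def)
    then show "of_int (moebius_top \<rho> +
           int (card \<rho> - 1) * ((-1) ^ (card \<rho> - 2) * fact (card \<rho> - 2))) * ?w \<rho>
        = (if \<rho> = {?A} then u ?A else 0)"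
      unfolding moebius_top_sum[OF fin\<rho>[OF \<rho>] ne] by auto
  qed
  also have "\<dots> = u ?A"
    using finP[of ?A] assms(1) partition_on_space[of ?A] by simp
  finally show ?thesis .
qed

text \<open>The logarithmic derivative is the only solution \<open>k\<close> of the linear equation
  saying that \<open>k\<close> times U is the derivative of U. Cumulants of modified families are
  computed by guessing \<open>k\<close>, without set partitions.\<close>

lemma cumul_unique:
  assumes "finite J" "i \<notin> J" "u {} = 1"
    and "\<And>B. B \<subseteq> J \<Longrightarrow> (k \<star> u) B = u (insert i B)"
  shows "cumul u (insert i J) = k J"
proof (rule conv_cancel[of J u])
  fix B assume "B \<subseteq> J"
  then show "((\<lambda>B. cumul u (insert i B)) \<star> u) B = (k \<star> u) B"
    using assms by (subst cumul_recursion) (auto intro: finite_subset)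
qed (use assms in auto)


section \<open>Filtered rings\<close>

text \<open>\<open>F n\<close> stands for the elements of order at least \<open>n\<close> in q - 1.
  \<open>F 0\<close> is a subring and need not be the whole ring, as elements with a pole lie
  outside it.\<close>

locale ring_filtration =
  fixes F :: "nat \<Rightarrow> 'c::comm_ring_1 set"
  assumes F_zero: "0 \<in> F n"
    and F_one: "1 \<in> F 0"
    and F_add: "x \<in> F n \<Longrightarrow> y \<in> F n \<Longrightarrow> x + y \<in> F n"
    and F_uminus: "x \<in> F n \<Longrightarrow> - x \<in> F n"
    and F_mult: "x \<in> F m \<Longrightarrow> y \<in> F n \<Longrightarrow> x * y \<in> F (m + n)"
    and F_Suc: "F (Suc n) \<subseteq> F n"
begin

lemma F_diff: "x \<in> F n \<Longrightarrow> y \<in> F n \<Longrightarrow> x - y \<in> F n"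
  using F_add[of x n "- y"] F_uminus by simp

lemma F_sum: "(\<And>i. i \<in> A \<Longrightarrow> f i \<in> F n) \<Longrightarrow> sum f A \<in> F n"
  by (induction A rule: infinite_finite_induct) (auto simp: F_zero F_add)

lemma F_mono: "m \<le> n \<Longrightarrow> F n \<subseteq> F m"
  using lift_Suc_antimono_le[of F] F_Suc by blast

lemma F_mult_le: "x \<in> F m \<Longrightarrow> y \<in> F n \<Longrightarrow> k \<le> m + n \<Longrightarrow> x * y \<in> F k"
  using F_mult F_mono by blast

lemma F_mult0: "x \<in> F 0 \<Longrightarrow> y \<in> F n \<Longrightarrow> x * y \<in> F n"
  using F_mult[of x 0] by simp

lemma F_conv:
  assumes "finite I" "\<And>B. B \<subseteq> I \<Longrightarrow> f B \<in> F (card B)" "\<And>B. B \<subseteq> I \<Longrightarrow> g B \<in> F (card B)"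
  shows "(f \<star> g) I \<in> F (card I)"
  unfolding subset_conv_def
proof (intro F_sum)
  fix B assume B: "B \<in> Pow I"
  then have "card I \<le> card B + card (I - B)"
    using assms(1) by (simp add: card_Diff_subset finite_subset)
  then show "f B * g (I - B) \<in> F (card I)"
    using B assms by (intro F_mult_le[of _ "card B" _ "card (I - B)"]) auto
qed

text \<open>All nonempty subsets are included because the exponentials of twisted differences at a
  set involve the cumulants of its subsets.\<close>

definition small_cumulants :: "nat set \<Rightarrow> (nat set \<Rightarrow> 'c) \<Rightarrow> bool" where
  "small_cumulants A u \<longleftrightarrow> (\<forall>B\<subseteq>A. B \<noteq> {} \<longrightarrow> cumul u B \<in> F (card B - 1))"

lemma small_cumulants_mono: "small_cumulants A u \<Longrightarrow> B \<subseteq> A \<Longrightarrow> small_cumulants B u"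
  unfolding small_cumulants_def by auto

lemma small_cumulants_insert:
  assumes "finite A" "small_cumulants A u" "insert i B \<subseteq> A" "i \<notin> B"
  shows "cumul u (insert i B) \<in> F (card B)"
proof -
  have "card (insert i B) - 1 = card B" using assms finite_subset by fastforce
  then show ?thesis using assms(2,3) unfolding small_cumulants_def by (metis insert_not_empty)
qed

text \<open>The series of the constant family is the exponential of the sum of the variables, so its
  logarithm is linear and cumulants of size above 1 vanish. This is the start for building up
  products.\<close>

lemma small_cumulants_ones: "finite A \<Longrightarrow> small_cumulants A (\<lambda>_. 1)"
  unfolding small_cumulants_def
proof (intro allI impI)
  fix B assume B: "finite A" "B \<subseteq> A" "B \<noteq> {}"
  then obtain i J where J: "B = insert i J" "i \<notin> J" by (meson all_not_in_conv mk_disjoint_insert)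
  have fin: "finite J" using B J finite_subset by auto
  have "cumul (\<lambda>_. 1) (insert i J) = (if J = {} then 1 else 0 :: 'c)"
  proof (rule cumul_unique[OF fin J(2)])
    fix C assume "C \<subseteq> J"
    then have "finite C" using fin finite_subset by blast
    have "((\<lambda>J. if J = {} then 1 else 0) \<star> (\<lambda>_. 1)) C = (\<Sum>B\<in>Pow C. if B = {} then 1 else 0 :: 'c)"
      by (simp add: subset_conv_def)
    then show "((\<lambda>J. if J = {} then 1 else 0) \<star> (\<lambda>_. 1)) C = (1 :: 'c)"
      using \<open>finite C\<close> by simp
  qed simp
  then show "cumul (\<lambda>_. 1) B \<in> F (card B - 1)"
    using J B by (auto simp: F_one F_zero)
qed

end

text \<open>A twist acts on functions of finite sets like a ring endomorphism that is the identity to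
  first order. Both the shift \<open>x\<^sub>k \<mapsto> x\<^sub>k / q\<close> and the multiplication by a multiplicative
  character of \<open>I\<close> are of this form.\<close>

locale twist = ring_filtration F for F :: "nat \<Rightarrow> 'c::comm_ring_1 set" +
  fixes s :: "nat set \<Rightarrow> 'c \<Rightarrow> 'c"
  assumes s_add: "s I (x + y) = s I x + s I y"
    and s_mult: "finite A \<Longrightarrow> finite B \<Longrightarrow> A \<inter> B = {} \<Longrightarrow> s (A \<union> B) (x * y) = s A x * s B y"
    and s_one: "s {} 1 = 1"
    and s_close: "x \<in> F n \<Longrightarrow> s I x - x \<in> F (Suc n)"
begin

lemma s_zero: "s I 0 = 0"
  using s_add[of I 0 0] by simp

lemma s_sum: "s I (sum f A) = (\<Sum>a\<in>A. s I (f a))"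
  by (induction A rule: infinite_finite_induct) (auto simp: s_zero s_add)

lemma s_F: "x \<in> F n \<Longrightarrow> s I x \<in> F n"
  using F_add[OF subsetD[OF F_Suc s_close[of x n I]], of x] by simp

definition texp :: "(nat set \<Rightarrow> 'c) \<Rightarrow> nat set \<Rightarrow> 'c" where
  "texp u = conv_quot (\<lambda>I. s I (u I)) u"

lemma texp_conv: "finite I \<Longrightarrow> u {} = 1 \<Longrightarrow> (texp u \<star> u) I = s I (u I)"
  unfolding texp_def by (rule conv_quot_conv)

lemma texp_empty: "u {} = 1 \<Longrightarrow> texp u {} = 1"
  using texp_conv[of "{}" u] by (simp add: subset_conv_def s_one)

text \<open>The twist is multiplicative over disjoint sets, so it acts on both factors of
  \<open>k \<star> u\<close>; the twisted \<open>u\<close> is then rewritten as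
  \<open>texp u \<star> u\<close>.\<close>

lemma s_insert:
  assumes "finite J" "i \<notin> J" "u {} = 1" and "\<And>B. B \<subseteq> J \<Longrightarrow> (k \<star> u) B = v (insert i B)"
  shows "s (insert i J) (v (insert i J)) = (((\<lambda>B. s (insert i B) (k B)) \<star> texp u) \<star> u) J"
proof -
  have "s (insert i J) (v (insert i J)) = (\<Sum>B\<in>Pow J. s (insert i J) (k B * u (J - B)))"
    using assms(4)[of J] by (simp add: subset_conv_def s_sum flip: assms(4))
  also have "\<dots> = (\<Sum>B\<in>Pow J. s (insert i B) (k B) * s (J - B) (u (J - B)))"
  proof (intro sum.cong refl)
    fix B assume B: "B \<in> Pow J"
    then have "insert i J = insert i B \<union> (J - B)" by auto
    then show "s (insert i J) (k B * u (J - B)) = s (insert i B) (k B) * s (J - B) (u (J - B))"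
      using B assms(1,2) s_mult[of "insert i B" "J - B"] by (metis Diff_disjoint Diff_iff
        Int_insert_left_if0 PowD finite.insertI finite_Diff finite_subset)
  qed
  also have "\<dots> = ((\<lambda>B. s (insert i B) (k B)) \<star> (texp u \<star> u)) J"
    unfolding subset_conv_def[of "\<lambda>B. s (insert i B) (k B)"] using assms(1,3)
    by (intro sum.cong) (auto simp: texp_conv)
  also have "\<dots> = (((\<lambda>B. s (insert i B) (k B)) \<star> texp u) \<star> u) J"
    using assms(1) by (simp add: conv_assoc)
  finally show ?thesis .
qed

text \<open>With \<open>U\<close> the generating function of \<open>u\<close>, the function \<open>texp u\<close> is \<open>s U / U\<close>, and its
  logarithmic derivative is that of \<open>s U\<close> minus that of \<open>U\<close>.\<close>

lemma texp_insert:
  assumes "finite J" "i \<notin> J" "u {} = 1"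
  shows "texp u (insert i J) =
    ((\<lambda>B. s (insert i B) (cumul u (insert i B)) - cumul u (insert i B)) \<star> texp u) J"
    (is "_ = (?D \<star> _) J")
proof -
  let ?K = "\<lambda>B. cumul u (insert i B)"
  let ?sK = "\<lambda>B. s (insert i B) (?K B)"
  show ?thesis
  proof (rule conv_cancel[of J u "\<lambda>J. texp u (insert i J)"])
    fix I assume I: "I \<subseteq> J"
    then have fin: "finite I" and i: "i \<notin> I" using assms by (auto intro: finite_subset)
    have rec: "(?K \<star> u) B = u (insert i B)" if "B \<subseteq> I" for B
      using that fin i assms(3) by (intro cumul_recursion) (auto intro: finite_subset)
    have "((\<lambda>J. texp u (insert i J)) \<star> u) I = s (insert i I) (u (insert i I)) - (texp u \<star> (\<lambda>J. u (insert i J))) I"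
      using conv_insert[OF fin i, of "texp u" u] texp_conv[of "insert i I" u] fin assms(3) by simp
    also have "s (insert i I) (u (insert i I)) = ((?sK \<star> texp u) \<star> u) I"
      using rec by (intro s_insert) (use fin i assms(3) in auto)
    also have "(texp u \<star> (\<lambda>J. u (insert i J))) I = (texp u \<star> (?K \<star> u)) I"
      using rec by (intro conv_cong) auto
    also have "\<dots> = ((texp u \<star> ?K) \<star> u) I"
      using fin by (simp add: conv_assoc)
    also have "\<dots> = ((?K \<star> texp u) \<star> u) I"
      by (intro conv_cong conv_commute refl)
    also have "((?sK \<star> texp u) \<star> u) I - ((?K \<star> texp u) \<star> u) I = ((?D \<star> texp u) \<star> u) I"
      by (simp only: conv_diff_left[symmetric])
    finally show "((\<lambda>J. texp u (insert i J)) \<star> u) I = ((?D \<star> texp u) \<star> u) I" .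
  qed (use assms in auto)
qed

text \<open>In \<open>texp_insert\<close> the twisted difference at \<open>insert i B\<close> has
  order \<open>card B + 1\<close> and the other factor, by induction, order
  \<open>card (J - B)\<close>. Together these make up \<open>card I\<close>.\<close>

lemma texp_F:
  assumes "finite I" "u {} = 1" "small_cumulants I u"
  shows "texp u I \<in> F (card I)"
  using assms(1,3)
proof (induction I rule: finite_psubset_induct)
  case (psubset I)
  show ?case
  proof (cases "I = {}")
    case True
    then show ?thesis using texp_empty assms(2) by (simp add: F_one)
  next
    case False
    then obtain i J where I: "I = insert i J" "i \<notin> J" by (meson all_not_in_conv mk_disjoint_insert)
    have fin: "finite J" using psubset.hyps I by simp
    let ?d = "\<lambda>B. s (insert i B) (cumul u (insert i B)) - cumul u (insert i B)"
    have "?d B * texp u (J - B) \<in> F (card I)" if B: "B \<subseteq> J" for B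
    proof (rule F_mult_le)
      show "?d B \<in> F (Suc (card B))"
        using B I psubset.hyps psubset.prems by (intro s_close small_cumulants_insert[of I]) auto
      show "texp u (J - B) \<in> F (card (J - B))"
        using B I psubset.prems by (intro psubset.IH) (auto intro: small_cumulants_mono)
      show "card I \<le> Suc (card B) + card (J - B)"
        using B I fin by (simp add: card_Diff_subset finite_subset)
    qed
    then show ?thesis
      unfolding I(1) texp_insert[of J i u, OF fin I(2) assms(2)] subset_conv_def
      by (intro F_sum) (auto simp flip: I(1))
  qed
qed

text \<open>The summand \<open>B = J\<close> of \<open>texp_insert\<close> is the linear term of the
  exponential. The other summands involve only cumulants of proper subsets, so nothing has to be
  known about the cumulant of \<open>I\<close> itself.\<close>

lemma texp_first_order:
  assumes "finite I" "I \<noteq> {}" "u {} = 1" "\<And>B. B \<subset> I \<Longrightarrow> small_cumulants B u"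
  shows "texp u I - (s I (cumul u I) - cumul u I) \<in> F (card I)"
proof -
  obtain i J where I: "I = insert i J" "i \<notin> J" using assms(2) by (meson all_not_in_conv mk_disjoint_insert)
  have fin: "finite J" using assms(1) I by simp
  let ?d = "\<lambda>B. s (insert i B) (cumul u (insert i B)) - cumul u (insert i B)"
  have "texp u I = ?d J + (\<Sum>B | B \<subset> J. ?d B * texp u (J - B))"
    unfolding I(1) texp_insert[of J i u, OF fin I(2) assms(3)] conv_split_left[OF fin]
    using assms(3) by (simp add: texp_empty)
  moreover have "?d B * texp u (J - B) \<in> F (card I)" if B: "B \<subset> J" for B
  proof (rule F_mult_le)
    have "insert i B \<subset> I" using B I by auto
    then show "?d B \<in> F (Suc (card B))"
      using B I assms(1) by (intro s_close small_cumulants_insert[of "insert i B"] assms(4))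
        (auto intro: finite_subset)
    show "texp u (J - B) \<in> F (card (J - B))"
      using B I fin assms by (intro texp_F) auto
    show "card I \<le> Suc (card B) + card (J - B)"
      using B I fin by (auto simp: card_Diff_subset finite_subset psubset_imp_subset)
  qed
  ultimately show ?thesis
    using I by (auto intro!: F_sum)
qed

end

section \<open>Twists by multiplicative characters, and families changed by one factor\<close>

locale character_twist = ring_filtration F for F :: "nat \<Rightarrow> 'c::comm_ring_1 set" +
  fixes c :: "nat \<Rightarrow> 'c"
  assumes c_close: "c i - 1 \<in> F 1"
begin

lemma prod_c_close: "(\<Prod>i\<in>I. c i) - 1 \<in> F 1"
proof (induction I rule: infinite_finite_induct)
  case (insert i I)
  have "(c i - 1) * ((\<Prod>i\<in>I. c i) - 1) \<in> F 1"
    using F_mult[OF c_close insert.IH] F_Suc by force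
  then have "(c i - 1) * ((\<Prod>i\<in>I. c i) - 1) + (c i - 1) + ((\<Prod>i\<in>I. c i) - 1) \<in> F 1"
    using insert.IH c_close F_add by blast
  moreover have "(c i - 1) * ((\<Prod>i\<in>I. c i) - 1) + (c i - 1) + ((\<Prod>i\<in>I. c i) - 1) = (\<Prod>i\<in>insert i I. c i) - 1"
    using insert.hyps by (simp add: algebra_simps)
  ultimately show ?case by metis
qed (simp_all add: F_zero)

definition cmul :: "nat set \<Rightarrow> 'c \<Rightarrow> 'c" where
  "cmul I x = (\<Prod>i\<in>I. c i) * x"

sublocale twist F cmul
proof
  fix I and x :: 'c and n assume "x \<in> F n"
  then have "((\<Prod>i\<in>I. c i) - 1) * x \<in> F (1 + n)" using prod_c_close by (intro F_mult)
  then show "cmul I x - x \<in> F (Suc n)" by (simp add: cmul_def algebra_simps)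
qed (auto simp: cmul_def algebra_simps prod.union_disjoint)

text \<open>The factor is attached exactly to the sets containing \<open>i\<close>, so the
  derivative in \<open>i\<close> of the new series is that of U minus \<open>x\<close> times its
  twist, while the series on sets avoiding \<open>i\<close> is unchanged. Dividing by U gives the
  new cumulants as \<open>?k\<close> minus \<open>x\<close> times
  \<open>?sk \<star> texp u\<close>.\<close>

lemma small_cumulants_mult:
  assumes "finite A" "u {} = 1" "small_cumulants A u" "x \<in> F 0"
    and u': "\<And>I. I \<subseteq> A \<Longrightarrow> u' I = (if i \<in> I then u I * (1 - x * (\<Prod>i\<in>I. c i)) else u I)"
  shows "small_cumulants A u'"
  unfolding small_cumulants_def
proof (intro allI impI)
  fix B assume B: "B \<subseteq> A" "B \<noteq> {}"
  show "cumul u' B \<in> F (card B - 1)"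
  proof (cases "i \<in> B")
    case False
    then have "cumul u' B = cumul u B" using B u' by (intro cumul_cong) (auto split: if_splits)
    then show ?thesis using assms(3) B by (simp add: small_cumulants_def)
  next
    case True
    then obtain J where J: "B = insert i J" "i \<notin> J" by (meson mk_disjoint_insert)
    have fin: "finite J" using B(1) J assms(1) finite_subset by auto
    let ?k = "\<lambda>B. cumul u (insert i B)"
    let ?sk = "\<lambda>B. cmul (insert i B) (?k B)"
    have kF: "?k I \<in> F (card I)" if "I \<subseteq> J" for I
      using that J B by (intro small_cumulants_insert[OF assms(1,3)]) auto
    have "cumul u' (insert i J) = ?k J - x * (?sk \<star> texp u) J"
    proof (rule cumul_unique[OF fin J(2)])
      show "u' {} = 1" using u' assms(2) by simp
      fix I assume I: "I \<subseteq> J"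
      then have fI: "finite I" and iI: "i \<notin> I" using fin J(2) by (auto intro: finite_subset)
      have IA: "C \<subseteq> A" if "C \<subseteq> insert i I" for C using that I J B by auto
      have "((\<lambda>J. ?k J - x * (?sk \<star> texp u) J) \<star> u') I = ((\<lambda>J. ?k J - x * (?sk \<star> texp u) J) \<star> u) I"
        using iI u' IA by (intro conv_cong refl) (metis subset_insertI2 subsetD)
      also have "\<dots> = (?k \<star> u) I - x * ((?sk \<star> texp u) \<star> u) I"
        by (simp only: conv_diff_left conv_mult_left)
      also have "((?sk \<star> texp u) \<star> u) I = cmul (insert i I) (u (insert i I))"
        using assms(2) by (intro s_insert[symmetric] cumul_recursion fI iI) (use fI iI in \<open>auto intro: finite_subset\<close>)
      also have "(?k \<star> u) I = u (insert i I)"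
        using assms(2) by (intro cumul_recursion fI iI)
      also have "u (insert i I) - x * cmul (insert i I) (u (insert i I)) = u' (insert i I)"
        using u'[OF IA[OF subset_refl]] by (simp add: cmul_def algebra_simps)
      finally show "((\<lambda>J. ?k J - x * (?sk \<star> texp u) J) \<star> u') I = u' (insert i I)" .
    qed
    also have "\<dots> \<in> F (card J)"
    proof (intro F_diff F_mult0 F_conv fin kF assms(4) subset_refl)
      fix I assume I: "I \<subseteq> J"
      show "?sk I \<in> F (card I)" by (intro s_F kF I)
      show "texp u I \<in> F (card I)"
        using I J B fin assms by (intro texp_F small_cumulants_mono[OF assms(3)]) (auto intro: finite_subset)
    qed
    finally show ?thesis using J fin by simp
  qed
qed

text \<open>The relation behind multiplication by a factor is read backwards. The unknown cumulant
  occurs in it both plainly and, in the top summand, twisted; together it is multiplied by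
  \<open>1 - x * ?\<chi>\<close>, which is invertible in \<open>F 0\<close>.\<close>

lemma small_cumulants_divide:
  assumes "finite A" "u {} = 1" "small_cumulants A u" "x \<in> F 0"
    and u': "\<And>I. I \<subseteq> A \<Longrightarrow> u I = (if i \<in> I then u' I * (1 - x * (\<Prod>i\<in>I. c i)) else u' I)"
    and unit: "\<And>I. I \<subseteq> A \<Longrightarrow> \<exists>y\<in>F 0. y * (1 - x * (\<Prod>i\<in>I. c i)) = 1"
  shows "small_cumulants A u'"
  unfolding small_cumulants_def
proof (intro allI impI)
  fix B assume B: "B \<subseteq> A" "B \<noteq> {}"
  have e1: "u' {} = 1" using u'[of "{}"] assms(2) by simp
  have same: "cumul u' B = cumul u B" if "i \<notin> B" "B \<subseteq> A" for B
    using that u' by (intro cumul_cong) (auto split: if_splits)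
  show "cumul u' B \<in> F (card B - 1)"
  proof (cases "i \<in> B")
    case False
    then show ?thesis using assms(3) B same by (simp add: small_cumulants_def)
  next
    case True
    then obtain J where J: "B = insert i J" "i \<notin> J" by (meson mk_disjoint_insert)
    have fin: "finite J" using B(1) J assms(1) finite_subset by auto
    let ?k = "\<lambda>B. cumul u' (insert i B)"
    let ?sk = "\<lambda>B. cmul (insert i B) (?k B)"
    have rec: "cumul u (insert i I) = ?k I - x * (?sk \<star> texp u') I" if I: "I \<subseteq> J" for I
    proof (rule cumul_unique)
      show fI: "finite I" and iI: "i \<notin> I" using I fin J(2) by (auto intro: finite_subset)
      show "u {} = 1" by fact
      fix C assume C: "C \<subseteq> I"
      then have fC: "finite C" and iC: "i \<notin> C" using fI iI by (auto intro: finite_subset)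
      have CA: "D \<subseteq> A" if "D \<subseteq> insert i C" for D using that C I J B by auto
      have "((\<lambda>J. ?k J - x * (?sk \<star> texp u') J) \<star> u) C = ((\<lambda>J. ?k J - x * (?sk \<star> texp u') J) \<star> u') C"
        using iC u' CA by (intro conv_cong refl) (metis subset_insertI2 subsetD)
      also have "\<dots> = (?k \<star> u') C - x * ((?sk \<star> texp u') \<star> u') C"
        by (simp only: conv_diff_left conv_mult_left)
      also have "((?sk \<star> texp u') \<star> u') C = cmul (insert i C) (u' (insert i C))"
        using e1 by (intro s_insert[symmetric] cumul_recursion fC iC) (use fC iC in \<open>auto intro: finite_subset\<close>)
      also have "(?k \<star> u') C = u' (insert i C)"
        using e1 by (intro cumul_recursion fC iC)
      also have "u' (insert i C) - x * cmul (insert i C) (u' (insert i C)) = u (insert i C)"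
        using u'[OF CA[OF subset_refl]] by (simp add: cmul_def algebra_simps)
      finally show "((\<lambda>J. ?k J - x * (?sk \<star> texp u') J) \<star> u) C = u (insert i C)" .
    qed
    \<comment> \<open>On subsets of \<open>J\<close>, which avoid \<open>i\<close>, the families
      \<open>u\<close> and \<open>u'\<close> agree, so the smallness of the cumulants of
      \<open>u\<close> suffices.\<close>
    have texpF: "texp u' I \<in> F (card I)" if I: "I \<subseteq> J" for I
    proof (rule texp_F)
      show "small_cumulants I u'"
        unfolding small_cumulants_def
      proof (intro allI impI)
        fix C assume C: "C \<subseteq> I" "C \<noteq> {}"
        then have "cumul u' C = cumul u C" using I J B by (intro same) auto
        then show "cumul u' C \<in> F (card C - 1)"
          using assms(3) C I J B by (auto simp: small_cumulants_def)
      qed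
    qed (use I fin e1 in \<open>auto intro: finite_subset\<close>)
    have "?k I \<in> F (card I)" if "I \<subseteq> J" for I
      using finite_subset[OF that fin] that
    proof (induction I rule: finite_psubset_induct)
      case (psubset I)
      let ?\<chi> = "\<Prod>i\<in>insert i I. c i"
      have "insert i I \<subseteq> A" using psubset.prems J B by auto
      then obtain y where y: "y \<in> F 0" "y * (1 - x * ?\<chi>) = 1" using unit by blast
      \<comment> \<open>The summand \<open>B = I\<close> of the convolution has moved to the
        left-hand side.\<close>
      have "(1 - x * ?\<chi>) * ?k I = cumul u (insert i I) + x * (\<Sum>B | B \<subset> I. ?sk B * texp u' (I - B))"
        unfolding rec[OF psubset.prems] conv_split_left[OF psubset.hyps] texp_empty[of u', OF e1]
        by (simp add: cmul_def[of "insert i I"] left_diff_distrib right_diff_distrib distrib_left mult_ac)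
      also have "\<dots> \<in> F (card I)"
      proof (intro F_add F_mult0[OF assms(4)] F_sum)
        show "cumul u (insert i I) \<in> F (card I)"
          using psubset.prems J B by (intro small_cumulants_insert[OF assms(1,3)]) auto
        fix C assume "C \<in> {B. B \<subset> I}"
        then have C: "C \<subset> I" by simp
        show "?sk C * texp u' (I - C) \<in> F (card I)"
        proof (rule F_mult_le)
          show "?sk C \<in> F (card C)" using C psubset.prems by (intro s_F psubset.IH) auto
          show "texp u' (I - C) \<in> F (card (I - C))" using psubset.prems by (intro texpF) auto
          show "card I \<le> card C + card (I - C)"
            using C psubset.hyps by (metis card_mono card_Diff_subset finite_subset le_add_diff_inverse psubset_imp_subset order_refl)
        qed
      qed
      finally have "y * ((1 - x * ?\<chi>) * ?k I) \<in> F (card I)" using y F_mult0 by blast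
      then show ?case using y(2) by (simp add: mult.assoc[symmetric])
    qed
    then have "?k J \<in> F (card J)" by simp
    then show ?thesis using J fin by simp
  qed
qed

end

section \<open>The local ring at \<open>q = 1\<close>\<close>

text \<open>\<open>R\<close> stands for the rational functions without a pole at \<open>q = 1\<close>. The separation axiom
  says that the difference of two eigenvalues is \<open>q - 1\<close> times a unit.\<close>

locale local_qt =
  fixes q t :: "'a::field" and R :: "'a set"
  assumes R_one: "1 \<in> R"
    and R_add: "x \<in> R \<Longrightarrow> y \<in> R \<Longrightarrow> x + y \<in> R"
    and R_uminus: "x \<in> R \<Longrightarrow> - x \<in> R"
    and R_mult: "x \<in> R \<Longrightarrow> y \<in> R \<Longrightarrow> x * y \<in> R"
    and q_R: "q \<in> R" and inverse_q_R: "inverse q \<in> R" and t_R: "t \<in> R"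
    and q_nonzero: "q \<noteq> 0" and t_nonzero: "t \<noteq> 0" and q_not_1: "q \<noteq> 1"
    and two_nonzero: "(2 :: 'a) \<noteq> 0"
    and node_inj: "q ^ m * t ^ i = q ^ n * t ^ j \<Longrightarrow> m = n \<and> i = j"
    and one_minus_unit: "k \<noteq> 0 \<Longrightarrow> \<exists>y\<in>R. y * (1 - q ^ a * t ^ k) = 1"
    and separation: "i < N \<Longrightarrow> \<nu> i \<noteq> \<mu> i \<Longrightarrow>
      \<exists>y\<in>R. y * (\<Sum>i<N. t ^ i * (inverse q ^ \<nu> i - inverse q ^ \<mu> i)) = q - 1"
begin

lemma R_zero: "0 \<in> R"
  using R_add[OF R_one R_uminus[OF R_one]] by simp

lemma R_power: "x \<in> R \<Longrightarrow> x ^ n \<in> R"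
  by (induction n) (auto simp: R_one R_mult)

definition O_one :: "nat \<Rightarrow> 'a set" where
  "O_one n = {(q - 1) ^ n * x |x. x \<in> R}"

lemma O_zero: "O_one 0 = R"
  by (simp add: O_one_def)

lemma R_O: "x \<in> R \<longleftrightarrow> x \<in> O_one 0"
  by (simp add: O_zero)

sublocale scalars: ring_filtration O_one
proof
  fix n show "0 \<in> O_one n" unfolding O_one_def using R_zero by force
  fix x y assume "x \<in> O_one n" "y \<in> O_one n"
  then show "x + y \<in> O_one n"
    unfolding O_one_def using R_add by (force simp flip: distrib_left)
next
  fix n x assume "x \<in> O_one n"
  then show "- x \<in> O_one n"
    unfolding O_one_def using R_uminus by (force simp flip: mult_minus_right)
next
  fix x y m n assume "x \<in> O_one m" "y \<in> O_one n"
  then obtain a b where "x = (q - 1) ^ m * a" "y = (q - 1) ^ n * b" "a \<in> R" "b \<in> R"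
    unfolding O_one_def by auto
  then have "x * y = (q - 1) ^ (m + n) * (a * b)" "a * b \<in> R"
    using R_mult by (auto simp: power_add)
  then show "x * y \<in> O_one (m + n)" unfolding O_one_def by blast
next
  fix n
  show "O_one (Suc n) \<subseteq> O_one n"
  proof
    fix x assume "x \<in> O_one (Suc n)"
    then obtain a where "x = (q - 1) ^ Suc n * a" "a \<in> R" unfolding O_one_def by auto
    moreover have "(q - 1) * a \<in> R"
      using calculation R_mult[OF R_add[OF q_R R_uminus[OF R_one]]] by simp
    ultimately show "x \<in> O_one n" unfolding O_one_def by (auto simp: mult_ac)
  qed
qed (simp add: O_one_def R_one)

lemma O_divide: "x \<in> O_one n \<Longrightarrow> x / (q - 1) ^ n \<in> R"
  unfolding O_one_def using q_not_1 by auto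

lemma O_Suc_cancel:
  assumes "(q - 1) * x \<in> O_one (Suc n)" shows "x \<in> O_one n"
  using assms q_not_1 unfolding O_one_def by (auto simp: mult.assoc)

lemma power_close:
  assumes "x \<in> R" "x - 1 \<in> O_one 1"
  shows "x ^ n - 1 \<in> O_one 1"
proof (induction n)
  case (Suc n)
  have "x ^ Suc n - 1 = x * (x ^ n - 1) + (x - 1)" by (simp add: algebra_simps)
  then show ?case using Suc assms by (auto intro!: scalars.F_mult0 scalars.F_add simp only: R_O)
qed (simp add: scalars.F_zero)

lemma q_power_close: "q ^ n - 1 \<in> O_one 1"
proof (rule power_close[OF q_R])
  show "q - 1 \<in> O_one 1" unfolding O_one_def using R_one by force
qed

lemma inverse_q_power_close: "inverse q ^ n - 1 \<in> O_one 1"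
proof (rule power_close[OF inverse_q_R])
  have "inverse q - 1 = (q - 1) ^ 1 * - inverse q" using q_nonzero by (simp add: field_simps)
  then show "inverse q - 1 \<in> O_one 1"
    unfolding O_one_def using R_uminus[OF inverse_q_R] by blast
qed

lemma one_minus_nonzero: "k \<noteq> 0 \<Longrightarrow> 1 - q ^ a * t ^ k \<noteq> 0"
  using one_minus_unit[of k a] by auto


section \<open>The normalising coefficients\<close>

text \<open>The q-Pochhammer symbol (t^k; q)_n.\<close>

definition qpoch :: "nat \<Rightarrow> nat \<Rightarrow> 'a" where
  "qpoch k n = (\<Prod>a<n. 1 - q ^ a * t ^ k)"

lemma qpoch_0 [simp]: "qpoch k 0 = 1"
  by (simp add: qpoch_def)

lemma qpoch_nonzero: "k \<noteq> 0 \<Longrightarrow> qpoch k n \<noteq> 0"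
  using one_minus_nonzero by (simp add: qpoch_def)

text \<open>Lowering a single \<open>d i\<close> by one removes from every set containing
  \<open>i\<close> the factor \<open>1 - t ^ k * q ^ s\<close>, where \<open>s\<close> is the sum of
  the lowered values. As a function of the set this is 1 minus \<open>t ^ k\<close> times a
  character, so the induction on the sum of \<open>d\<close> peels off one factor at a time.\<close>

lemma small_cumulants_qpoch:
  assumes "finite A" "u {} = 1" "scalars.small_cumulants A u" "k \<noteq> 0"
  shows "scalars.small_cumulants A (\<lambda>I. u I * qpoch k (\<Sum>j\<in>I. d j))"
    and "scalars.small_cumulants A (\<lambda>I. u I / qpoch k (\<Sum>j\<in>I. d j))"
proof (induction "\<Sum>j\<in>A. d j" arbitrary: d)
  case 0
  have z: "(\<Sum>j\<in>I. d j) = 0" if "I \<subseteq> A" for I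
    using sum_mono2[OF assms(1) that, of d] 0 by simp
  have "cumul (\<lambda>I. u I * qpoch k (\<Sum>j\<in>I. d j)) B = cumul u B"
       "cumul (\<lambda>I. u I / qpoch k (\<Sum>j\<in>I. d j)) B = cumul u B" if "B \<subseteq> A" for B
    using z that by (intro cumul_cong; auto)+
  then show "scalars.small_cumulants A (\<lambda>I. u I * qpoch k (\<Sum>j\<in>I. d j))"
    "scalars.small_cumulants A (\<lambda>I. u I / qpoch k (\<Sum>j\<in>I. d j))"
    using assms(3) by (simp_all add: scalars.small_cumulants_def)
next
  case (Suc n)
  have "\<not> (\<forall>i\<in>A. d i = 0)"
  proof
    assume "\<forall>i\<in>A. d i = 0"
    then have "(\<Sum>j\<in>A. d j) = 0" by simp
    then show False using Suc.hyps(3) by simp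
  qed
  then obtain i where i: "i \<in> A" "d i \<noteq> 0" by auto
  define d' where "d' = d(i := d i - 1)"
  have sum_d: "(\<Sum>j\<in>I. d j) = (if i \<in> I then Suc (\<Sum>j\<in>I. d' j) else (\<Sum>j\<in>I. d' j))"
    if "I \<subseteq> A" for I
  proof -
    have fin: "finite I" using that assms(1) finite_subset by blast
    have "(\<Sum>j\<in>I. d j) = (\<Sum>j\<in>I. d' j + (if j = i then 1 else 0))"
      using i by (intro sum.cong) (auto simp: d'_def)
    then show ?thesis using fin by (simp add: sum.distrib)
  qed
  have n: "n = (\<Sum>j\<in>A. d' j)" using sum_d[of A] i Suc.hyps(3) by simp
  interpret character_twist O_one "\<lambda>i. q ^ d' i"
    by unfold_locales (rule q_power_close)
  have pr: "(\<Prod>j\<in>I. q ^ d' j) = q ^ (\<Sum>j\<in>I. d' j)" for I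
    by (simp add: power_sum)
  show "scalars.small_cumulants A (\<lambda>I. u I * qpoch k (\<Sum>j\<in>I. d j))"
  proof (rule small_cumulants_mult[OF assms(1) _ Suc.hyps(1)[OF n]])
    show "t ^ k \<in> O_one 0" using R_power[OF t_R] by (simp add: R_O)
    fix I assume "I \<subseteq> A"
    then show "u I * qpoch k (\<Sum>j\<in>I. d j) =
      (if i \<in> I then u I * qpoch k (\<Sum>j\<in>I. d' j) * (1 - t ^ k * (\<Prod>j\<in>I. q ^ d' j))
       else u I * qpoch k (\<Sum>j\<in>I. d' j))"
      using sum_d by (simp add: pr qpoch_def mult_ac)
  qed (use assms in simp)
  show "scalars.small_cumulants A (\<lambda>I. u I / qpoch k (\<Sum>j\<in>I. d j))"
  proof (rule small_cumulants_divide[OF assms(1) _ Suc.hyps(2)[OF n]])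
    show "t ^ k \<in> O_one 0" using R_power[OF t_R] by (simp add: R_O)
    fix I assume "I \<subseteq> A"
    then show "u I / qpoch k (\<Sum>j\<in>I. d' j) =
      (if i \<in> I then u I / qpoch k (\<Sum>j\<in>I. d j) * (1 - t ^ k * (\<Prod>j\<in>I. q ^ d' j))
       else u I / qpoch k (\<Sum>j\<in>I. d j))"
      using sum_d one_minus_nonzero[OF assms(4), of "\<Sum>j\<in>I. d' j"]
      by (simp add: pr qpoch_def mult_ac)
    show "\<exists>y\<in>O_one 0. y * (1 - t ^ k * (\<Prod>j\<in>I. q ^ d' j)) = 1"
      using one_minus_unit[OF assms(4), of "\<Sum>j\<in>I. d' j"]
      by (simp only: pr O_zero mult.commute[of "t ^ k"])
  qed (use assms in simp)
qed

definition iform :: "nat list \<Rightarrow> 'a" where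
  "iform \<nu> = (\<Prod>i<length \<nu>. \<Prod>j<\<nu> ! i. 1 - q ^ arm \<nu> i j * t ^ (leg \<nu> i j + 1))"

lemma iform_nonzero: "iform \<nu> \<noteq> 0"
  using one_minus_nonzero[of "Suc _"] by (auto simp: iform_def simp del: power_Suc)

end

section \<open>Componentwise sums of partitions and products over rows\<close>

lemma partition_nth_mono:
  assumes "is_partition \<nu>" "i \<le> j"
  shows "nth_default 0 \<nu> j \<le> nth_default 0 \<nu> i"
proof (cases "i = j \<or> length \<nu> \<le> j")
  case False
  then show ?thesis using assms sorted_wrt_nth_less[of "(\<ge>)" \<nu> i j]
    by (auto simp: is_partition_def nth_default_def)
qed (auto simp: nth_default_def)

text \<open>The blocks \<open>{g (Suc l)..<g l}\<close> tile the range from right to left; equal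
  values of \<open>g\<close> give empty blocks, which contribute 1.\<close>

lemma prod_telescope_blocks:
  fixes g :: "nat \<Rightarrow> nat" and h :: "nat \<Rightarrow> 'c::comm_monoid_mult"
  assumes "antimono g"
  shows "(\<Prod>j\<in>{g L..<g 0}. h j) = (\<Prod>l<L. \<Prod>j\<in>{g (Suc l)..<g l}. h j)"
proof (induction L)
  case (Suc L)
  have "g (Suc L) \<le> g L" "g L \<le> g 0" using assms by (auto intro: antimonoD)
  then have "(\<Prod>j\<in>{g (Suc L)..<g 0}. h j) = (\<Prod>j\<in>{g (Suc L)..<g L}. h j) * (\<Prod>j\<in>{g L..<g 0}. h j)"
    by (simp add: prod.atLeastLessThan_concat)
  then show ?case using Suc by (simp add: mult.commute)
qed simp

lemma nth_default_oplus_family: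
  assumes "finite I"
  shows "nth_default 0 (oplus_family I \<Lambda>) k = (\<Sum>i\<in>I. nth_default 0 (\<Lambda> i) k)"
proof (cases "k < length (oplus_family I \<Lambda>)")
  case False
  have "length (\<Lambda> i) \<le> k" if "i \<in> I" for i
  proof -
    have "length (\<Lambda> i) \<le> length (oplus_family I \<Lambda>)"
      using that assms by (auto simp: oplus_family_def intro!: Max_ge)
    then show ?thesis using False by simp
  qed
  then have "(\<Sum>i\<in>I. nth_default 0 (\<Lambda> i) k) = 0"
    by (intro sum.neutral) (simp add: nth_default_def leD)
  then show ?thesis using False by (simp add: nth_default_def)
qed (auto simp: oplus_family_def nth_default_def[of _ "map _ _"])

lemma length_oplus_family_le:
  assumes "finite I" "\<And>i. i \<in> I \<Longrightarrow> length (\<Lambda> i) \<le> N"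
  shows "length (oplus_family I \<Lambda>) \<le> N"
  using assms by (auto simp: oplus_family_def)

lemma is_partition_oplus_family:
  assumes "finite I" "\<And>i. i \<in> I \<Longrightarrow> is_partition (\<Lambda> i)"
  shows "is_partition (oplus_family I \<Lambda>)"
  unfolding is_partition_def
proof
  let ?\<nu> = "oplus_family I \<Lambda>"
  show "sorted_wrt (\<ge>) ?\<nu>"
    unfolding sorted_wrt_iff_nth_less
  proof (intro allI impI)
    fix i j assume ij: "i < j" "j < length ?\<nu>"
    have "nth_default 0 ?\<nu> j \<le> nth_default 0 ?\<nu> i"
      unfolding nth_default_oplus_family[OF assms(1)]
      using ij assms by (intro sum_mono partition_nth_mono) auto
    then show "?\<nu> ! j \<le> ?\<nu> ! i" using ij by (simp add: nth_default_def)
  qed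
  show "\<forall>k\<in>set ?\<nu>. 0 < k"
  proof
    fix k assume "k \<in> set ?\<nu>"
    then obtain j where j: "j < length ?\<nu>" "k = ?\<nu> ! j" by (metis in_set_conv_nth)
    then have "j < Max (insert 0 ((\<lambda>i. length (\<Lambda> i)) ` I))" by (simp add: oplus_family_def)
    then have "\<exists>x\<in>insert 0 ((\<lambda>i. length (\<Lambda> i)) ` I). j < x" using assms(1) by (subst (asm) Max_gr_iff) auto
    then obtain i where i: "i \<in> I" "j < length (\<Lambda> i)" by auto
    have "0 < nth_default 0 (\<Lambda> i) j" using assms(2)[OF i(1)] i(2) by (simp add: is_partition_def nth_default_def)
    also have "\<dots> \<le> (\<Sum>i\<in>I. nth_default 0 (\<Lambda> i) j)" using i assms(1) by (intro member_le_sum) auto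
    also have "\<dots> = k" using j nth_default_oplus_family[OF assms(1), of \<Lambda> j] by (simp add: nth_default_def)
    finally show "0 < k" .
  qed
qed

context local_qt
begin

text \<open>In row \<open>i\<close> the boxes of leg length \<open>l\<close> occupy the columns from \<open>\<nu>\<^bsub>i+l+1\<^esub>\<close> to \<open>\<nu>\<^bsub>i+l\<^esub>\<close>.\<close>

lemma iform_qpoch:
  assumes \<nu>: "is_partition \<nu>" "length \<nu> \<le> N"
  defines "p \<equiv> nth_default 0 \<nu>"
  shows "iform \<nu> = (\<Prod>i<N. \<Prod>l<N - i.
    qpoch (Suc l) (p i - p (i + Suc l)) / qpoch (Suc l) (p i - p (i + l)))"
proof -
  have p0: "p i = 0" if "length \<nu> \<le> i" for i
    using that by (simp add: p_def nth_default_def)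
  have mono: "p j \<le> p i" if "i \<le> j" for i j
    using partition_nth_mono[OF \<nu>(1) that] by (simp add: p_def)
  have row: "(\<Prod>j<p i. 1 - q ^ arm \<nu> i j * t ^ (leg \<nu> i j + 1))
     = (\<Prod>l<N - i. qpoch (Suc l) (p i - p (i + Suc l)) / qpoch (Suc l) (p i - p (i + l)))"
    if "i < N" for i
  proof -
    define g where "g l = p (i + l)" for l
    have anti: "antimono g" unfolding g_def by (intro antimonoI mono) auto
    have "g (N - i) = 0" using that \<nu>(2) by (simp add: g_def p0)
    then have "(\<Prod>j<p i. 1 - q ^ arm \<nu> i j * t ^ (leg \<nu> i j + 1))
      = (\<Prod>l<N - i. \<Prod>j\<in>{g (Suc l)..<g l}. 1 - q ^ arm \<nu> i j * t ^ (leg \<nu> i j + 1))"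
      using prod_telescope_blocks[OF anti, where L = "N - i"] by (simp add: g_def lessThan_atLeast0)
    also have "\<dots> = (\<Prod>l<N - i. qpoch (Suc l) (p i - p (i + Suc l)) / qpoch (Suc l) (p i - p (i + l)))"
    proof (intro prod.cong refl)
      fix l
      have le: "g (Suc l) \<le> g l" "g l \<le> p i"
        using antimonoD[OF anti, of l "Suc l"] antimonoD[OF anti, of 0 l] by (auto simp: g_def)
      have "(\<Prod>j\<in>{g (Suc l)..<g l}. 1 - q ^ arm \<nu> i j * t ^ (leg \<nu> i j + 1))
        = (\<Prod>j\<in>{g (Suc l)..<g l}. 1 - q ^ (p i - Suc j) * t ^ Suc l)"
      proof (intro prod.cong refl)
        fix j assume j: "j \<in> {g (Suc l)..<g l}"
        have "{j'. j < j' \<and> j' < nth_default 0 \<nu> i} = {j<..<p i}" by (auto simp: p_def)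
        then have "arm \<nu> i j = p i - Suc j" by (simp add: arm_def)
        moreover have legs: "{i'. i < i' \<and> j < nth_default 0 \<nu> i'} = {i<..i + l}"
        proof (intro Set.set_eqI iffI)
          fix i' assume "i' \<in> {i'. i < i' \<and> j < nth_default 0 \<nu> i'}"
          then have "i < i'" "j < p i'" by (auto simp: p_def)
          moreover have "i' < i + Suc l"
          proof (rule ccontr)
            assume "\<not> ?thesis"
            then have "p i' \<le> g (Suc l)" using mono[of "i + Suc l" i'] by (simp add: g_def)
            then show False using j \<open>j < p i'\<close> by simp
          qed
          ultimately show "i' \<in> {i<..i + l}" by auto
        next
          fix i' assume i': "i' \<in> {i<..i + l}"
          then have "g l \<le> p i'" using mono[of i' "i + l"] by (simp add: g_def)
          then show "i' \<in> {i'. i < i' \<and> j < nth_default 0 \<nu> i'}" using i' j by (auto simp: p_def)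
        qed
        have "leg \<nu> i j = l" unfolding leg_def legs by simp
        ultimately show "1 - q ^ arm \<nu> i j * t ^ (leg \<nu> i j + 1) = 1 - q ^ (p i - Suc j) * t ^ Suc l"
          by simp
      qed
      \<comment> \<open>Within a block of constant leg length the arm lengths run through
        consecutive numbers, so the block is a quotient of two q-Pochhammer symbols.\<close>
      also have "\<dots> = (\<Prod>a\<in>{p i - g l..<p i - g (Suc l)}. 1 - q ^ a * t ^ Suc l)"
        by (rule prod.reindex_bij_witness[of _ "\<lambda>a. p i - Suc a" "\<lambda>j. p i - Suc j"])
           (use le in auto)
      also have "\<dots> = qpoch (Suc l) (p i - g (Suc l)) / qpoch (Suc l) (p i - g l)"
      proof -
        have "qpoch (Suc l) (p i - g (Suc l)) = qpoch (Suc l) (p i - g l) *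
          (\<Prod>a\<in>{p i - g l..<p i - g (Suc l)}. 1 - q ^ a * t ^ Suc l)"
          unfolding qpoch_def lessThan_atLeast0 using le by (subst prod.atLeastLessThan_concat) auto
        then show ?thesis using qpoch_nonzero[of "Suc l"] by (simp add: field_simps)
      qed
      finally show "(\<Prod>j\<in>{g (Suc l)..<g l}. 1 - q ^ arm \<nu> i j * t ^ (leg \<nu> i j + 1))
        = qpoch (Suc l) (p i - p (i + Suc l)) / qpoch (Suc l) (p i - p (i + l))"
        by (simp add: g_def)
    qed
    finally show ?thesis .
  qed
  have "iform \<nu> = (\<Prod>i<length \<nu>. \<Prod>j<p i. 1 - q ^ arm \<nu> i j * t ^ (leg \<nu> i j + 1))"
    unfolding iform_def by (intro prod.cong refl) (auto simp: p_def nth_default_def)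
  also have "\<dots> = (\<Prod>i<N. \<Prod>j<p i. 1 - q ^ arm \<nu> i j * t ^ (leg \<nu> i j + 1))"
    using \<nu>(2) by (intro prod.mono_neutral_left) (auto simp: p0)
  also have "\<dots> = (\<Prod>i<N. \<Prod>l<N - i.
    qpoch (Suc l) (p i - p (i + Suc l)) / qpoch (Suc l) (p i - p (i + l)))"
    by (intro prod.cong refl row) auto
  finally show ?thesis .
qed

text \<open>The hypothesis on a factor is quantified over all families \<open>u\<close>, so that the
  factors can be appended one after the other to the constant family 1.\<close>

lemma small_cumulants_prod:
  assumes "finite A" "finite X"
    and "\<And>x u. x \<in> X \<Longrightarrow> u {} = 1 \<Longrightarrow> scalars.small_cumulants A u \<Longrightarrow> scalars.small_cumulants A (\<lambda>I. u I * g x I)"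
    and "\<And>x. x \<in> X \<Longrightarrow> g x {} = 1"
  shows "scalars.small_cumulants A (\<lambda>I. \<Prod>x\<in>X. g x I)"
  using assms(2,3,4)
proof (induction X rule: finite_induct)
  case (insert x X)
  have "scalars.small_cumulants A (\<lambda>I. (\<Prod>x\<in>X. g x I) * g x I)"
    using insert by (intro insert.prems(1)) auto
  then show ?case using insert.hyps by (simp add: mult.commute)
qed (simp add: scalars.small_cumulants_ones assms(1))

text \<open>In \<open>iform_qpoch\<close> the set \<open>I\<close> enters only through differences
  of two rows, which are additive in \<open>I\<close>. The bound \<open>N\<close> is the number of
  rows for the whole of \<open>A\<close>, so all subsets share one index set of factors.\<close>

lemma small_cumulants_iform:
  assumes "finite A" "\<And>i. i \<in> A \<Longrightarrow> is_partition (\<Lambda> i)"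
  shows "scalars.small_cumulants A (\<lambda>I. iform (oplus_family I \<Lambda>))"
proof -
  define N where "N = length (oplus_family A \<Lambda>)"
  define p where "p k = nth_default 0 (\<Lambda> k)" for k
  define g where "g = (\<lambda>(i, l) I. qpoch (Suc l) (\<Sum>k\<in>I. p k i - p k (i + Suc l)) / qpoch (Suc l) (\<Sum>k\<in>I. p k i - p k (i + l)))"
  have "scalars.small_cumulants A (\<lambda>I. \<Prod>x\<in>Sigma {..<N} (\<lambda>i. {..<N - i}). g x I)"
  proof (intro small_cumulants_prod assms(1))
    fix x :: "nat \<times> nat" and u :: "nat set \<Rightarrow> 'a" assume u: "u {} = 1" "scalars.small_cumulants A u"
    obtain i l where x: "x = (i, l)" by (cases x)
    have "scalars.small_cumulants A (\<lambda>I. u I * qpoch (Suc l) (\<Sum>k\<in>I. p k i - p k (i + Suc l))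
       / qpoch (Suc l) (\<Sum>k\<in>I. p k i - p k (i + l)))"
      using u assms(1) by (intro small_cumulants_qpoch) auto
    then show "scalars.small_cumulants A (\<lambda>I. u I * g x I)" by (simp add: x g_def)
  qed (auto simp: g_def)
  moreover have "iform (oplus_family I \<Lambda>) = (\<Prod>x\<in>Sigma {..<N} (\<lambda>i. {..<N - i}). g x I)" if I: "I \<subseteq> A" for I
  proof -
    have fin: "finite I" using I assms(1) finite_subset by blast
    have len: "length (oplus_family I \<Lambda>) \<le> N"
      unfolding N_def oplus_family_def using I assms(1) by (auto intro!: Max_mono)
    \<comment> \<open>Truncated subtraction commutes with the sum because every summand is a
      difference of weakly decreasing parts.\<close>
    have diff: "(\<Sum>k\<in>I. p k i) - (\<Sum>k\<in>I. p k j) = (\<Sum>k\<in>I. p k i - p k j)" if "i \<le> j" for i j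
      using that I assms(2) by (intro sum_subtractf_nat[symmetric]) (auto simp: p_def intro!: partition_nth_mono)
    have "iform (oplus_family I \<Lambda>) = (\<Prod>i<N. \<Prod>l<N - i. g (i, l) I)"
      using I assms(2) fin
      by (subst iform_qpoch[OF is_partition_oplus_family len])
         (auto simp: nth_default_oplus_family diff g_def simp flip: p_def)
    then show ?thesis by (simp add: prod.Sigma)
  qed
  then have "cumul (\<lambda>I. iform (oplus_family I \<Lambda>)) B = cumul (\<lambda>I. \<Prod>x\<in>Sigma {..<N} (\<lambda>i. {..<N - i}). g x I) B"
    if "B \<subseteq> A" for B using that by (intro cumul_cong) auto
  ultimately show ?thesis by (simp add: scalars.small_cumulants_def)
qed

end

section \<open>Polynomials\<close>

abbreviation lookup where "lookup \<equiv> Poly_Mapping.lookup"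
abbreviation single where "single \<equiv> Poly_Mapping.single"
abbreviation keys where "keys \<equiv> Poly_Mapping.keys"
abbreviation map_key where "map_key \<equiv> Poly_Mapping.map_key"

lemma poly_mapping_sum_singles: "p = (\<Sum>m\<in>keys p. single m (lookup p m))"
  by (rule poly_mapping_eqI) (auto simp: lookup_sum lookup_single when_def in_keys_iff)

lemma times_sum_singles:
  fixes p r :: "'k::comm_monoid_add \<Rightarrow>\<^sub>0 'c::comm_semiring_0"
  shows "p * r = (\<Sum>a\<in>keys p. \<Sum>b\<in>keys r. single (a + b) (lookup p a * lookup r b))"
  by (subst poly_mapping_sum_singles[of p], subst poly_mapping_sum_singles[of r])
     (simp add: sum_product mult_single)

lemma lookup_times:
  fixes p r :: "'k::comm_monoid_add \<Rightarrow>\<^sub>0 'c::comm_semiring_0"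
  shows "lookup (p * r) m = (\<Sum>a\<in>keys p. \<Sum>b\<in>keys r. if a + b = m then lookup p a * lookup r b else 0)"
  by (simp add: times_sum_singles lookup_sum lookup_single when_def)

lemma lookup_single_times:
  fixes p :: "'k::cancel_comm_monoid_add \<Rightarrow>\<^sub>0 'c::comm_semiring_0"
  shows "lookup (single a c * p) (a + m) = c * lookup p m"
proof -
  have "lookup (single a c * p) (a + m) = (\<Sum>b\<in>keys p. if b = m then c * lookup p b else 0)"
    by (cases "c = 0") (auto simp: lookup_times intro!: sum.cong)
  then show ?thesis by (auto simp: in_keys_iff)
qed

lemma lookup_single_times_0:
  fixes p :: "'k::cancel_comm_monoid_add \<Rightarrow>\<^sub>0 'c::comm_semiring_0"
  shows "(\<And>m. a + m \<noteq> k) \<Longrightarrow> lookup (single a c * p) k = 0"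
  by (cases "c = 0") (auto simp: lookup_times intro!: sum.neutral)

lemma lookup_const_times [simp]:
  fixes p :: "'k::cancel_comm_monoid_add \<Rightarrow>\<^sub>0 'c::comm_semiring_0"
  shows "lookup (single 0 c * p) m = c * lookup p m"
  using lookup_single_times[of 0 c p m] by simp

text \<open>The universal property of a monoid algebra. Evaluation, rescaling of one variable and
  permutation of the variables are all instances.\<close>

locale mpol_hom =
  fixes C :: "'a::comm_ring_1 \<Rightarrow> 'r::comm_ring_1" and G :: "'k::comm_monoid_add \<Rightarrow> 'r"
  assumes C_0: "C 0 = 0" and C_1: "C 1 = 1" and C_add: "C (x + y) = C x + C y"
    and C_mult: "C (x * y) = C x * C y"
    and G_0: "G 0 = 1" and G_add: "G (m + n) = G m * G n"
begin

definition hom :: "('k \<Rightarrow>\<^sub>0 'a) \<Rightarrow> 'r" where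
  "hom p = (\<Sum>m\<in>keys p. C (lookup p m) * G m)"

lemma hom_add: "hom (p + r) = hom p + hom r"
  unfolding hom_def by (rule setsum_keys_plus_distrib) (simp_all add: C_0 C_add distrib_right)

lemma hom_single: "hom (single m c) = C c * G m"
  by (cases "c = 0") (simp_all add: hom_def C_0)

lemma hom_0: "hom 0 = 0"
  by (simp add: hom_def)

lemma hom_1: "hom 1 = 1"
  using hom_single[of 0 1] by (simp add: C_1 G_0)

lemma hom_sum: "hom (sum f A) = (\<Sum>a\<in>A. hom (f a))"
  by (induction A rule: infinite_finite_induct) (simp_all add: hom_0 hom_add)

lemma hom_diff: "hom (p - r) = hom p - hom r"
  using hom_add[of "p - r" r] by (simp add: algebra_simps)

lemma hom_mult: "hom (p * r) = hom p * hom r"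
  unfolding times_sum_singles
  by (simp add: hom_sum hom_single C_mult G_add hom_def[of p] hom_def[of r] sum_product mult_ac)

end

definition mon_eval :: "(nat \<Rightarrow> 'a::comm_ring_1) \<Rightarrow> (nat \<Rightarrow>\<^sub>0 nat) \<Rightarrow> 'a" where
  "mon_eval x m = (\<Prod>i\<in>keys m. x i ^ lookup m i)"

lemma mon_eval_superset: "keys m \<subseteq> S \<Longrightarrow> finite S \<Longrightarrow> mon_eval x m = (\<Prod>i\<in>S. x i ^ lookup m i)"
  unfolding mon_eval_def by (rule prod.mono_neutral_left) (auto simp: in_keys_iff)

interpretation mpeval: mpol_hom "\<lambda>c. c" "mon_eval x"
  rewrites "mpol_hom.hom (\<lambda>c. c) (mon_eval x) = mpeval x" for x :: "nat \<Rightarrow> 'a::comm_ring_1"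
proof -
  show "mpol_hom (\<lambda>c. c) (mon_eval x)"
  proof
    fix m n :: "nat \<Rightarrow>\<^sub>0 nat"
    let ?S = "keys m \<union> keys n"
    have "keys (m + n) \<subseteq> ?S" by (rule keys_add)
    then show "mon_eval x (m + n) = mon_eval x m * mon_eval x n"
      by (simp add: mon_eval_superset[of _ ?S] lookup_add power_add prod.distrib)
  qed (simp_all add: mon_eval_def)
  then show "mpol_hom.hom (\<lambda>c. c) (mon_eval x) = mpeval x"
    by (auto simp: fun_eq_iff mpol_hom.hom_def mpeval_def mon_eval_def)
qed

lemma mpeval_mon_eval: "mpeval x p = (\<Sum>m\<in>keys p. lookup p m * mon_eval x m)"
  by (simp add: mpeval_def mon_eval_def)

definition shift_var :: "'a::comm_ring_1 \<Rightarrow> nat \<Rightarrow> 'a mpol \<Rightarrow> 'a mpol" where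
  "shift_var z k p = (\<Sum>m\<in>keys p. single m (z ^ lookup m k * lookup p m))"

interpretation shift_var: mpol_hom "single 0" "\<lambda>m. single m (z ^ lookup m k)"
  rewrites "mpol_hom.hom (single 0) (\<lambda>m. single m (z ^ lookup m k)) = shift_var z k"
  for z :: "'a::comm_ring_1" and k :: nat
proof -
  show hom: "mpol_hom (single 0) (\<lambda>m. single m (z ^ lookup m k))"
    by standard (simp_all add: single_add mult_single lookup_add power_add)
  show "mpol_hom.hom (single 0) (\<lambda>m. single m (z ^ lookup m k)) = shift_var z k"
    by (rule ext) (simp add: mpol_hom.hom_def[OF hom] shift_var_def mult_single mult.commute)
qed

lemma lookup_shift_var [simp]: "lookup (shift_var z k p) m = z ^ lookup m k * lookup p m"
  by (auto simp: shift_var_def lookup_sum lookup_single when_def in_keys_iff)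

lemma mpeval_shift_var: "mpeval x (shift_var z k p) = mpeval (x(k := z * x k)) p"
proof -
  have "mon_eval (x(k := z * x k)) m = z ^ lookup m k * mon_eval x m" for m
  proof -
    let ?S = "insert k (keys m)"
    have "mon_eval (x(k := z * x k)) m = (\<Prod>i\<in>?S. (if i = k then z ^ lookup m k else 1) * x i ^ lookup m i)"
      by (subst mon_eval_superset[of _ ?S]) (auto intro!: prod.cong simp: power_mult_distrib)
    also have "\<dots> = z ^ lookup m k * mon_eval x m"
      unfolding prod.distrib by (subst mon_eval_superset[of _ ?S]) auto
    finally show ?thesis .
  qed
  then show ?thesis
    unfolding shift_var_def mpeval.hom_sum mpeval.hom_single mpeval_mon_eval[of "x(k := z * x k)"]
    by (simp add: mult.left_commute mult.assoc)
qed

lemma lookup_map_key: "\<sigma> permutes S \<Longrightarrow> lookup (map_key \<sigma> m) i = lookup m (\<sigma> i)"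
  by (simp add: map_key.rep_eq permutes_inj)

lemma map_key_map_key:
  "\<sigma> permutes S \<Longrightarrow> \<tau> permutes S \<Longrightarrow> map_key \<sigma> (map_key \<tau> m) = map_key (\<tau> \<circ> \<sigma>) m"
  by (rule poly_mapping_eqI) (simp add: lookup_map_key lookup_map_key[OF permutes_compose])

lemma map_key_inv:
  assumes "\<sigma> permutes S"
  shows "map_key (inv_into UNIV \<sigma>) (map_key \<sigma> m) = m" "map_key \<sigma> (map_key (inv_into UNIV \<sigma>) m) = m"
  using assms by (auto intro!: poly_mapping_eqI
      simp: lookup_map_key[OF assms] lookup_map_key[OF permutes_inv[OF assms]] permutes_inverses)

lemma map_key_inject:
  assumes "\<sigma> permutes S" shows "map_key \<sigma> m = map_key \<sigma> n \<longleftrightarrow> m = n"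
  by (metis map_key_inv(1)[OF assms])

definition permute_vars :: "(nat \<Rightarrow> nat) \<Rightarrow> 'a::comm_ring_1 mpol \<Rightarrow> 'a mpol" where
  "permute_vars \<sigma> p = (\<Sum>m\<in>keys p. single (map_key \<sigma> m) (lookup p m))"

lemma permute_vars_hom:
  assumes "\<sigma> permutes S"
  shows "mpol_hom (single 0) (\<lambda>m :: nat \<Rightarrow>\<^sub>0 nat. single (map_key \<sigma> m) (1::'a::comm_ring_1))"
    and "permute_vars \<sigma> = mpol_hom.hom (single 0) (\<lambda>m :: nat \<Rightarrow>\<^sub>0 nat. single (map_key \<sigma> m) (1::'a))"
proof -
  show "mpol_hom (single 0) (\<lambda>m :: nat \<Rightarrow>\<^sub>0 nat. single (map_key \<sigma> m) (1::'a::comm_ring_1))"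
    using permutes_inj[OF assms] by unfold_locales (simp_all add: single_add mult_single map_key_plus)
  then show "permute_vars \<sigma> = mpol_hom.hom (single 0) (\<lambda>m :: nat \<Rightarrow>\<^sub>0 nat. single (map_key \<sigma> m) (1::'a))"
    by (auto simp: fun_eq_iff mpol_hom.hom_def permute_vars_def mult_single)
qed

lemma lookup_permute_vars:
  assumes "\<sigma> permutes S"
  shows "lookup (permute_vars \<sigma> p) (map_key \<sigma> m) = lookup p m"
  by (auto simp: permute_vars_def lookup_sum lookup_single when_def in_keys_iff map_key_inject[OF assms])

lemma permute_vars_shift_var:
  assumes "\<sigma> permutes S"
  shows "permute_vars \<sigma> (shift_var z k p) = shift_var z (inv_into UNIV \<sigma> k) (permute_vars \<sigma> p)"
proof (rule poly_mapping_eqI)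
  fix m :: "nat \<Rightarrow>\<^sub>0 nat"
  obtain m' where m: "m = map_key \<sigma> m'" using map_key_inv(2)[OF assms] by metis
  show "lookup (permute_vars \<sigma> (shift_var z k p)) m = lookup (shift_var z (inv_into UNIV \<sigma> k) (permute_vars \<sigma> p)) m"
    using assms by (simp add: m lookup_permute_vars lookup_map_key permutes_inverses)
qed

lemma is_symmetric_permute_vars:
  assumes "is_symmetric N p" "\<sigma> permutes {..<N}"
  shows "permute_vars \<sigma> p = p"
proof (rule poly_mapping_eqI)
  fix m :: "nat \<Rightarrow>\<^sub>0 nat"
  obtain m' where m: "m = map_key \<sigma> m'" using map_key_inv(2)[OF assms(2)] by metis
  show "lookup (permute_vars \<sigma> p) m = lookup p m"
    using assms by (simp add: m lookup_permute_vars is_symmetric_def)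
qed

text \<open>The order of exponents is lexicographic with index 0 most significant, so a partition is
  the largest element of its orbit.\<close>

lemma less_mon_iff:
  fixes m n :: "nat \<Rightarrow>\<^sub>0 nat"
  shows "m < n \<longleftrightarrow> (\<exists>k. lookup m k < lookup n k \<and> (\<forall>k'<k. lookup m k' = lookup n k'))"
  by (simp add: less_poly_mapping.rep_eq less_fun_def)

text \<open>Pigeonhole: if \<open>map_key \<sigma> m\<close> exceeded \<open>m\<close> first at
  \<open>k\<close>, then \<open>\<sigma>\<close> would map \<open>k\<close> together with the set
  \<open>D\<close> of positions of value at least \<open>lookup m (\<sigma> k)\<close> injectively
  into \<open>D\<close>, although \<open>k\<close> is not in \<open>D\<close>.\<close>

lemma map_key_le:
  fixes m :: "nat \<Rightarrow>\<^sub>0 nat"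
  assumes "\<sigma> permutes S" and anti: "\<And>i j. i \<le> j \<Longrightarrow> lookup m j \<le> lookup m i"
  shows "map_key \<sigma> m \<le> m"
proof (rule ccontr)
  assume "\<not> ?thesis"
  then have "m < map_key \<sigma> m" by simp
  then obtain k where k: "lookup m k < lookup m (\<sigma> k)" "\<And>j. j < k \<Longrightarrow> lookup m j = lookup m (\<sigma> j)"
    unfolding less_mon_iff lookup_map_key[OF assms(1)] by blast
  define D where "D = {j. lookup m (\<sigma> k) \<le> lookup m j}"
  have D: "D \<subseteq> {..<k}" unfolding D_def using k(1) anti by (force simp: not_less[symmetric])
  then have fin: "finite D" using finite_subset by blast
  have "\<sigma> ` insert k D \<subseteq> D" using k(2) D by (auto simp: D_def)
  then have "card (insert k D) \<le> card D"
    using card_inj_on_le[OF inj_on_subset[OF permutes_inj[OF assms(1)] subset_UNIV] _ fin] by blast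
  moreover have "k \<notin> D" using D by auto
  ultimately show False using fin by simp
qed

section \<open>Supports, degree bounds and symmetric polynomials\<close>

lemma in_vars_keys: "in_vars N p \<Longrightarrow> m \<in> keys p \<Longrightarrow> N \<le> i \<Longrightarrow> lookup m i = 0"
  unfolding in_vars_def by (meson in_keys_iff lessThan_iff linorder_not_le subsetD)

lemma in_vars_add: "in_vars N p \<Longrightarrow> in_vars N r \<Longrightarrow> in_vars N (p + r)"
  unfolding in_vars_def using keys_add[of p r] by blast

lemma in_vars_diff: "in_vars N p \<Longrightarrow> in_vars N r \<Longrightarrow> in_vars N (p - r)" for p :: "'a::ab_group_add mpol"
  unfolding in_vars_def by (metis (no_types, lifting) in_keys_iff lookup_minus diff_self)

lemma in_vars_0: "in_vars N 0"
  by (simp add: in_vars_def)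

lemma in_vars_sum: "(\<And>a. a \<in> A \<Longrightarrow> in_vars N (f a)) \<Longrightarrow> in_vars N (sum f A)"
  by (induction A rule: infinite_finite_induct) (auto simp: in_vars_0 in_vars_add)

lemma in_vars_single: "keys m \<subseteq> {..<N} \<Longrightarrow> in_vars N (single m c)"
  by (auto simp: in_vars_def split: if_splits)

lemma in_vars_mult:
  fixes p r :: "'a::comm_semiring_0 mpol"
  assumes "in_vars N p" "in_vars N r"
  shows "in_vars N (p * r)"
  unfolding times_sum_singles
proof (intro in_vars_sum in_vars_single)
  fix a b assume "a \<in> keys p" "b \<in> keys r"
  then have "keys a \<subseteq> {..<N}" "keys b \<subseteq> {..<N}" using assms by (auto simp: in_vars_def)
  then show "keys (a + b) \<subseteq> {..<N}" using keys_add[of a b] by blast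
qed

lemma in_vars_1: "in_vars N (1 :: 'a::zero_neq_one mpol)"
  by (auto simp: in_vars_def)

lemma in_vars_prod:
  fixes f :: "'b \<Rightarrow> 'a::comm_semiring_1 mpol"
  shows "(\<And>a. a \<in> A \<Longrightarrow> in_vars N (f a)) \<Longrightarrow> in_vars N (prod f A)"
  by (induction A rule: infinite_finite_induct) (auto simp: in_vars_1 in_vars_mult)

text \<open>A bound in place of the exact degree is stable under sums. Only the first
  \<open>N\<close> variables are counted, hence the companion condition
  \<open>in_vars N\<close>.\<close>

definition deg_le :: "nat \<Rightarrow> nat \<Rightarrow> 'a::zero mpol \<Rightarrow> bool" where
  "deg_le N d p \<longleftrightarrow> (\<forall>m\<in>keys p. (\<Sum>i<N. lookup m i) \<le> d)"

lemma deg_le_0: "deg_le N d 0"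
  by (simp add: deg_le_def)

lemma deg_le_add: "deg_le N d p \<Longrightarrow> deg_le N d r \<Longrightarrow> deg_le N d (p + r)"
  unfolding deg_le_def using keys_add[of p r] by blast

lemma deg_le_diff: "deg_le N d p \<Longrightarrow> deg_le N d r \<Longrightarrow> deg_le N d (p - r)"
  for p :: "'a::ab_group_add mpol"
  unfolding deg_le_def by (metis (no_types, lifting) in_keys_iff lookup_minus diff_self)

lemma deg_le_sum: "(\<And>a. a \<in> A \<Longrightarrow> deg_le N d (f a)) \<Longrightarrow> deg_le N d (sum f A)"
  by (induction A rule: infinite_finite_induct) (auto simp: deg_le_0 deg_le_add)

lemma deg_le_mult:
  fixes p r :: "'a::comm_semiring_0 mpol"
  assumes "deg_le N d p" "deg_le N e r"
  shows "deg_le N (d + e) (p * r)"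
  unfolding times_sum_singles
proof (intro deg_le_sum)
  fix a b assume "a \<in> keys p" "b \<in> keys r"
  then show "deg_le N (d + e) (single (a + b) (lookup p a * lookup r b))"
    using assms by (force simp: deg_le_def lookup_add sum.distrib intro: add_mono)
qed

lemma total_degree_le_iff:
  assumes "in_vars N p"
  shows "total_degree p \<le> d \<longleftrightarrow> deg_le N d p"
proof -
  have "(\<Sum>i\<in>keys m. lookup m i) = (\<Sum>i<N. lookup m i)" if "m \<in> keys p" for m
    using that assms by (intro sum.mono_neutral_left) (auto simp: in_vars_def in_keys_iff)
  then show ?thesis unfolding total_degree_def deg_le_def by (auto simp: Max_le_iff)
qed

lemma is_symmetric_0: "is_symmetric N 0"
  by (simp add: is_symmetric_def in_vars_0)

lemma is_symmetric_add: "is_symmetric N p \<Longrightarrow> is_symmetric N r \<Longrightarrow> is_symmetric N (p + r)"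
  by (simp add: is_symmetric_def in_vars_add lookup_add)

lemma is_symmetric_sum: "(\<And>a. a \<in> A \<Longrightarrow> is_symmetric N (f a)) \<Longrightarrow> is_symmetric N (sum f A)"
  by (induction A rule: infinite_finite_induct) (auto simp: is_symmetric_0 is_symmetric_add)

lemma is_symmetric_const_times:
  fixes p :: "'a::comm_semiring_1 mpol"
  shows "is_symmetric N p \<Longrightarrow> is_symmetric N (single 0 c * p)"
  by (simp add: is_symmetric_def in_vars_mult in_vars_single)

lemma is_symmetric_diff:
  fixes p r :: "'a::comm_ring_1 mpol"
  shows "is_symmetric N p \<Longrightarrow> is_symmetric N r \<Longrightarrow> is_symmetric N (p - r)"
  using is_symmetric_add[of N p "single 0 (-1) * r"] is_symmetric_const_times[of N r "-1"]
  by (simp add: single_uminus)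

lemma lookup_monomial_sym:
  "lookup (monomial_sym N \<mu> :: 'a::comm_semiring_1 mpol) m = (if m \<in> orbit_monomials N \<mu> then 1 else 0)"
  by (simp add: monomial_sym_def lookup_sum lookup_single when_def finite_orbit_monomials)

lemma map_key_orbit:
  assumes "\<sigma> permutes {..<N}" "m \<in> orbit_monomials N \<mu>"
  shows "map_key \<sigma> m \<in> orbit_monomials N \<mu>"
  using assms unfolding orbit_monomials_def
  by (auto simp: map_key_map_key[OF assms(1)] permutes_compose)

lemma orbit_self: "Poly_Mapping.nth \<mu> \<in> orbit_monomials N \<mu>"
proof -
  have "Poly_Mapping.nth \<mu> = map_key id (Poly_Mapping.nth \<mu>)" by (simp add: map_key_id id_def)
  then show ?thesis unfolding orbit_monomials_def using permutes_id by blast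
qed

lemma keys_orbit:
  assumes "m \<in> orbit_monomials N \<mu>" "length \<mu> \<le> N"
  shows "keys m \<subseteq> {..<N}"
proof -
  obtain \<sigma> where \<sigma>: "\<sigma> permutes {..<N}" "m = map_key \<sigma> (Poly_Mapping.nth \<mu>)"
    using assms(1) by (auto simp: orbit_monomials_def)
  show ?thesis
  proof
    fix i assume "i \<in> keys m"
    then have "nth_default 0 \<mu> (\<sigma> i) \<noteq> 0" by (simp add: in_keys_iff \<sigma> lookup_map_key[OF \<sigma>(1)])
    then have "\<sigma> i < N" using assms(2) by (auto simp: nth_default_def split: if_splits)
    then show "i \<in> {..<N}" using permutes_in_image[OF \<sigma>(1), of i] by auto
  qed
qed

lemma orbit_le:
  assumes "is_partition \<mu>" "m \<in> orbit_monomials N \<mu>"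
  shows "m \<le> Poly_Mapping.nth \<mu>"
  using assms partition_nth_mono[OF assms(1)] unfolding orbit_monomials_def by (auto intro!: map_key_le)

lemma keys_nth_subset: "length \<mu> \<le> N \<Longrightarrow> keys (Poly_Mapping.nth \<mu> :: nat \<Rightarrow>\<^sub>0 nat) \<subseteq> {..<N}"
  by (rule keys_orbit[OF orbit_self])

lemma nth_inj:
  assumes "is_partition \<mu>" "is_partition \<nu>" "Poly_Mapping.nth \<mu> = Poly_Mapping.nth \<nu>"
  shows "\<mu> = \<nu>"
proof (rule orbit_unique)
  show "Poly_Mapping.nth \<mu> \<in> orbit_monomials (max (length \<mu>) (length \<nu>)) \<mu>"
    by (rule orbit_self)
  show "Poly_Mapping.nth \<mu> \<in> orbit_monomials (max (length \<mu>) (length \<nu>)) \<nu>"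
    unfolding assms(3) by (rule orbit_self)
qed (use assms in auto)

lemma partition_eqI:
  assumes "is_partition \<mu>" "is_partition \<nu>" "length \<mu> \<le> N" "length \<nu> \<le> N"
    and "\<And>i. i < N \<Longrightarrow> nth_default 0 \<mu> i = nth_default 0 \<nu> i"
  shows "\<mu> = \<nu>"
proof (rule nth_inj[OF assms(1,2)], rule poly_mapping_eqI)
  fix i show "lookup (Poly_Mapping.nth \<mu>) i = lookup (Poly_Mapping.nth \<nu>) i"
    using assms(3,4) by (cases "i < N") (simp_all add: assms(5) nth_default_beyond)
qed

lemma is_symmetric_monomial_sym:
  assumes "length \<mu> \<le> N"
  shows "is_symmetric N (monomial_sym N \<mu> :: 'a::comm_semiring_1 mpol)"
  unfolding is_symmetric_def
proof (intro conjI allI impI)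
  show "in_vars N (monomial_sym N \<mu> :: 'a mpol)"
    unfolding monomial_sym_def
    by (intro in_vars_sum in_vars_single keys_orbit[where \<mu> = \<mu>]) (use assms in auto)
  fix \<sigma> m assume \<sigma>: "\<sigma> permutes {..<N}"
  have "map_key \<sigma> m \<in> orbit_monomials N \<mu> \<longleftrightarrow> m \<in> orbit_monomials N \<mu>"
    using map_key_orbit[OF \<sigma>, of m] map_key_orbit[OF permutes_inv[OF \<sigma>], of "map_key \<sigma> m"]
    by (auto simp: map_key_inv[OF \<sigma>])
  then show "lookup (monomial_sym N \<mu> :: 'a mpol) (map_key \<sigma> m) = lookup (monomial_sym N \<mu>) m"
    by (simp add: lookup_monomial_sym)
qed

lemma sum_nth_default: "length \<mu> \<le> N \<Longrightarrow> (\<Sum>i<N. nth_default 0 \<mu> i) = sum_list \<mu>"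
proof -
  assume "length \<mu> \<le> N"
  then have "(\<Sum>i<N. nth_default 0 \<mu> i) = (\<Sum>i<length \<mu>. nth_default 0 \<mu> i)"
    by (intro sum.mono_neutral_right) (auto simp: nth_default_def)
  then show ?thesis by (simp add: nth_default_def sum_list_sum_nth lessThan_atLeast0)
qed

lemma sum_lookup_orbit:
  assumes "m \<in> orbit_monomials N \<mu>" "length \<mu> \<le> N"
  shows "(\<Sum>i<N. lookup m i) = sum_list \<mu>"
proof -
  have "sum_list \<mu> = (\<Sum>i\<in>keys m. lookup m i)"
    using assms keys_orbit by (intro sum_list_orbit) auto
  also have "\<dots> = (\<Sum>i<N. lookup m i)"
    using keys_orbit[OF assms] by (intro sum.mono_neutral_left) (auto simp: in_keys_iff)
  finally show ?thesis by simp
qed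

lemma deg_le_monomial_sym:
  "length \<mu> \<le> N \<Longrightarrow> sum_list \<mu> \<le> d \<Longrightarrow> deg_le N d (monomial_sym N \<mu> :: 'a::comm_semiring_1 mpol)"
  unfolding deg_le_def by (auto simp: in_keys_iff lookup_monomial_sym sum_lookup_orbit split: if_splits)

lemma symmetric_eq_0:
  fixes p :: "'a::comm_semiring_1 mpol"
  assumes "is_symmetric N p" "deg_le N d p"
    and "\<And>\<mu>. is_partition \<mu> \<Longrightarrow> length \<mu> \<le> N \<Longrightarrow> sum_list \<mu> \<le> d \<Longrightarrow> mcoeff p \<mu> = 0"
  shows "p = 0"
proof -
  have "total_degree p \<le> d" using assms(1,2) by (simp add: total_degree_le_iff[of N] is_symmetric_def)
  then show ?thesis
    by (subst monomial_expansion[OF assms(1)]) (auto intro!: sum.neutral simp: assms(3))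
qed

text \<open>If \<open>m \<le> a\<close> and \<open>n \<le> b\<close>, then
  \<open>m + n = a + b\<close> forces equality in both. The bounds \<open>a\<close> and
  \<open>b\<close> need not occur as exponents.\<close>

lemma lookup_times_lead:
  fixes p r :: "'k::{linorder, ordered_cancel_comm_monoid_add} \<Rightarrow>\<^sub>0 'c::comm_semiring_0"
  assumes "\<And>m. m \<in> keys p \<Longrightarrow> m \<le> a" "\<And>m. m \<in> keys r \<Longrightarrow> m \<le> b"
  shows "lookup (p * r) (a + b) = lookup p a * lookup r b"
proof -
  have "(m + n = a + b) = (m = a \<and> n = b)" if "m \<in> keys p" "n \<in> keys r" for m n
    using assms(1)[OF that(1)] assms(2)[OF that(2)]
    by (metis add_le_less_mono add_less_le_mono less_irrefl order_less_le)
  then have "lookup (p * r) (a + b)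
      = (\<Sum>m\<in>keys p. \<Sum>n\<in>keys r. if m = a \<and> n = b then lookup p m * lookup r n else 0)"
    unfolding lookup_times by (intro sum.cong) auto
  also have "\<dots> = (\<Sum>m\<in>keys p. if m = a then lookup p m * lookup r b else 0)"
    by (intro sum.cong refl) (auto simp: in_keys_iff)
  finally show ?thesis by (auto simp: in_keys_iff)
qed

lemma keys_times_le:
  fixes p r :: "'k::{linorder, ordered_cancel_comm_monoid_add} \<Rightarrow>\<^sub>0 'c::comm_semiring_0"
  assumes "\<And>m. m \<in> keys p \<Longrightarrow> m \<le> a" "\<And>m. m \<in> keys r \<Longrightarrow> m \<le> b" "m \<in> keys (p * r)"
  shows "m \<le> a + b"
  using keys_mult[of p r] assms by (blast intro: add_mono)

lemma lookup_prod_lead: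
  fixes f :: "'b \<Rightarrow> 'k::{linorder, ordered_cancel_comm_monoid_add} \<Rightarrow>\<^sub>0 'c::comm_semiring_1"
  assumes "finite A" "\<And>x m. x \<in> A \<Longrightarrow> m \<in> keys (f x) \<Longrightarrow> m \<le> l x"
  shows "lookup (\<Prod>x\<in>A. f x) (\<Sum>x\<in>A. l x) = (\<Prod>x\<in>A. lookup (f x) (l x))"
    and "m \<in> keys (\<Prod>x\<in>A. f x) \<Longrightarrow> m \<le> (\<Sum>x\<in>A. l x)"
proof -
  have "lookup (\<Prod>x\<in>A. f x) (\<Sum>x\<in>A. l x) = (\<Prod>x\<in>A. lookup (f x) (l x)) \<and>
    (\<forall>m\<in>keys (\<Prod>x\<in>A. f x). m \<le> (\<Sum>x\<in>A. l x))"
    using assms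
  proof (induction A rule: finite_induct)
    case (insert x A)
    then show ?case
      using lookup_times_lead[of "f x" "l x" "prod f A" "sum l A"]
        keys_times_le[of "f x" "l x" "prod f A" "sum l A"] by auto
  qed auto
  then show "lookup (\<Prod>x\<in>A. f x) (\<Sum>x\<in>A. l x) = (\<Prod>x\<in>A. lookup (f x) (l x))"
    "m \<in> keys (\<Prod>x\<in>A. f x) \<Longrightarrow> m \<le> (\<Sum>x\<in>A. l x)" by auto
qed

text \<open>At the index \<open>y\<close> of largest key only the unknown \<open>a y\<close>
  contributes, so it is determined first; its contribution is then moved to the right-hand
  side.\<close>

lemma triangular_solve:
  fixes A :: "'i \<Rightarrow> 'i \<Rightarrow> 'a::field" and key :: "'i \<Rightarrow> 'k::linorder"
  assumes "finite X" "inj_on key X"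
    and "\<And>x y. x \<in> X \<Longrightarrow> y \<in> X \<Longrightarrow> key x < key y \<Longrightarrow> A x y = 0"
    and "\<And>x. x \<in> X \<Longrightarrow> A x x \<noteq> 0"
  shows "\<exists>a. \<forall>y\<in>X. (\<Sum>x\<in>X. a x * A x y) = b y"
  using assms
proof (induction "card X" arbitrary: X b)
  case (Suc n)
  then have "X \<noteq> {}" by auto
  then have "\<exists>y\<in>X. key y = Max (key ` X)" using Suc.prems(1) Max_in[of "key ` X"] by fastforce
  then obtain y where y: "y \<in> X" "key y = Max (key ` X)" by blast
  have less: "key x < key y" if "x \<in> X - {y}" for x
    using that y Suc.prems Max_ge[of "key ` X" "key x"] by (auto simp: inj_on_def order_less_le)
  let ?c = "b y / A y y"
  have "\<exists>a. \<forall>z\<in>X - {y}. (\<Sum>x\<in>X - {y}. a x * A x z) = b z - ?c * A y z"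
    using Suc.prems y Suc.hyps(2) by (intro Suc.hyps(1)) (auto simp: inj_on_def)
  then obtain a where a: "\<And>z. z \<in> X - {y} \<Longrightarrow> (\<Sum>x\<in>X - {y}. a x * A x z) = b z - ?c * A y z"
    by blast
  have split: "(\<Sum>x\<in>X. (a(y := ?c)) x * A x z) = ?c * A y z + (\<Sum>x\<in>X - {y}. a x * A x z)" for z
    using Suc.prems(1) y(1) by (subst sum.remove[of _ y]) auto
  have "(\<Sum>x\<in>X - {y}. a x * A x y) = 0"
    using less Suc.prems(3) y(1) by (intro sum.neutral) auto
  then have "(\<Sum>x\<in>X. (a(y := ?c)) x * A x z) = b z" if "z \<in> X" for z
    unfolding split using a[of z] that Suc.prems(4)[OF y(1)] by (cases "z = y") auto
  then show ?case by blast
qed auto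

section \<open>The difference operator\<close>

declare single_of_int [simp del]

lemma perm_neq_id_moves:
  assumes "w permutes {..<N}" "w \<noteq> id"
  shows "\<exists>i<N. w i \<noteq> i \<and> w i < N"
proof -
  obtain i where i: "w i \<noteq> i" using assms(2) by (auto simp: fun_eq_iff)
  then have "i < N" using assms(1) by (meson lessThan_iff permutes_not_in)
  then show ?thesis using i permutes_in_image[OF assms(1), of i] by auto
qed

lemma finite_perms [simp]: "finite {w. w permutes {..<N::nat}}"
  by (simp add: finite_permutations)

text \<open>The exponents N, ..., 1 and not N - 1, ..., 0: the additional 1 leaves room for lowering
  any exponent once, which is the division by a variable.\<close>

definition stair :: "nat \<Rightarrow> nat \<Rightarrow>\<^sub>0 nat" where
  "stair N = Poly_Mapping.nth (map (\<lambda>i. N - i) [0..<N])"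

lemma lookup_stair [simp]: "lookup (stair N) i = N - i"
  by (simp add: stair_def nth_default_def)

lemma map_key_stair_le: "w permutes {..<N} \<Longrightarrow> map_key w (stair N) \<le> stair N"
  by (rule map_key_le) auto

lemma map_key_stair_less:
  assumes "w permutes {..<N}" "w \<noteq> id"
  shows "map_key w (stair N) < stair N"
proof -
  obtain i where "i < N" "w i \<noteq> i" "w i < N" using perm_neq_id_moves[OF assms] by blast
  then have "lookup (map_key w (stair N)) i \<noteq> lookup (stair N) i"
    by (simp add: lookup_map_key[OF assms(1)])
  then show ?thesis using map_key_stair_le[OF assms(1)] by (auto simp: order_less_le)
qed

text \<open>The exponent at \<open>k\<close> is \<open>N - w k > 0\<close>, so the truncated
  subtraction really lowers it; this gives strictness even for the identity.\<close>

lemma map_key_stair_minus_less: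
  assumes "w permutes {..<N}" "k < N"
  shows "map_key w (stair N) - single k 1 < stair N"
proof -
  have "w k < N" using permutes_in_image[OF assms(1), of k] assms(2) by simp
  then have "map_key w (stair N) - single k 1 < map_key w (stair N)"
    unfolding less_mon_iff
    by (intro exI[of _ k]) (auto simp: lookup_minus lookup_map_key[OF assms(1)] lookup_single)
  also have "\<dots> \<le> stair N" by (rule map_key_stair_le[OF assms(1)])
  finally show ?thesis .
qed

lemma keys_map_key_stair:
  assumes "w permutes {..<N}"
  shows "keys (map_key w (stair N)) \<subseteq> {..<N}" "keys (map_key w (stair N) - single k 1) \<subseteq> {..<N}"
proof -
  have *: "w i < N \<Longrightarrow> i < N" for i using permutes_in_image[OF assms, of i] by simp
  show "keys (map_key w (stair N)) \<subseteq> {..<N}"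
    using * by (auto simp: in_keys_iff lookup_map_key[OF assms])
  show "keys (map_key w (stair N) - single k 1) \<subseteq> {..<N}"
    using * by (auto simp: in_keys_iff lookup_map_key[OF assms] lookup_minus)
qed

lemma sum_map_key_stair:
  assumes "w permutes {..<N}"
  shows "(\<Sum>i<N. lookup (map_key w (stair N)) i) = (\<Sum>i<N. N - i)"
  using sum.permute[OF assms, of "\<lambda>i. N - i"] by (simp add: lookup_map_key[OF assms] comp_def)

context local_qt
begin

text \<open>Up to the factor \<open>x\<^sub>1\<cdots>x\<^sub>N\<close>, which clears the denominators \<open>x\<^sub>k\<close>, \<open>alternant N\<close> is the
  Vandermonde determinant and \<open>alternant_shift N k\<close> is its product with
  \<open>(1 - 1 / x\<^sub>k) \<Prod>\<^bsub>j \<noteq> k\<^esub> (x\<^sub>k - t x\<^sub>j) / (x\<^sub>k - x\<^sub>j)\<close>. So \<open>eigenop N c f = 0\<close> says that \<open>f\<close> is an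
  eigenfunction, with eigenvalue \<open>c\<close>, of the Macdonald type operator for interpolation polynomials.\<close>

definition alternant :: "nat \<Rightarrow> 'a mpol" where
  "alternant N = (\<Sum>w | w permutes {..<N}. single (map_key w (stair N)) (of_int (sign w)))"

definition alternant_shift :: "nat \<Rightarrow> nat \<Rightarrow> 'a mpol" where
  "alternant_shift N k = (\<Sum>w | w permutes {..<N}.
     single (map_key w (stair N)) (of_int (sign w) * t ^ w k)
     - single (map_key w (stair N) - single k 1) (of_int (sign w) * t ^ w k))"

definition sdiff :: "nat \<Rightarrow> 'a mpol \<Rightarrow> 'a mpol" where
  "sdiff k f = shift_var (inverse q) k f - f"

definition eigenop :: "nat \<Rightarrow> 'a \<Rightarrow> 'a mpol \<Rightarrow> 'a mpol" where
  "eigenop N c f = (\<Sum>k<N. alternant_shift N k * sdiff k f) - single 0 c * alternant N * f"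

definition eigenval :: "nat \<Rightarrow> (nat \<Rightarrow> nat) \<Rightarrow> 'a" where
  "eigenval N \<nu> = (\<Sum>i<N. t ^ i * (inverse q ^ \<nu> i - 1))"

lemma lookup_sdiff: "lookup (sdiff k f) m = (inverse q ^ lookup m k - 1) * lookup f m"
  by (simp add: sdiff_def lookup_minus left_diff_distrib)

lemma sdiff_add: "sdiff k (f + g) = sdiff k f + sdiff k g"
  by (rule poly_mapping_eqI) (simp add: lookup_sdiff lookup_add distrib_left)

lemma sdiff_const_times: "sdiff k (single 0 c * f) = single 0 c * sdiff k f"
  by (rule poly_mapping_eqI) (simp add: lookup_sdiff mult.left_commute)

lemma eigenop_add: "eigenop N c (f + g) = eigenop N c f + eigenop N c g"
  by (simp add: eigenop_def sdiff_add distrib_left sum.distrib)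

lemma eigenop_const_times: "eigenop N c (single 0 z * f) = single 0 z * eigenop N c f"
  by (simp add: eigenop_def sdiff_const_times right_diff_distrib sum_distrib_left mult.assoc mult.left_commute)

lemma eigenop_0: "eigenop N c 0 = 0"
  by (simp add: eigenop_def sdiff_def shift_var.hom_0)

lemma eigenop_sum: "eigenop N c (sum f A) = (\<Sum>a\<in>A. eigenop N c (f a))"
  by (induction A rule: infinite_finite_induct) (simp_all add: eigenop_0 eigenop_add)

lemma eigenval_close: "eigenval N \<nu> \<in> O_one 1"
  unfolding eigenval_def
  using R_power[OF t_R] by (intro scalars.F_sum scalars.F_mult0 inverse_q_power_close) (simp add: R_O)

lemma eigenval_diff: "eigenval N \<nu> - eigenval N \<mu> = (\<Sum>i<N. t ^ i * (inverse q ^ \<nu> i - inverse q ^ \<mu> i))"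
  unfolding eigenval_def sum_subtractf[symmetric] by (intro sum.cong) (simp_all add: algebra_simps)

lemma eigenval_separation:
  assumes "keys m \<subseteq> {..<N}" "keys n \<subseteq> {..<N}" "m \<noteq> n"
  shows "\<exists>y\<in>R. y * (eigenval N (lookup m) - eigenval N (lookup n)) = q - 1"
proof -
  have "\<exists>i. lookup m i \<noteq> lookup n i"
    using assms(3) unfolding poly_mapping_eq_iff fun_eq_iff by blast
  then obtain i where i: "lookup m i \<noteq> lookup n i" ..
  then have "i \<in> keys m \<union> keys n" by (auto simp: in_keys_iff)
  then have "i < N" using assms by blast
  then show ?thesis unfolding eigenval_diff by (rule separation) (rule i)
qed

lemma eigenval_inj:
  assumes "keys m \<subseteq> {..<N}" "keys n \<subseteq> {..<N}" "m \<noteq> n"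
  shows "eigenval N (lookup m) \<noteq> eigenval N (lookup n)"
  using eigenval_separation[OF assms] q_not_1 by auto

lemma sign_R: "of_int (sign w) \<in> R"
  by (cases w rule: sign_cases) (auto simp: R_one R_uminus)

text \<open>The operator is triangular for the lexicographic order of the exponents.\<close>

lemma eigenop_leading_coeff:
  assumes M: "0 \<in> M" "\<And>x y. x \<in> M \<Longrightarrow> y \<in> M \<Longrightarrow> x + y \<in> M" "\<And>r x. r \<in> R \<Longrightarrow> x \<in> M \<Longrightarrow> r * x \<in> M"
    and c: "c \<in> O_one 1"
    and f: "\<And>m. \<nu> < m \<Longrightarrow> lookup f m \<in> M"
  shows "\<exists>x\<in>M. lookup (eigenop N c f) (\<nu> + stair N)
    = (eigenval N (lookup \<nu>) - c) * lookup f \<nu> + (q - 1) * x"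
proof -
  \<comment> \<open>The error terms lie in q - 1 times \<open>M\<close>, because each carries a
    factor \<open>inverse q ^ n - 1\<close> or the small scalar \<open>c\<close>. The set
    \<open>M\<close> is later \<open>{0}\<close> or \<open>O_one r\<close>.\<close>
  define hM where "hM = {(q - 1) * x |x. x \<in> M}"
  have h0: "0 \<in> hM" using M(1) by (force simp: hM_def)
  have hadd: "x + y \<in> hM" if "x \<in> hM" "y \<in> hM" for x y
    using that M(2) by (force simp: hM_def simp flip: distrib_left)
  have hR: "r * x \<in> hM" if "r \<in> R" "x \<in> hM" for r x
    using that M(3) by (force simp: hM_def)
  have hdiff: "x - y \<in> hM" if "x \<in> hM" "y \<in> hM" for x y
    using hadd[OF that(1) hR[OF R_uminus[OF R_one] that(2)]] by simp
  have hsum: "sum g A \<in> hM" if "\<And>a. a \<in> A \<Longrightarrow> g a \<in> hM" for g and A :: "'b set"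
    using that by (induction A rule: infinite_finite_induct) (auto simp: h0 hadd)
  have hO: "r * x \<in> hM" if "r \<in> O_one 1" "x \<in> M" for r x
    using that M(3) by (force simp: hM_def O_one_def)
  \<comment> \<open>An exponent of the alternants strictly below \<open>stair N\<close> can only
    meet coefficients of \<open>f\<close> strictly beyond \<open>\<nu>\<close>, and these lie in
    \<open>M\<close>.\<close>
  have pos: "\<nu> < m" if "a < stair N" "a + m = \<nu> + stair N" for a m
  proof (rule ccontr)
    assume "\<not> \<nu> < m"
    then have "a + m < stair N + \<nu>" using that(1) by (intro add_less_le_mono) auto
    then show False using that(2) by (simp add: add.commute)
  qed
  have L1: "lookup (single a s * sdiff k f) (\<nu> + stair N) \<in> hM" if a: "a < stair N" and s: "s \<in> R" for a s k
  proof (cases "\<exists>m. a + m = \<nu> + stair N")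
    case True
    then obtain m where m: "a + m = \<nu> + stair N" ..
    have "s * ((inverse q ^ lookup m k - 1) * lookup f m) \<in> hM"
      by (intro hR s hO inverse_q_power_close f pos[OF a m])
    then show ?thesis by (simp add: lookup_single_times lookup_sdiff flip: m)
  qed (simp add: lookup_single_times_0 h0)
  have L2: "lookup (single a (c * s) * f) (\<nu> + stair N) \<in> hM" if a: "a < stair N" and s: "s \<in> R" for a s
  proof (cases "\<exists>m. a + m = \<nu> + stair N")
    case True
    then obtain m where m: "a + m = \<nu> + stair N" ..
    have "s * (c * lookup f m) \<in> hM"
      by (intro hR s hO c f pos[OF a m])
    then show ?thesis by (simp add: lookup_single_times mult.assoc mult.left_commute flip: m)
  qed (simp add: lookup_single_times_0 h0)
  define X where "X w k = lookup (single (map_key w (stair N)) (of_int (sign w) * t ^ w k) * sdiff k f) (\<nu> + stair N)" for w k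
  define Y where "Y w k = lookup (single (map_key w (stair N) - single k 1) (of_int (sign w) * t ^ w k) * sdiff k f) (\<nu> + stair N)" for w k
  define Z where "Z w = lookup (single (map_key w (stair N)) (c * of_int (sign w)) * f) (\<nu> + stair N)" for w
  define G where "G w = (\<Sum>k<N. X w k - Y w k) - Z w" for w
  have "lookup (eigenop N c f) (\<nu> + stair N) = (\<Sum>k<N. \<Sum>w | w permutes {..<N}. X w k - Y w k) - (\<Sum>w | w permutes {..<N}. Z w)"
    unfolding eigenop_def alternant_def alternant_shift_def X_def Y_def Z_def
    by (simp add: lookup_minus lookup_sum sum_distrib_left sum_distrib_right mult_single left_diff_distrib)
  also have "\<dots> = (\<Sum>w | w permutes {..<N}. G w)"
    unfolding G_def sum_subtractf[of _ Z] by (subst sum.swap) simp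
  \<comment> \<open>Only the identity permutation, and there only the unlowered terms, reaches
    \<open>stair N\<close> itself; these terms produce the eigenvalue at
    \<open>\<nu>\<close>.\<close>
  also have "\<dots> = G id + (\<Sum>w\<in>{w. w permutes {..<N}} - {id}. G w)"
    by (rule sum.remove) (auto simp: permutes_id)
  finally have eq: "lookup (eigenop N c f) (\<nu> + stair N) = G id + (\<Sum>w\<in>{w. w permutes {..<N}} - {id}. G w)" .
  have sR: "of_int (sign w) * t ^ j \<in> R" for w j
    by (intro R_mult sign_R R_power t_R)
  have Yh: "Y w k \<in> hM" if "w permutes {..<N}" "k < N" for w k
    unfolding Y_def using that by (intro L1 sR map_key_stair_minus_less)
  have Gh: "G w \<in> hM" if "w permutes {..<N}" "w \<noteq> id" for w
    unfolding G_def
    by (intro hdiff hsum Yh that) (use that in \<open>auto simp: X_def Z_def intro!: L1 L2 sR sign_R map_key_stair_less\<close>)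
  have idX: "X id k = t ^ k * ((inverse q ^ lookup \<nu> k - 1) * lookup f \<nu>)" for k
    using lookup_single_times[of "stair N" "t ^ k" "sdiff k f" \<nu>]
    by (simp add: X_def lookup_sdiff add.commute map_key_id[unfolded id_def[symmetric]])
  have idZ: "Z id = c * lookup f \<nu>"
    using lookup_single_times[of "stair N" c f \<nu>]
    by (simp add: Z_def add.commute map_key_id[unfolded id_def[symmetric]])
  have idG: "G id = (eigenval N (lookup \<nu>) - c) * lookup f \<nu> - (\<Sum>k<N. Y id k)"
    unfolding G_def idX idZ eigenval_def sum_subtractf
    by (simp add: sum_distrib_right left_diff_distrib mult.assoc)
  define y where "y = (\<Sum>w\<in>{w. w permutes {..<N}} - {id}. G w) - (\<Sum>k<N. Y id k)"
  have "y \<in> hM" unfolding y_def by (intro hdiff hsum Gh Yh permutes_id) auto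
  moreover have "lookup (eigenop N c f) (\<nu> + stair N) = (eigenval N (lookup \<nu>) - c) * lookup f \<nu> + y"
    unfolding eq idG y_def by simp
  ultimately show ?thesis by (auto simp: hM_def)
qed

lemma eigenop_leading_coeff_exact:
  assumes "\<And>m. \<nu> < m \<Longrightarrow> lookup f m = 0"
  shows "lookup (eigenop N (eigenval N \<mu>) f) (\<nu> + stair N)
    = (eigenval N (lookup \<nu>) - eigenval N \<mu>) * lookup f \<nu>"
  using eigenop_leading_coeff[of "{0}" "eigenval N \<mu>" \<nu> f N] assms eigenval_close[of N \<mu>] by auto

text \<open>At the largest exponent whose coefficient is too big, triangularity shows that the
  eigenvalue difference times this coefficient has order \<open>Suc r\<close>. Separation turns the
  difference into q - 1, which is cancelled. At \<open>n\<close> the difference is 0, hence the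
  separate hypothesis there.\<close>

lemma eigenop_small_imp_small:
  assumes "in_vars N f" "keys n \<subseteq> {..<N}"
    and T: "\<And>m. lookup (eigenop N (eigenval N (lookup n)) f) m \<in> O_one (Suc r)"
    and n: "lookup f n \<in> O_one r"
  shows "lookup f m \<in> O_one r"
proof (rule ccontr)
  assume m: "\<not> ?thesis"
  define B where "B = {m\<in>keys f. lookup f m \<notin> O_one r}"
  have fin: "finite B" by (simp add: B_def)
  have "m \<in> B" using m scalars.F_zero by (auto simp: B_def in_keys_iff)
  define \<nu> where "\<nu> = Max B"
  have \<nu>: "\<nu> \<in> keys f" "lookup f \<nu> \<notin> O_one r"
    using Max_in[OF fin] \<open>m \<in> B\<close> unfolding \<nu>_def B_def by auto
  have gt: "lookup f m \<in> O_one r" if "\<nu> < m" for m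
  proof (rule ccontr)
    assume "\<not> ?thesis"
    then have "m \<in> B" using scalars.F_zero by (auto simp: B_def in_keys_iff)
    then show False using that Max_ge[OF fin] by (auto simp: \<nu>_def not_less[symmetric])
  qed
  have "keys \<nu> \<subseteq> {..<N}" using assms(1) \<nu> by (auto simp: in_vars_def)
  moreover have "\<nu> \<noteq> n" using \<nu> n by auto
  ultimately obtain y where y: "y \<in> R" "y * (eigenval N (lookup \<nu>) - eigenval N (lookup n)) = q - 1"
    using eigenval_separation assms(2) by blast
  obtain x where x: "x \<in> O_one r" "lookup (eigenop N (eigenval N (lookup n)) f) (\<nu> + stair N)
    = (eigenval N (lookup \<nu>) - eigenval N (lookup n)) * lookup f \<nu> + (q - 1) * x"
    using eigenop_leading_coeff[of "O_one r" "eigenval N (lookup n)" \<nu> f N] gt eigenval_close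
      scalars.F_zero scalars.F_add scalars.F_mult0 R_O by blast
  have "(q - 1) * x \<in> O_one (Suc r)"
    using x(1) scalars.F_mult[of "q - 1" 1] q_power_close[of 1] by simp
  then have "(eigenval N (lookup \<nu>) - eigenval N (lookup n)) * lookup f \<nu> \<in> O_one (Suc r)"
    using scalars.F_diff[OF T[of "\<nu> + stair N"]] x(2) by (metis add_diff_cancel_right')
  then have "y * ((eigenval N (lookup \<nu>) - eigenval N (lookup n)) * lookup f \<nu>) \<in> O_one (Suc r)"
    using y(1) scalars.F_mult0 R_O by blast
  then have "(q - 1) * lookup f \<nu> \<in> O_one (Suc r)" by (simp add: y(2) flip: mult.assoc)
  then show False using O_Suc_cancel \<nu>(2) by blast
qed

text \<open>The largest exponent of an eigenfunction must have the same eigenvalue as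
  \<open>n\<close>, and eigenvalues separate exponents.\<close>

lemma eigenfunction_leading:
  assumes "in_vars N f" "keys n \<subseteq> {..<N}" "eigenop N (eigenval N (lookup n)) f = 0" "m \<in> keys f"
  shows "m \<le> n"
proof -
  define \<nu> where "\<nu> = Max (keys f)"
  have \<nu>: "\<nu> \<in> keys f" "m \<le> \<nu>" using assms(4) by (auto simp: \<nu>_def intro: Max_in)
  have "lookup f m = 0" if "\<nu> < m" for m
    using that Max_ge[of "keys f" m] by (auto simp: \<nu>_def in_keys_iff not_less[symmetric])
  then have "(eigenval N (lookup \<nu>) - eigenval N (lookup n)) * lookup f \<nu> = 0"
    using eigenop_leading_coeff_exact[of \<nu> f N "lookup n"] assms(3) by simp
  then have "eigenval N (lookup \<nu>) = eigenval N (lookup n)" using \<nu> by (simp add: in_keys_iff)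
  moreover have "keys \<nu> \<subseteq> {..<N}" using assms(1) \<nu> by (auto simp: in_vars_def)
  ultimately have "\<nu> = n" using eigenval_inj assms(2) by blast
  then show ?thesis using \<nu> by simp
qed


section \<open>Existence of eigenfunctions\<close>

lemma
  assumes "\<sigma> permutes {..<N}"
  shows permute_alternant: "permute_vars \<sigma> (alternant N) = single 0 (of_int (sign \<sigma>)) * alternant N"
    and permute_alternant_shift:
      "permute_vars \<sigma> (alternant_shift N k) = single 0 (of_int (sign \<sigma>)) * alternant_shift N (inv_into UNIV \<sigma> k)"
proof -
  interpret hom: mpol_hom "single 0" "\<lambda>m :: nat \<Rightarrow>\<^sub>0 nat. single (map_key \<sigma> m) (1::'a)"
    rewrites "mpol_hom.hom (single 0) (\<lambda>m :: nat \<Rightarrow>\<^sub>0 nat. single (map_key \<sigma> m) (1::'a)) = permute_vars \<sigma>"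
    by (rule permute_vars_hom[OF assms], rule permute_vars_hom(2)[OF assms, symmetric])
  have perm: "permutation w" if "w permutes {..<N}" for w
    using that permutation_permutes by blast
  have sign: "of_int (sign \<sigma>) * of_int (sign (w \<circ> \<sigma>)) = (of_int (sign w) :: 'a)" if "w permutes {..<N}" for w
    using perm[OF that] perm[OF assms] by (cases \<sigma> rule: sign_cases) (simp_all add: sign_compose)
  have single: "permute_vars \<sigma> (single m c) = single (map_key \<sigma> m) c" for m and c :: 'a
    by (simp add: hom.hom_single mult_single)
  have minus: "map_key \<sigma> (map_key w (stair N) - single k 1) = map_key (w \<circ> \<sigma>) (stair N) - single (inv_into UNIV \<sigma> k) 1"
    if "w permutes {..<N}" for w
    using permutes_inverses[OF assms]
    by (intro poly_mapping_eqI) (auto simp: lookup_map_key[OF permutes_compose[OF assms that]]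
        lookup_map_key[OF assms] lookup_map_key[OF that] lookup_minus lookup_single when_def)
  have "permute_vars \<sigma> (alternant N) = (\<Sum>w | w permutes {..<N}. single (map_key (w \<circ> \<sigma>) (stair N)) (of_int (sign w)))"
    unfolding alternant_def hom.hom_sum using assms by (intro sum.cong) (auto simp: single map_key_map_key)
  also have "\<dots> = (\<Sum>w | w permutes {..<N}. single (map_key (w \<circ> \<sigma>) (stair N)) (of_int (sign \<sigma>) * of_int (sign (w \<circ> \<sigma>))))"
    by (intro sum.cong) (auto simp: sign)
  also have "\<dots> = (\<Sum>w | w permutes {..<N}. single (map_key w (stair N)) (of_int (sign \<sigma>) * of_int (sign w)))"
    using sum_permutations_compose_right[OF assms, of "\<lambda>w. single (map_key w (stair N)) (of_int (sign \<sigma>) * of_int (sign w))"]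
    by (rule sym)
  finally show "permute_vars \<sigma> (alternant N) = single 0 (of_int (sign \<sigma>)) * alternant N"
    by (simp add: alternant_def sum_distrib_left mult_single)
  let ?g = "\<lambda>w. single (map_key w (stair N)) (of_int (sign \<sigma>) * (of_int (sign w) * t ^ w (inv_into UNIV \<sigma> k)))
     - single (map_key w (stair N) - single (inv_into UNIV \<sigma> k) 1) (of_int (sign \<sigma>) * (of_int (sign w) * t ^ w (inv_into UNIV \<sigma> k)))"
  have "permute_vars \<sigma> (alternant_shift N k) = (\<Sum>w | w permutes {..<N}. ?g (w \<circ> \<sigma>))"
    unfolding alternant_shift_def hom.hom_sum
  proof (intro sum.cong refl)
    fix w assume "w \<in> {w. w permutes {..<N}}"
    then have w: "w permutes {..<N}" by simp
    have "(w \<circ> \<sigma>) (inv_into UNIV \<sigma> k) = w k" using permutes_inverses[OF assms] by simp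
    then show "permute_vars \<sigma> (single (map_key w (stair N)) (of_int (sign w) * t ^ w k)
       - single (map_key w (stair N) - single k 1) (of_int (sign w) * t ^ w k)) = ?g (w \<circ> \<sigma>)"
      unfolding mult.assoc[symmetric] sign[OF w]
      by (simp only: hom.hom_diff single minus[OF w] map_key_map_key[OF assms w])
  qed
  also have "\<dots> = (\<Sum>w | w permutes {..<N}. ?g w)"
    using sum_permutations_compose_right[OF assms, of ?g] by (rule sym)
  finally show "permute_vars \<sigma> (alternant_shift N k) = single 0 (of_int (sign \<sigma>)) * alternant_shift N (inv_into UNIV \<sigma> k)"
    by (simp add: alternant_shift_def sum_distrib_left mult_single right_diff_distrib)
qed

lemma permute_eigenop:
  assumes "\<sigma> permutes {..<N}" "is_symmetric N f"
  shows "permute_vars \<sigma> (eigenop N c f) = single 0 (of_int (sign \<sigma>)) * eigenop N c f"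
proof -
  interpret hom: mpol_hom "single 0" "\<lambda>m :: nat \<Rightarrow>\<^sub>0 nat. single (map_key \<sigma> m) (1::'a)"
    rewrites "mpol_hom.hom (single 0) (\<lambda>m :: nat \<Rightarrow>\<^sub>0 nat. single (map_key \<sigma> m) (1::'a)) = permute_vars \<sigma>"
    by (rule permute_vars_hom[OF assms(1)], rule permute_vars_hom(2)[OF assms(1), symmetric])
  have inv: "inv_into UNIV \<sigma> permutes {..<N}" by (rule permutes_inv[OF assms(1)])
  have c: "permute_vars \<sigma> (single 0 c) = single 0 c"
    by (simp add: hom.hom_single mult_single map_key_zero permutes_inj[OF assms(1)])
  have "permute_vars \<sigma> (eigenop N c f) = single 0 (of_int (sign \<sigma>)) *
     ((\<Sum>k<N. alternant_shift N (inv_into UNIV \<sigma> k) * sdiff (inv_into UNIV \<sigma> k) f) - single 0 c * alternant N * f)"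
    unfolding eigenop_def sdiff_def
    by (simp add: hom.hom_sum hom.hom_diff hom.hom_mult c permute_alternant_shift[OF assms(1)]
        permute_alternant[OF assms(1)] permute_vars_shift_var[OF assms(1)]
        is_symmetric_permute_vars[OF assms(2,1)] right_diff_distrib sum_distrib_left mult_ac)
  also have "(\<Sum>k<N. alternant_shift N (inv_into UNIV \<sigma> k) * sdiff (inv_into UNIV \<sigma> k) f) = (\<Sum>k<N. alternant_shift N k * sdiff k f)"
    using sum.permute[OF inv, of "\<lambda>k. alternant_shift N k * sdiff k f"] by (simp add: comp_def)
  finally show ?thesis by (simp add: eigenop_def)
qed

lemma lookup_eigenop_permute:
  assumes "\<sigma> permutes {..<N}" "is_symmetric N f"
  shows "lookup (eigenop N c f) m = of_int (sign \<sigma>) * lookup (eigenop N c f) (map_key \<sigma> m)"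
  using lookup_permute_vars[OF assms(1), of "eigenop N c f" m] by (simp add: permute_eigenop[OF assms] del: single_of_int)

text \<open>The image of a symmetric polynomial is antisymmetric, and a transposition fixing the
  exponent makes the coefficient its own negative; here 2 must be invertible.\<close>

lemma lookup_eigenop_repeated:
  assumes "is_symmetric N f" "i < N" "j < N" "i \<noteq> j" "lookup m i = lookup m j"
  shows "lookup (eigenop N c f) m = 0"
proof -
  have p: "Transposition.transpose i j permutes {..<N}" using assms by (intro permutes_swap_id) auto
  have "map_key (Transposition.transpose i j) m = m"
    using assms by (intro poly_mapping_eqI) (auto simp: lookup_map_key[OF p] Transposition.transpose_def)
  then have "lookup (eigenop N c f) m = - lookup (eigenop N c f) m"
    using lookup_eigenop_permute[OF p assms(1), of c m] assms(4) by (simp add: sign_swap_id)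
  then have "2 * lookup (eigenop N c f) m = 0" by (simp only: eq_neg_iff_add_eq_0 mult_2)
  then show ?thesis using two_nonzero by simp
qed

lemma in_vars_sdiff: "in_vars N f \<Longrightarrow> in_vars N (sdiff k f)"
  unfolding in_vars_def by (auto simp: in_keys_iff lookup_sdiff)

lemma deg_le_sdiff: "deg_le N d f \<Longrightarrow> deg_le N d (sdiff k f)"
  unfolding deg_le_def by (auto simp: in_keys_iff lookup_sdiff)

lemma in_vars_alternant: "in_vars N (alternant N)"
  unfolding alternant_def by (intro in_vars_sum in_vars_single keys_map_key_stair) auto

lemma in_vars_alternant_shift: "in_vars N (alternant_shift N k)"
  unfolding alternant_shift_def by (intro in_vars_sum in_vars_diff in_vars_single keys_map_key_stair) auto

lemma in_vars_eigenop: "in_vars N f \<Longrightarrow> in_vars N (eigenop N c f)"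
  unfolding eigenop_def
  by (intro in_vars_diff in_vars_sum in_vars_mult in_vars_alternant in_vars_alternant_shift in_vars_sdiff in_vars_single) auto

lemma deg_le_alternant: "deg_le N (\<Sum>i<N. N - i) (alternant N)"
  unfolding alternant_def by (intro deg_le_sum) (simp add: deg_le_def sum_map_key_stair)

lemma deg_le_alternant_shift: "deg_le N (\<Sum>i<N. N - i) (alternant_shift N k)"
  unfolding alternant_shift_def
proof (intro deg_le_sum deg_le_diff)
  fix w assume "w \<in> {w. w permutes {..<N}}"
  then have w: "w permutes {..<N}" by simp
  show "deg_le N (\<Sum>i<N. N - i) (single (map_key w (stair N)) (of_int (sign w) * t ^ w k))"
    using w by (simp add: deg_le_def sum_map_key_stair)
  have "(\<Sum>i<N. lookup (map_key w (stair N) - single k 1) i) \<le> (\<Sum>i<N. lookup (map_key w (stair N)) i)"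
    by (intro sum_mono) (simp add: lookup_minus)
  then show "deg_le N (\<Sum>i<N. N - i) (single (map_key w (stair N) - single k 1) (of_int (sign w) * t ^ w k))"
    using sum_map_key_stair[OF w] by (simp add: deg_le_def)
qed

lemma deg_le_eigenop:
  assumes "deg_le N d f"
  shows "deg_le N ((\<Sum>i<N. N - i) + d) (eigenop N c f)"
proof -
  have "deg_le N (0 + (\<Sum>i<N. N - i)) (single 0 c * alternant N)"
    by (intro deg_le_mult deg_le_alternant) (simp add: deg_le_def)
  then show ?thesis
    unfolding eigenop_def using assms
    by (intro deg_le_diff deg_le_sum deg_le_mult deg_le_alternant_shift deg_le_sdiff) auto
qed

text \<open>The alternants contain every variable, except that a lowered term for
  \<open>k = i\<close> may lack \<open>x i\<close>. That term is multiplied by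
  \<open>sdiff i f\<close>, where all monomials free of \<open>x i\<close> cancel.\<close>

lemma eigenop_exponent_pos:
  assumes "m \<in> keys (eigenop N c f)" "i < N"
  shows "0 < lookup m i"
proof (rule ccontr)
  assume "\<not> ?thesis"
  then have m0: "lookup m i = 0" by simp
  have stair_pos: "0 < lookup (map_key w (stair N)) i" if "w permutes {..<N}" for w
    using that assms(2) permutes_in_image[OF that, of i] by (simp add: lookup_map_key[OF that])
  have zero: "lookup (p * r) m = 0"
    if "\<And>a b. a \<in> keys p \<Longrightarrow> b \<in> keys r \<Longrightarrow> 0 < lookup a i + lookup b i" for p r :: "'a mpol"
  proof (rule ccontr)
    assume "lookup (p * r) m \<noteq> 0"
    then obtain a b where "m = a + b" "a \<in> keys p" "b \<in> keys r"
      using keys_mult[of p r] by (auto simp: in_keys_iff[symmetric])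
    then show False using that[of a b] m0 by (simp add: lookup_add)
  qed
  have alt: "0 < lookup a i" if "a \<in> keys (alternant N)" for a
  proof -
    have "\<exists>w. w permutes {..<N} \<and> a = map_key w (stair N)"
      using that unfolding alternant_def
      by (auto simp: in_keys_iff lookup_sum lookup_single when_def elim!: sum.not_neutral_contains_not_neutral split: if_splits)
    then show ?thesis using stair_pos by auto
  qed
  have alts: "0 < lookup a i" if a: "a \<in> keys (alternant_shift N k)" and "k \<noteq> i" for a k
  proof -
    have "\<exists>w. w permutes {..<N} \<and> (a = map_key w (stair N) \<or> a = map_key w (stair N) - single k 1)"
      using a unfolding alternant_shift_def
      by (auto simp: in_keys_iff lookup_sum lookup_minus lookup_single when_def elim!: sum.not_neutral_contains_not_neutral split: if_splits)
    then show ?thesis using stair_pos \<open>k \<noteq> i\<close> by (auto simp: lookup_minus lookup_single when_def)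
  qed
  have sd: "0 < lookup b i" if "b \<in> keys (sdiff i f)" for b
    using that by (cases "lookup b i") (auto simp: in_keys_iff lookup_sdiff)
  have "lookup (alternant_shift N k * sdiff k f) m = 0" for k
    by (rule zero) (use alts sd in \<open>cases "k = i"; auto\<close>)
  moreover have "lookup (alternant N * f) m = 0" by (rule zero) (use alt in auto)
  ultimately have "lookup (eigenop N c f) m = 0"
    by (simp add: eigenop_def lookup_minus lookup_sum mult.assoc)
  then show False using assms(1) by (simp add: in_keys_iff)
qed

text \<open>By antisymmetry and positivity every exponent is, up to a permutation, strictly
  decreasing and positive, that is, of the form \<open>Poly_Mapping.nth \<nu> + stair N\<close>; the
  degree bounds the size of \<open>\<nu>\<close>. Testing these finitely many coefficients replaces
  a division by the Vandermonde determinant.\<close>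

lemma eigenop_eq_0:
  assumes f: "is_symmetric N f" "deg_le N d f"
    and *: "\<And>\<nu>. is_partition \<nu> \<Longrightarrow> length \<nu> \<le> N \<Longrightarrow> sum_list \<nu> \<le> d \<Longrightarrow>
      lookup (eigenop N c f) (Poly_Mapping.nth \<nu> + stair N) = 0"
  shows "eigenop N c f = 0"
proof (rule ccontr)
  let ?T = "eigenop N c f"
  assume "?T \<noteq> 0"
  then obtain m where m: "lookup ?T m \<noteq> 0" by (metis lookup_zero poly_mapping_eqI)
  have iv: "in_vars N ?T" using f(1) by (intro in_vars_eigenop) (simp add: is_symmetric_def)
  then have "keys m \<subseteq> {..<N}" using m by (simp add: in_vars_def in_keys_iff)
  then obtain \<mu> where \<mu>: "is_partition \<mu>" "length \<mu> \<le> N" "m \<in> orbit_monomials N \<mu>"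
    using keys_subset_imp_orbit by blast
  then obtain \<sigma> where \<sigma>: "\<sigma> permutes {..<N}" "m = map_key \<sigma> (Poly_Mapping.nth \<mu>)"
    by (auto simp: orbit_monomials_def)
  define p where "p = nth_default 0 \<mu>"
  have T: "lookup ?T (Poly_Mapping.nth \<mu>) \<noteq> 0"
    using m lookup_eigenop_permute[OF \<sigma>(1) f(1), of c "Poly_Mapping.nth \<mu>"]
    by (cases \<sigma> rule: sign_cases) (simp_all add: \<sigma>(2))
  have strict: "p (Suc i) < p i" if "Suc i < N" for i
  proof -
    have "p (Suc i) \<le> p i" using partition_nth_mono[OF \<mu>(1), of i "Suc i"] by (simp add: p_def)
    moreover have "p (Suc i) \<noteq> p i"
      using T lookup_eigenop_repeated[OF f(1) _ that, of i "Poly_Mapping.nth \<mu>" c] that by (auto simp: p_def)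
    ultimately show ?thesis by simp
  qed
  have pos: "0 < p i" if "i < N" for i
    using eigenop_exponent_pos[of "Poly_Mapping.nth \<mu>" N c f i] T that by (simp add: in_keys_iff p_def)
  have p_ge: "N - i \<le> p i" if "i < N" for i
    using that
  proof (induction "N - i" arbitrary: i)
    case (Suc k)
    show ?case
    proof (cases "Suc i < N")
      case True
      then have "N - Suc i \<le> p (Suc i)" using Suc by (intro Suc.hyps(1)) auto
      then show ?thesis using strict[OF True] by linarith
    next
      case False
      then show ?thesis using pos[OF Suc.prems] by linarith
    qed
  qed simp
  have p0: "p i = 0" if "N \<le> i" for i using that \<mu>(2) by (simp add: p_def nth_default_def)
  define n where "n = Poly_Mapping.nth \<mu> - stair N"
  have lookup_n: "lookup n i = p i - (N - i)" for i by (simp add: n_def lookup_minus p_def)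
  have n: "n + stair N = Poly_Mapping.nth \<mu>"
  proof (rule poly_mapping_eqI)
    fix i show "lookup (n + stair N) i = lookup (Poly_Mapping.nth \<mu>) i"
      using p_ge[of i] p0[of i] by (cases "i < N") (simp_all add: lookup_add lookup_n flip: p_def)
  qed
  have kn: "keys n \<subseteq> {..<N}"
  proof
    fix i assume "i \<in> keys n"
    then have "p i \<noteq> 0" by (auto simp: in_keys_iff lookup_n)
    then show "i \<in> {..<N}" using p0[of i] by (cases "N \<le> i") auto
  qed
  have "lookup n (Suc i) \<le> lookup n i" for i
    using strict[of i] p_ge[of i] p0[of "Suc i"] by (cases "Suc i < N") (auto simp: lookup_n)
  then have anti: "lookup n j \<le> lookup n i" if "i \<le> j" for i j
    using lift_Suc_antimono_le[of "lookup n" i j] that by simp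
  obtain \<nu> where \<nu>: "is_partition \<nu>" "length \<nu> \<le> N" "n \<in> orbit_monomials N \<nu>"
    using keys_subset_imp_orbit[OF kn] by blast
  then obtain \<tau> where \<tau>: "\<tau> permutes {..<N}" "n = map_key \<tau> (Poly_Mapping.nth \<nu>)"
    by (auto simp: orbit_monomials_def)
  have "Poly_Mapping.nth \<nu> = map_key (inv_into UNIV \<tau>) n" unfolding \<tau>(2) by (simp add: map_key_inv[OF \<tau>(1)])
  also have "\<dots> \<le> n" using anti by (intro map_key_le[OF permutes_inv[OF \<tau>(1)]]) auto
  finally have n\<nu>: "n = Poly_Mapping.nth \<nu>" using orbit_le[OF \<nu>(1,3)] by simp
  have "(\<Sum>i<N. lookup (n + stair N) i) \<le> (\<Sum>i<N. N - i) + d"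
    unfolding n using bspec[OF deg_le_eigenop[OF f(2), of c, unfolded deg_le_def], of "Poly_Mapping.nth \<mu>"] T
    by (simp only: in_keys_iff not_False_eq_True)
  then have "(\<Sum>i<N. lookup n i) \<le> d" by (simp only: lookup_add lookup_stair sum.distrib)
  then have "sum_list \<nu> \<le> d" using sum_lookup_orbit[OF \<nu>(3,2)] by simp
  then have "lookup ?T (n + stair N) = 0" unfolding n\<nu> by (rule *[OF \<nu>(1,2)])
  then show False using T unfolding n by contradiction
qed

abbreviation eigenval_part :: "nat \<Rightarrow> nat list \<Rightarrow> 'a" where
  "eigenval_part N \<nu> \<equiv> eigenval N (lookup (Poly_Mapping.nth \<nu>))"

text \<open>The scalar is left free; the nonzero coefficient at \<open>\<nu>\<close> is what permits
  the normalisation later.\<close>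

definition is_eigenfunction :: "nat \<Rightarrow> nat list \<Rightarrow> 'a mpol \<Rightarrow> bool" where
  "is_eigenfunction N \<nu> f \<longleftrightarrow> is_symmetric N f \<and> deg_le N (sum_list \<nu>) f \<and>
     eigenop N (eigenval_part N \<nu>) f = 0 \<and> mcoeff f \<nu> \<noteq> 0"

text \<open>The unknowns are the coefficients of the \<open>monomial_sym\<close> of
  lexicographically smaller partitions. The conditions of \<open>eigenop_eq_0\<close> form a
  triangular system whose diagonal entries are eigenvalue differences; at \<open>l\<close> itself
  the condition holds automatically.\<close>

lemma eigenfunction_exists:
  assumes l: "is_partition l" "length l \<le> N"
  shows "\<exists>f. is_eigenfunction N l f"
proof -
  let ?nth = "Poly_Mapping.nth :: nat list \<Rightarrow> _"
  let ?c = "eigenval_part N l"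
  let ?d = "sum_list l"
  let ?m = "monomial_sym N :: nat list \<Rightarrow> 'a mpol"
  define X where "X = {\<mu>. is_partition \<mu> \<and> length \<mu> \<le> N \<and> sum_list \<mu> \<le> ?d \<and> ?nth \<mu> < ?nth l}"
  define A where "A \<mu> \<nu> = lookup (eigenop N ?c (?m \<mu>)) (?nth \<nu> + stair N)" for \<mu> \<nu>
  have fin: "finite X" using finite_partitions_bounded[of N ?d] by (rule finite_subset[rotated]) (auto simp: X_def)
  have beyond: "lookup (?m \<mu>) m = 0" if "is_partition \<mu>" "?nth \<mu> < m" for \<mu> m
    using orbit_le[OF that(1), of m N] that(2) by (auto simp: lookup_monomial_sym not_less[symmetric])
  have A_upper: "A \<mu> \<nu> = 0" if "is_partition \<mu>" "?nth \<mu> < ?nth \<nu>" for \<mu> \<nu>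
    unfolding A_def using that beyond by (subst eigenop_leading_coeff_exact) (auto intro: less_trans)
  have A_diag: "A \<mu> \<mu> = eigenval_part N \<mu> - ?c" if "is_partition \<mu>" for \<mu>
    unfolding A_def using that beyond by (subst eigenop_leading_coeff_exact) (auto simp: lookup_monomial_sym orbit_self)
  have "\<exists>a. \<forall>\<nu>\<in>X. (\<Sum>\<mu>\<in>X. a \<mu> * A \<mu> \<nu>) = - A l \<nu>"
  proof (rule triangular_solve[OF fin, of ?nth])
    show "inj_on ?nth X" by (auto simp: inj_on_def X_def intro: nth_inj)
    fix \<mu> assume \<mu>: "\<mu> \<in> X"
    then have "eigenval_part N \<mu> \<noteq> ?c"
      by (intro eigenval_inj keys_nth_subset l(2)) (auto simp: X_def)
    then show "A \<mu> \<mu> \<noteq> 0" using \<mu> A_diag[of \<mu>] by (simp add: X_def)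
  qed (auto simp: A_upper X_def)
  then obtain a where a: "\<And>\<nu>. \<nu> \<in> X \<Longrightarrow> (\<Sum>\<mu>\<in>X. a \<mu> * A \<mu> \<nu>) = - A l \<nu>" by blast
  define f where "f = ?m l + (\<Sum>\<mu>\<in>X. single 0 (a \<mu>) * ?m \<mu>)"
  have sym: "is_symmetric N f"
    unfolding f_def using l
    by (intro is_symmetric_add is_symmetric_sum is_symmetric_const_times is_symmetric_monomial_sym) (auto simp: X_def)
  have "deg_le N (0 + ?d) (single 0 (a \<mu>) * ?m \<mu>)" if "\<mu> \<in> X" for \<mu>
    using that by (intro deg_le_mult deg_le_monomial_sym) (auto simp: X_def deg_le_def)
  then have deg: "deg_le N ?d f"
    unfolding f_def using l by (intro deg_le_add deg_le_sum deg_le_monomial_sym) auto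
  have T: "lookup (eigenop N ?c f) (?nth \<nu> + stair N) = A l \<nu> + (\<Sum>\<mu>\<in>X. a \<mu> * A \<mu> \<nu>)" for \<nu>
    by (simp add: f_def A_def eigenop_add eigenop_sum eigenop_const_times lookup_add lookup_sum)
  have "eigenop N ?c f = 0"
  proof (rule eigenop_eq_0[OF sym deg])
    fix \<nu> assume \<nu>: "is_partition \<nu>" "length \<nu> \<le> N" "sum_list \<nu> \<le> ?d"
    consider "?nth \<nu> < ?nth l" | "?nth \<nu> = ?nth l" | "?nth l < ?nth \<nu>" by (rule linorder_cases)
    then show "lookup (eigenop N ?c f) (?nth \<nu> + stair N) = 0"
    proof cases
      case 1
      then show ?thesis unfolding T using a[of \<nu>] \<nu> by (simp add: X_def)
    next
      case 2
      then have "\<nu> = l" using nth_inj \<nu> l by blast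
      then show ?thesis unfolding T using A_diag[OF l(1)] by (auto simp: X_def A_upper intro!: sum.neutral)
    next
      case 3
      then show ?thesis unfolding T using A_upper[OF l(1)]
        by (auto simp: X_def intro!: sum.neutral A_upper intro: less_trans)
    qed
  qed
  moreover have "lookup (?m \<mu>) (?nth l) = 0" if "\<mu> \<in> X" for \<mu>
    using that beyond by (simp add: X_def)
  then have "mcoeff f l = 1"
    by (simp add: f_def mcoeff_def lookup_add lookup_sum lookup_monomial_sym orbit_self)
  ultimately show ?thesis using sym deg unfolding is_eigenfunction_def by auto
qed

end

section \<open>Values at the interpolation nodes\<close>

definition altval :: "nat \<Rightarrow> (nat \<Rightarrow> nat) \<Rightarrow> (nat \<Rightarrow> 'a::field) \<Rightarrow> 'a" where
  "altval N e x = (\<Sum>w | w permutes {..<N}. of_int (sign w) * (\<Prod>i<N. x i ^ e (w i)))"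

lemma altval_det: "altval N e x = det (mat N N (\<lambda>(i, j). x i ^ e j))"
proof -
  have "signof w = (of_int (sign w) :: 'a)" for w by (simp add: sign_def)
  moreover have "(\<Prod>i = 0..<N. mat N N (\<lambda>(i, j). x i ^ e j) $$ (i, w i)) = (\<Prod>i<N. x i ^ e (w i))"
    if "w permutes {0..<N}" for w
    using permutes_in_image[OF that] unfolding lessThan_atLeast0 by (intro prod.cong) auto
  ultimately show ?thesis
    by (subst det_def'[of _ N]) (auto simp: altval_def lessThan_atLeast0 intro!: sum.cong)
qed

lemma altval_repeated_var:
  assumes "i < N" "j < N" "i \<noteq> j" "x i = x j"
  shows "altval N e x = 0"
  unfolding altval_det
  by (rule det_identical_rows[OF _ assms(3,1,2)]) (use assms in \<open>auto intro!: eq_vecI\<close>)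

lemma altval_repeated_exponent:
  assumes "i < N" "j < N" "i \<noteq> j" "e i = e j"
  shows "altval N e x = 0"
proof -
  let ?A = "mat N N (\<lambda>(i, j). x i ^ e j)"
  have "det (transpose_mat ?A) = 0"
    by (rule det_identical_rows[OF _ assms(3,1,2)]) (use assms in \<open>auto intro!: eq_vecI\<close>)
  then show ?thesis unfolding altval_det by (subst (asm) det_transpose[of _ N]) auto
qed

text \<open>A kernel vector would be the coefficient list of a nonzero polynomial of degree at most
  \<open>N\<close> with \<open>N + 1\<close> roots: the distinct nonzero \<open>x i\<close>, and 0,
  as all exponents \<open>N - j\<close> are positive.\<close>

lemma altval_nonzero:
  assumes inj: "inj_on x {..<N}" and nz: "\<And>i. i < N \<Longrightarrow> x i \<noteq> 0"
  shows "altval N (\<lambda>j. N - j) x \<noteq> 0"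
proof
  let ?A = "mat N N (\<lambda>(i, j). x i ^ (N - j))"
  assume "altval N (\<lambda>j. N - j) x = 0"
  then obtain v where v: "v \<in> carrier_vec N" "v \<noteq> 0\<^sub>v N" "?A *\<^sub>v v = 0\<^sub>v N"
    unfolding altval_det using det_0_iff_vec_prod_zero_field[of ?A N] by auto
  define p where "p = (\<Sum>j<N. monom (v $ j) (N - j))"
  have coeff: "coeff p (N - j) = v $ j" if "j < N" for j
  proof -
    have "coeff p (N - j) = (\<Sum>k<N. if k = j then v $ k else 0)"
      unfolding p_def coeff_sum using that by (intro sum.cong) auto
    then show ?thesis using that by simp
  qed
  have "poly p (x i) = 0" if "i < N" for i
  proof -
    have "poly p (x i) = (?A *\<^sub>v v) $ i"
      using that v(1) by (simp add: p_def poly_sum poly_monom scalar_prod_def lessThan_atLeast0 mult.commute)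
    then show ?thesis using that by (simp add: v(3))
  qed
  moreover have "poly p 0 = 0"
    unfolding p_def poly_sum by (intro sum.neutral) (simp add: poly_monom power_0_left)
  ultimately have roots: "insert 0 (x ` {..<N}) \<subseteq> {y. poly p y = 0}" by auto
  have "card (insert 0 (x ` {..<N})) = Suc N"
    using nz by (subst card_insert_disjoint) (auto simp: card_image[OF inj])
  moreover have "degree p \<le> N" unfolding p_def by (intro degree_sum_le) (auto intro: order_trans[OF degree_monom_le])
  ultimately have "p = 0"
    using card_poly_roots_bound[of p] card_mono[OF poly_roots_finite roots] by force
  then have "v = 0\<^sub>v N" using v(1) coeff by (intro eq_vecI) auto
  then show False using v(2) by simp
qed

definition is_dominant :: "nat \<Rightarrow> (nat \<Rightarrow> nat) \<Rightarrow> bool" where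
  "is_dominant N \<mu> \<longleftrightarrow> (\<forall>i j. i \<le> j \<longrightarrow> j < N \<longrightarrow> \<mu> j \<le> \<mu> i)"

lemma is_dominant_partition: "is_partition \<mu> \<Longrightarrow> is_dominant N (nth_default 0 \<mu>)"
  by (simp add: is_dominant_def partition_nth_mono)

lemma mpeval_cong:
  fixes p :: "'a::comm_ring_1 mpol"
  assumes "in_vars N p" "\<And>i. i < N \<Longrightarrow> x i = y i"
  shows "mpeval x p = mpeval y p"
proof -
  have "mon_eval x m = mon_eval y m" if "m \<in> keys p" for m
  proof -
    have "keys m \<subseteq> {..<N}" using that assms(1) by (simp add: in_vars_def)
    then have "x i = y i" if "i \<in> keys m" for i using that assms(2) by blast
    then show ?thesis unfolding mon_eval_def by (intro prod.cong) auto
  qed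
  then show ?thesis unfolding mpeval_mon_eval by simp
qed

lemma base_expansion_inj:
  fixes a b :: "nat \<Rightarrow> nat"
  assumes "\<And>i. i < N \<Longrightarrow> a i < B" "\<And>i. i < N \<Longrightarrow> b i < B"
    and "(\<Sum>i<N. a i * B ^ (N - Suc i)) = (\<Sum>i<N. b i * B ^ (N - Suc i))"
  shows "\<forall>i<N. a i = b i"
  using assms
proof (induction N)
  case (Suc N)
  have split: "(\<Sum>i<Suc N. c i * B ^ (Suc N - Suc i)) = B * (\<Sum>i<N. c i * B ^ (N - Suc i)) + c N" for c :: "nat \<Rightarrow> nat"
  proof -
    have "(\<Sum>i<N. c i * B ^ (N - i)) = (\<Sum>i<N. B * (c i * B ^ (N - Suc i)))"
    proof (intro sum.cong refl)
      fix i assume "i \<in> {..<N}"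
      then have "N - i = Suc (N - Suc i)" by auto
      then show "c i * B ^ (N - i) = B * (c i * B ^ (N - Suc i))" by simp
    qed
    then show ?thesis by (simp add: sum_distrib_left)
  qed
  have eq: "B * (\<Sum>i<N. a i * B ^ (N - Suc i)) + a N = B * (\<Sum>i<N. b i * B ^ (N - Suc i)) + b N"
    using Suc.prems(3) unfolding split .
  have lt: "a N < B" "b N < B" using Suc.prems by auto
  have "a N = b N" using arg_cong[OF eq, of "\<lambda>z. z mod B"] lt by simp
  moreover have "(\<Sum>i<N. a i * B ^ (N - Suc i)) = (\<Sum>i<N. b i * B ^ (N - Suc i))"
    using arg_cong[OF eq, of "\<lambda>z. z div B"] lt by simp
  then have "\<forall>i<N. a i = b i"
    using Suc.prems(1,2) by (intro Suc.IH) (simp_all only: less_SucI)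
  ultimately show ?case unfolding less_Suc_eq by blast
qed simp

context local_qt
begin

text \<open>The value 0 beyond \<open>N\<close> makes nodes equal as functions as soon as they agree
  on the variables in use.\<close>

definition node :: "nat \<Rightarrow> (nat \<Rightarrow> nat) \<Rightarrow> nat \<Rightarrow> 'a" where
  "node N \<mu> i = (if i < N then q ^ \<mu> i * t ^ (N - 1 - i) else 0)"

abbreviation vander :: "nat \<Rightarrow> (nat \<Rightarrow> 'a) \<Rightarrow> 'a" where
  "vander N \<equiv> altval N (\<lambda>j. N - j)"

lemma node_nonzero: "i < N \<Longrightarrow> node N \<mu> i \<noteq> 0"
  by (simp add: node_def q_nonzero t_nonzero)

lemma vander_node: "vander N (node N \<mu>) \<noteq> 0"
proof (rule altval_nonzero)
  show "inj_on (node N \<mu>) {..<N}"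
  proof (rule inj_onI)
    fix i j assume ij: "i \<in> {..<N}" "j \<in> {..<N}" "node N \<mu> i = node N \<mu> j"
    then have "N - 1 - i = N - 1 - j" using node_inj by (auto simp: node_def)
    then show "i = j" using ij by auto
  qed
qed (rule node_nonzero)

lemma mon_eval_stair:
  assumes "w permutes {..<N}"
  shows "mon_eval x (map_key w (stair N)) = (\<Prod>i<N. x i ^ (N - w i))"
  by (subst mon_eval_superset[OF keys_map_key_stair(1)[OF assms]]) (simp_all add: lookup_map_key[OF assms])

lemma mpeval_alternant: "mpeval x (alternant N) = vander N x"
  by (simp add: alternant_def mpeval.hom_sum mpeval.hom_single altval_def mon_eval_stair)

definition shift_val :: "nat \<Rightarrow> (nat \<Rightarrow> 'a) \<Rightarrow> nat \<Rightarrow> 'a" where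
  "shift_val N x k = (\<Sum>w | w permutes {..<N}. of_int (sign w) * t ^ w k * (\<Prod>i<N. x i ^ (N - w i)))"

lemma mpeval_alternant_shift:
  assumes "k < N" "x k \<noteq> 0"
  shows "mpeval x (alternant_shift N k) = shift_val N x k * (1 - inverse (x k))"
proof -
  have "mon_eval x (map_key w (stair N) - single k 1) = (\<Prod>i<N. x i ^ (N - w i)) * inverse (x k)"
    if w: "w permutes {..<N}" for w
  proof -
    have "w k < N" using permutes_in_image[OF w, of k] assms(1) by simp
    then have "map_key w (stair N) = (map_key w (stair N) - single k 1) + single k 1"
      by (intro poly_mapping_eqI) (auto simp: lookup_add lookup_minus lookup_map_key[OF w] lookup_single when_def)
    then have "mon_eval x (map_key w (stair N)) = mon_eval x (map_key w (stair N) - single k 1) * mon_eval x (single k 1)"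
      using mpeval.G_add by metis
    moreover have "mon_eval x (single k 1) = x k" by (simp add: mon_eval_def)
    ultimately have "(\<Prod>i<N. x i ^ (N - w i)) = mon_eval x (map_key w (stair N) - single k 1) * x k"
      by (simp only: mon_eval_stair[OF w])
    then show ?thesis using assms(2) by simp
  qed
  then show ?thesis
    unfolding alternant_shift_def shift_val_def sum_distrib_right mpeval.hom_sum
    by (intro sum.cong) (auto simp: mpeval.hom_diff mpeval.hom_single mon_eval_stair algebra_simps)
qed

text \<open>Replacing \<open>x k\<close> by \<open>x k / t\<close> divides the term of
  \<open>w\<close> by \<open>t ^ (N - w k)\<close>. In this form zeros of \<open>shift_val\<close>
  become visible as repeated variables.\<close>

lemma shift_val_vander:
  assumes "k < N"
  shows "shift_val N x k = t ^ N * vander N (x(k := x k / t))"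
  unfolding shift_val_def altval_def sum_distrib_left
proof (intro sum.cong refl)
  fix w assume "w \<in> {w. w permutes {..<N}}"
  then have "w k < N" using permutes_in_image[of w "{..<N}" k] assms by simp
  then have N: "t ^ N = t ^ w k * t ^ (N - w k)" by (simp flip: power_add)
  have "(\<Prod>i<N. (x(k := x k / t)) i ^ (N - w i)) = (\<Prod>i<N. (if i = k then inverse (t ^ (N - w k)) else 1) * x i ^ (N - w i))"
    by (intro prod.cong) (auto simp: power_divide field_simps)
  also have "\<dots> = inverse (t ^ (N - w k)) * (\<Prod>i<N. x i ^ (N - w i))"
    using assms by (simp add: prod.distrib)
  finally show "of_int (sign w) * t ^ w k * (\<Prod>i<N. x i ^ (N - w i))
     = t ^ N * (of_int (sign w) * (\<Prod>i<N. (x(k := x k / t)) i ^ (N - w i)))"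
    using t_nonzero by (simp add: N)
qed

lemma shift_val_node_eq_0:
  assumes "Suc k < N" "\<mu> k = \<mu> (Suc k)"
  shows "shift_val N (node N \<mu>) k = 0"
proof -
  let ?x = "(node N \<mu>)(k := node N \<mu> k / t)"
  have "N - 1 - k = Suc (N - 1 - Suc k)" using assms(1) by simp
  then have "node N \<mu> k / t = node N \<mu> (Suc k)"
    using assms t_nonzero by (simp add: node_def)
  then have "vander N ?x = 0" using assms(1) by (intro altval_repeated_var[of k N "Suc k"]) auto
  then show ?thesis using assms(1) by (simp add: shift_val_vander)
qed

text \<open>Dividing by \<open>x\<^sub>k\<close> lowers one exponent of the alternant by one. This repeats an exponent
  unless the lowered exponent is the last one.\<close>

lemma sum_alternant_lowered:
  assumes "0 < N" "\<And>i. i < N \<Longrightarrow> x i \<noteq> 0"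
  shows "(\<Sum>k<N. \<Sum>w | w permutes {..<N}. of_int (sign w) * s ^ w k * (\<Prod>i<N. x i ^ (N - w i)) * inverse (x k))
    = s ^ (N - 1) * altval N (\<lambda>l. N - l - (if l = N - 1 then 1 else 0)) x"
proof -
  let ?e = "\<lambda>j l. N - l - (if l = j then 1 else 0 :: nat)"
  have "(\<Sum>k<N. \<Sum>w | w permutes {..<N}. of_int (sign w) * s ^ w k * (\<Prod>i<N. x i ^ (N - w i)) * inverse (x k))
    = (\<Sum>w | w permutes {..<N}. \<Sum>k<N. of_int (sign w) * s ^ w k * (\<Prod>i<N. x i ^ (N - w i)) * inverse (x k))"
    by (rule sum.swap)
  also have "\<dots> = (\<Sum>w | w permutes {..<N}. \<Sum>k<N. of_int (sign w) * s ^ w k * (\<Prod>i<N. x i ^ ?e (w k) (w i)))"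
  proof (rule sum.cong[OF refl], rule sum.cong[OF refl])
    fix w k assume "w \<in> {w. w permutes {..<N}}" and k: "k \<in> {..<N}"
    then have w: "w permutes {..<N}" by simp
    have wk: "w k < N" using permutes_in_image[OF w, of k] k by simp
    have "(\<Prod>i<N. x i ^ (N - w i)) = (\<Prod>i<N. x i ^ ?e (w k) (w i) * (if i = k then x k else 1))"
    proof (intro prod.cong refl)
      fix i
      have "w i = w k \<longleftrightarrow> i = k" using permutes_inj[OF w] by (auto simp: inj_def)
      moreover have "N - w k = Suc (N - w k - 1)" using wk by simp
      ultimately show "x i ^ (N - w i) = x i ^ ?e (w k) (w i) * (if i = k then x k else 1)"
        by (auto simp flip: power_Suc2)
    qed
    also have "\<dots> = (\<Prod>i<N. x i ^ ?e (w k) (w i)) * x k"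
      using k by (simp add: prod.distrib)
    finally show "of_int (sign w) * s ^ w k * (\<Prod>i<N. x i ^ (N - w i)) * inverse (x k)
      = of_int (sign w) * s ^ w k * (\<Prod>i<N. x i ^ ?e (w k) (w i))"
      using assms(2) k by simp
  qed
  also have "\<dots> = (\<Sum>w | w permutes {..<N}. \<Sum>j<N. of_int (sign w) * s ^ j * (\<Prod>i<N. x i ^ ?e j (w i)))"
  proof (rule sum.cong[OF refl])
    fix w assume "w \<in> {w. w permutes {..<N}}"
    then show "(\<Sum>k<N. of_int (sign w) * s ^ w k * (\<Prod>i<N. x i ^ ?e (w k) (w i)))
      = (\<Sum>j<N. of_int (sign w) * s ^ j * (\<Prod>i<N. x i ^ ?e j (w i)))"
      using sum.permute[of w "{..<N}" "\<lambda>j. of_int (sign w) * s ^ j * (\<Prod>i<N. x i ^ ?e j (w i))"]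
      by (simp add: comp_def)
  qed
  also have "\<dots> = (\<Sum>j<N. s ^ j * altval N (?e j) x)"
    by (subst sum.swap) (simp add: altval_def sum_distrib_left mult_ac)
  also have "\<dots> = (\<Sum>j<N. if j = N - 1 then s ^ j * altval N (?e j) x else 0)"
  proof (intro sum.cong refl)
    fix j assume j: "j \<in> {..<N}"
    have "altval N (?e j) x = 0" if "j \<noteq> N - 1"
      using j that by (intro altval_repeated_exponent[of j N "Suc j"]) auto
    then show "s ^ j * altval N (?e j) x = (if j = N - 1 then s ^ j * altval N (?e j) x else 0)" by simp
  qed
  finally show ?thesis using assms(1) by simp
qed

text \<open>\<open>sum_alternant_lowered\<close> is used twice: with 1 it expresses the lowered
  alternant by the Vandermonde value, with \<open>t\<close> it then evaluates the part with
  \<open>inverse (x k)\<close>. At a node, \<open>t ^ (N - 1) * inverse (x k)\<close> equals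
  \<open>t ^ k * inverse q ^ \<mu> k\<close>, a summand of the eigenvalue.\<close>

lemma sum_alternant_shift_node:
  "(\<Sum>k<N. mpeval (node N \<mu>) (alternant_shift N k)) = - eigenval N \<mu> * vander N (node N \<mu>)"
proof (cases "N = 0")
  case False
  let ?x = "node N \<mu>"
  let ?P = "\<lambda>w. \<Prod>i<N. ?x i ^ (N - w i)"
  let ?Q = "altval N (\<lambda>l. N - l - (if l = N - 1 then 1 else 0)) ?x"
  have N: "0 < N" using False by simp
  have "(\<Sum>k<N. \<Sum>w | w permutes {..<N}. of_int (sign w) * 1 ^ w k * ?P w * inverse (?x k))
      = (\<Sum>k<N. inverse (?x k)) * vander N ?x"
    by (subst sum.swap) (simp add: altval_def sum_distrib_left sum_distrib_right mult_ac)
  then have Q: "?Q = (\<Sum>k<N. inverse (?x k)) * vander N ?x"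
    using sum_alternant_lowered[OF N, of ?x 1] node_nonzero by simp
  have "(\<Sum>k<N. shift_val N ?x k) = (\<Sum>w | w permutes {..<N}. of_int (sign w) * ?P w * (\<Sum>k<N. t ^ w k))"
    unfolding shift_val_def by (subst sum.swap) (simp add: sum_distrib_left sum_distrib_right mult_ac)
  also have "\<dots> = (\<Sum>w | w permutes {..<N}. of_int (sign w) * ?P w * (\<Sum>k<N. t ^ k))"
  proof (rule sum.cong[OF refl], rule arg_cong2[of _ _ _ _ "(*)", OF refl])
    fix w assume "w \<in> {w. w permutes {..<N}}"
    then show "(\<Sum>k<N. t ^ w k) = (\<Sum>k<N. t ^ k)"
      using sum.permute[of w "{..<N}" "\<lambda>k. t ^ k"] by (simp add: comp_def)
  qed
  finally have 1: "(\<Sum>k<N. shift_val N ?x k) = (\<Sum>k<N. t ^ k) * vander N ?x"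
    by (simp add: altval_def sum_distrib_left sum_distrib_right mult_ac)
  have "(\<Sum>k<N. shift_val N ?x k * inverse (?x k)) = t ^ (N - 1) * ?Q"
    using sum_alternant_lowered[OF N, of ?x t] node_nonzero by (simp add: shift_val_def sum_distrib_right)
  also have "\<dots> = (\<Sum>k<N. t ^ (N - 1) * inverse (?x k)) * vander N ?x"
    unfolding Q sum_distrib_left[symmetric] by (rule mult.assoc[symmetric])
  also have "(\<Sum>k<N. t ^ (N - 1) * inverse (?x k)) = (\<Sum>k<N. t ^ k * inverse q ^ \<mu> k)"
  proof (intro sum.cong refl)
    fix k assume "k \<in> {..<N}"
    then have k: "k < N" and "t ^ (N - 1) = t ^ k * t ^ (N - 1 - k)" by (auto simp flip: power_add)
    then show "t ^ (N - 1) * inverse (?x k) = t ^ k * inverse q ^ \<mu> k"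
      using t_nonzero by (simp add: node_def power_inverse)
  qed
  finally have "(\<Sum>k<N. shift_val N ?x k * inverse (?x k)) = (\<Sum>k<N. t ^ k * inverse q ^ \<mu> k) * vander N ?x" .
  moreover have "(\<Sum>k<N. mpeval ?x (alternant_shift N k))
      = (\<Sum>k<N. shift_val N ?x k) - (\<Sum>k<N. shift_val N ?x k * inverse (?x k))"
    unfolding sum_subtractf[symmetric] using node_nonzero
    by (intro sum.cong refl) (simp add: mpeval_alternant_shift right_diff_distrib)
  ultimately show ?thesis
    by (simp add: 1 eigenval_def right_diff_distrib sum_subtractf left_diff_distrib)
qed (simp add: eigenval_def)

lemma eigenfunction_node_recursion:
  assumes "eigenop N c f = 0"
  shows "(c - eigenval N \<mu>) * vander N (node N \<mu>) * mpeval (node N \<mu>) f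
    = (\<Sum>k<N. mpeval (node N \<mu>) (alternant_shift N k) * mpeval ((node N \<mu>)(k := inverse q * node N \<mu> k)) f)"
proof -
  let ?x = "node N \<mu>"
  have "0 = mpeval ?x (eigenop N c f)" using assms by (simp add: mpeval.hom_0)
  also have "\<dots> = (\<Sum>k<N. mpeval ?x (alternant_shift N k) * mpeval (?x(k := inverse q * ?x k)) f)
     - (\<Sum>k<N. mpeval ?x (alternant_shift N k)) * mpeval ?x f - c * vander N ?x * mpeval ?x f"
    unfolding eigenop_def sdiff_def
    by (simp add: mpeval.hom_diff mpeval.hom_sum mpeval.hom_mult mpeval_alternant mpeval_shift_var mpeval.hom_single
        right_diff_distrib sum_subtractf sum_distrib_right mon_eval_def)
  finally show ?thesis unfolding sum_alternant_shift_node by (simp add: algebra_simps)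
qed

text \<open>In \<open>eigenfunction_node_recursion\<close> the coefficient of a neighbour vanishes
  when lowering \<open>\<mu> k\<close> destroys dominance: by \<open>shift_val_node_eq_0\<close> if
  the next part is equal, and by \<open>x k = 1\<close> for a last part 0. The remaining neighbours
  are nodes of smaller weight. The factor on the left is nonzero unless \<open>\<mu>\<close> agrees
  with \<open>l\<close>, which is why such points are left to a hypothesis.\<close>

lemma eigenfunction_vanishing:
  assumes f: "eigenop N (eigenval N l) f = 0" and "is_dominant N \<mu>"
    and sep: "\<And>\<mu>. \<exists>i<N. \<mu> i \<noteq> l i \<Longrightarrow> eigenval N \<mu> \<noteq> eigenval N l"
    and 0: "\<And>\<mu>'. is_dominant N \<mu>' \<Longrightarrow> (\<And>i. i < N \<Longrightarrow> \<mu>' i \<le> \<mu> i) \<Longrightarrow> (\<And>i. i < N \<Longrightarrow> \<mu>' i = l i) \<Longrightarrow> mpeval (node N \<mu>') f = 0"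
  shows "mpeval (node N \<mu>) f = 0"
  using assms(2) 0
proof (induction "\<Sum>i<N. \<mu> i" arbitrary: \<mu> rule: less_induct)
  case less
  let ?x = "node N \<mu>"
  show ?case
  proof (cases "\<forall>i<N. \<mu> i = l i")
    case True
    then show ?thesis using less.prems(1) by (intro less.prems(2)) auto
  next
    case False
    have "mpeval ?x (alternant_shift N k) * mpeval (?x(k := inverse q * ?x k)) f = 0" if k: "k < N" for k
    proof -
      consider "Suc k < N" "\<mu> k = \<mu> (Suc k)" | "k = N - 1" "\<mu> k = 0"
        | "0 < \<mu> k" "\<And>j. k < j \<Longrightarrow> j < N \<Longrightarrow> \<mu> j < \<mu> k"
      proof -
        have dom: "\<mu> j \<le> \<mu> i" if "i \<le> j" "j < N" for i j
          using less.prems(1) that by (simp add: is_dominant_def)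
        show ?thesis
        proof (cases "Suc k < N")
          case True
          show ?thesis
          proof (cases "\<mu> k = \<mu> (Suc k)")
            case False
            then have "\<mu> (Suc k) < \<mu> k" using dom[of k "Suc k"] True by simp
            show ?thesis
            proof (rule that(3))
              show "0 < \<mu> k" using \<open>\<mu> (Suc k) < \<mu> k\<close> by simp
              fix j assume "k < j" "j < N"
              then show "\<mu> j < \<mu> k" using \<open>\<mu> (Suc k) < \<mu> k\<close> dom[of "Suc k" j] by simp
            qed
          qed (use True that(1) in blast)
        next
          case False
          then have "k = N - 1" using k by simp
          then show ?thesis using that(2,3) k by (cases "\<mu> k = 0") auto
        qed
      qed
      then show ?thesis
      proof cases
        case 1
        then show ?thesis using k node_nonzero by (simp add: mpeval_alternant_shift shift_val_node_eq_0)
      next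
        case 2
        then have "?x k = 1" using k by (simp add: node_def)
        then show ?thesis using k by (simp add: mpeval_alternant_shift)
      next
        case 3
        let ?\<mu>' = "\<mu>(k := \<mu> k - 1)"
        have "?x(k := inverse q * ?x k) = node N ?\<mu>'"
        proof -
          have "q ^ \<mu> k = q * q ^ (\<mu> k - 1)" using 3(1) by (cases "\<mu> k") auto
          then show ?thesis using k q_nonzero by (auto simp: node_def fun_eq_iff)
        qed
        moreover have "mpeval (node N ?\<mu>') f = 0"
        proof (rule less.hyps)
          show "(\<Sum>i<N. ?\<mu>' i) < (\<Sum>i<N. \<mu> i)"
            using k 3(1) by (intro sum_strict_mono_ex1) auto
          show "is_dominant N ?\<mu>'"
            using less.prems(1) 3 unfolding is_dominant_def by (fastforce simp: le_less)
          fix \<nu> assume "is_dominant N \<nu>" "\<And>i. i < N \<Longrightarrow> \<nu> i \<le> ?\<mu>' i" "\<And>i. i < N \<Longrightarrow> \<nu> i = l i"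
          moreover have "?\<mu>' i \<le> \<mu> i" for i by simp
          ultimately show "mpeval (node N \<nu>) f = 0" by (meson less.prems(2) order_trans)
        qed
        ultimately show ?thesis by simp
      qed
    qed
    then have "(eigenval N l - eigenval N \<mu>) * vander N ?x * mpeval ?x f = 0"
      unfolding eigenfunction_node_recursion[OF f] by (intro sum.neutral) auto
    moreover have "eigenval N \<mu> \<noteq> eigenval N l" using sep False by blast
    ultimately show ?thesis using vander_node by simp
  qed
qed

text \<open>At \<open>\<mu>\<^sub>i = n B\<^bsup>N-1-i\<^esup>\<close> with large \<open>B\<close> different monomials become different powers of \<open>q\<^sup>n\<close>.\<close>

lemma nodes_dense:
  assumes f: "in_vars N f" and 0: "\<And>\<mu>. is_dominant N \<mu> \<Longrightarrow> mpeval (node N \<mu>) f = 0"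
  shows "f = 0"
proof (rule ccontr)
  assume "f \<noteq> 0"
  then obtain m0 where m0: "m0 \<in> keys f" by (metis in_keys_iff lookup_zero poly_mapping_eqI)
  define B where "B = Suc (\<Sum>m\<in>keys f. \<Sum>i<N. lookup m i)"
  have B: "lookup m i < B" if "m \<in> keys f" "i < N" for m i
  proof -
    have "lookup m i \<le> (\<Sum>i<N. lookup m i)" using that by (intro member_le_sum) auto
    also have "\<dots> \<le> (\<Sum>m\<in>keys f. \<Sum>i<N. lookup m i)"
      using that by (intro member_le_sum[of m _ "\<lambda>m. \<Sum>i<N. lookup m i"]) auto
    finally show ?thesis by (simp add: B_def)
  qed
  define s where "s m = (\<Sum>i<N. lookup m i * B ^ (N - Suc i))" for m :: "nat \<Rightarrow>\<^sub>0 nat"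
  define e where "e m = (\<Prod>i<N. (t ^ (N - 1 - i)) ^ lookup m i)" for m :: "nat \<Rightarrow>\<^sub>0 nat"
  define p where "p = (\<Sum>m\<in>keys f. monom (lookup f m * e m) (s m))"
  have s_inj: "m = m0" if "m \<in> keys f" "s m = s m0" for m
  proof -
    have "\<forall>i<N. lookup m i = lookup m0 i"
      using that m0 B unfolding s_def by (intro base_expansion_inj[of N _ B]) auto
    then have "lookup m i = lookup m0 i" for i
      using in_vars_keys[OF f that(1), of i] in_vars_keys[OF f m0, of i] by (cases "i < N") auto
    then show ?thesis by (rule poly_mapping_eqI)
  qed
  have "poly p (q ^ n) = 0" for n
  proof -
    let ?\<mu> = "\<lambda>i. n * B ^ (N - Suc i)"
    have "is_dominant N ?\<mu>" unfolding is_dominant_def by (auto simp: B_def intro!: mult_le_mono2 power_increasing)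
    then have "0 = mpeval (node N ?\<mu>) f" using 0 by simp
    also have "\<dots> = (\<Sum>m\<in>keys f. lookup f m * (e m * (q ^ n) ^ s m))"
      unfolding mpeval_mon_eval
    proof (intro sum.cong refl arg_cong2[of _ _ _ _ "(*)"])
      fix m assume m: "m \<in> keys f"
      have "mon_eval (node N ?\<mu>) m = (\<Prod>i<N. node N ?\<mu> i ^ lookup m i)"
        using m f by (intro mon_eval_superset) (auto simp: in_vars_def)
      also have "\<dots> = (\<Prod>i<N. (t ^ (N - 1 - i)) ^ lookup m i * (q ^ n) ^ (lookup m i * B ^ (N - Suc i)))"
        by (intro prod.cong refl) (simp add: node_def power_mult_distrib mult_ac flip: power_mult)
      also have "\<dots> = e m * (q ^ n) ^ s m"
        unfolding prod.distrib s_def e_def power_sum ..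
      finally show "mon_eval (node N ?\<mu>) m = e m * (q ^ n) ^ s m" .
    qed
    finally show ?thesis by (simp add: p_def poly_sum poly_monom mult.assoc)
  qed
  then have "range (\<lambda>n. q ^ n) \<subseteq> {z. poly p z = 0}" by auto
  moreover have "inj (\<lambda>n. q ^ n)"
    using node_inj[of _ 0 _ 0] by (auto intro: injI)
  ultimately have "infinite {z. poly p z = 0}"
    using finite_subset range_inj_infinite by blast
  then have "p = 0" using poly_roots_finite by blast
  moreover have "coeff p (s m0) = lookup f m0 * e m0"
  proof -
    have "coeff p (s m0) = (\<Sum>m\<in>keys f. if m = m0 then lookup f m * e m else 0)"
      unfolding p_def coeff_sum using s_inj by (intro sum.cong) auto
    then show ?thesis using m0 by simp
  qed
  moreover have "e m0 \<noteq> 0" using t_nonzero by (simp add: e_def)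
  ultimately show False using m0 by (simp add: in_keys_iff)
qed


section \<open>Interpolation polynomials\<close>

definition is_interp :: "nat \<Rightarrow> nat list \<Rightarrow> 'a mpol \<Rightarrow> bool" where
  "is_interp N \<nu> p \<longleftrightarrow>
     is_symmetric N p \<and> total_degree p = sum_list \<nu> \<and> mcoeff p \<nu> = iform \<nu> \<and>
     (\<forall>\<mu>. is_partition \<mu> \<and> \<mu> \<noteq> \<nu> \<and> sum_list \<mu> \<le> sum_list \<nu> \<and> length \<mu> \<le> N \<longrightarrow>
        mpeval (\<lambda>i. q ^ nth_default 0 \<mu> i * t ^ (N - 1 - i)) p = 0)"

lemma eigenval_sep_fun:
  assumes "\<exists>i<N. \<mu> i \<noteq> \<nu> i" shows "eigenval N \<mu> \<noteq> eigenval N \<nu>"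
proof
  assume "eigenval N \<mu> = eigenval N \<nu>"
  then have 0: "(\<Sum>i<N. t ^ i * (inverse q ^ \<mu> i - inverse q ^ \<nu> i)) = 0"
    by (simp flip: eigenval_diff)
  obtain i where "i < N" "\<mu> i \<noteq> \<nu> i" using assms by blast
  from separation[of _ N \<mu> \<nu>, OF this] show False using q_not_1 unfolding 0 by simp
qed

text \<open>The exceptional case of \<open>eigenfunction_vanishing\<close> needs \<open>l\<close>
  below \<open>\<mu>\<close> in every row, and then the size bound forces
  \<open>\<mu> = l\<close>.\<close>

lemma eigenfunction_node_0:
  assumes "is_eigenfunction N l f" "is_partition l" "length l \<le> N"
    and "is_partition \<mu>" "length \<mu> \<le> N" "sum_list \<mu> \<le> sum_list l" "\<mu> \<noteq> l"
  shows "mpeval (node N (nth_default 0 \<mu>)) f = 0"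
proof (rule eigenfunction_vanishing[of N "nth_default 0 l"])
  show "eigenop N (eigenval N (nth_default 0 l)) f = 0" using assms(1) by (simp add: is_eigenfunction_def)
  fix \<mu>' assume \<mu>': "\<And>i. i < N \<Longrightarrow> \<mu>' i \<le> nth_default 0 \<mu> i" "\<And>i. i < N \<Longrightarrow> \<mu>' i = nth_default 0 l i"
  then have le: "nth_default 0 l i \<le> nth_default 0 \<mu> i" if "i < N" for i using that by force
  have "\<mu> = l"
  proof (rule partition_eqI[OF assms(4,2,5,3)])
    fix i assume i: "i < N"
    show "nth_default 0 \<mu> i = nth_default 0 l i"
    proof (rule ccontr)
      assume "\<not> ?thesis"
      then have "(\<Sum>i<N. nth_default 0 l i) < (\<Sum>i<N. nth_default 0 \<mu> i)"
        using le i le[OF i] by (intro sum_strict_mono_ex1 bexI[of _ i]) (auto simp: order_less_le)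
      then show False using assms(6) sum_nth_default[OF assms(3)] sum_nth_default[OF assms(5)] by simp
    qed
  qed
  then show "mpeval (node N \<mu>') f = 0" using assms(7) by simp
qed (use eigenval_sep_fun is_dominant_partition[OF assms(4)] in auto)

text \<open>Vanishing at its own node would propagate to all dominant nodes, and these are
  dense.\<close>

lemma eigenfunction_node_nonzero:
  assumes f: "is_eigenfunction N l f" and "is_partition l"
  shows "mpeval (node N (nth_default 0 l)) f \<noteq> 0"
proof
  assume 0: "mpeval (node N (nth_default 0 l)) f = 0"
  have "f = 0"
  proof (rule nodes_dense)
    show "in_vars N f" using f by (simp add: is_eigenfunction_def is_symmetric_def)
    fix \<mu> assume "is_dominant N \<mu>"
    then show "mpeval (node N \<mu>) f = 0"
    proof (rule eigenfunction_vanishing[of N "nth_default 0 l", rotated])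
      show "eigenop N (eigenval N (nth_default 0 l)) f = 0" using f by (simp add: is_eigenfunction_def)
      fix \<mu>' assume "\<And>i. i < N \<Longrightarrow> \<mu>' i = nth_default 0 l i"
      then have "node N \<mu>' = node N (nth_default 0 l)" by (auto simp: node_def)
      then show "mpeval (node N \<mu>') f = 0" using 0 by simp
    qed (use eigenval_sep_fun in auto)
  qed
  then show False using f by (simp add: is_eigenfunction_def mcoeff_def)
qed

text \<open>The polynomial is expanded in the eigenfunctions \<open>P \<mu>\<close>, which are
  triangular in the lexicographic order. Evaluating at nodes by increasing size isolates one
  coefficient at a time: larger or equal sizes vanish at the node, smaller ones were removed before.
  The coefficient of \<open>P l\<close> is left, and it dies with the coefficient at
  \<open>l\<close>.\<close>

lemma interpolation_unique_0:
  assumes l: "is_partition l" "length l \<le> N"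
    and p: "is_symmetric N p" "deg_le N (sum_list l) p" "mcoeff p l = 0"
    and p0: "\<And>\<mu>. is_partition \<mu> \<Longrightarrow> length \<mu> \<le> N \<Longrightarrow> sum_list \<mu> \<le> sum_list l \<Longrightarrow> \<mu> \<noteq> l \<Longrightarrow>
      mpeval (node N (nth_default 0 \<mu>)) p = 0"
  shows "p = 0"
proof -
  let ?nth = "Poly_Mapping.nth :: nat list \<Rightarrow> _"
  define X where "X = {\<mu>. is_partition \<mu> \<and> length \<mu> \<le> N \<and> sum_list \<mu> \<le> sum_list l}"
  have fin: "finite X" unfolding X_def by (rule finite_partitions_bounded)
  define P where "P \<mu> = (SOME f. is_eigenfunction N \<mu> f)" for \<mu>
  have P: "is_eigenfunction N \<mu> (P \<mu>)" if "\<mu> \<in> X" for \<mu>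
    unfolding P_def by (rule someI_ex, rule eigenfunction_exists) (use that in \<open>simp_all add: X_def\<close>)
  have "\<exists>a. \<forall>\<nu>\<in>X. (\<Sum>\<mu>\<in>X. a \<mu> * mcoeff (P \<mu>) \<nu>) = mcoeff p \<nu>"
  proof (rule triangular_solve[OF fin, of ?nth])
    show "inj_on ?nth X" unfolding inj_on_def X_def using nth_inj by blast
    fix \<mu> assume \<mu>: "\<mu> \<in> X"
    then show "mcoeff (P \<mu>) \<mu> \<noteq> 0" using P by (simp add: is_eigenfunction_def)
    fix \<nu> assume "?nth \<mu> < ?nth \<nu>"
    moreover have "?nth \<nu> \<le> ?nth \<mu>" if "?nth \<nu> \<in> keys (P \<mu>)"
    proof (rule eigenfunction_leading[OF _ _ _ that])
      show "in_vars N (P \<mu>)" "eigenop N (eigenval_part N \<mu>) (P \<mu>) = 0"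
        using P[OF \<mu>] by (simp_all only: is_eigenfunction_def is_symmetric_def)
      show "keys (?nth \<mu>) \<subseteq> {..<N}" using \<mu> by (intro keys_nth_subset) (simp add: X_def)
    qed
    ultimately show "mcoeff (P \<mu>) \<nu> = 0" unfolding mcoeff_def in_keys_iff by force
  qed
  then obtain a where a: "\<And>\<nu>. \<nu> \<in> X \<Longrightarrow> (\<Sum>\<mu>\<in>X. a \<mu> * mcoeff (P \<mu>) \<nu>) = mcoeff p \<nu>" by blast
  let ?s = "\<Sum>\<mu>\<in>X. single 0 (a \<mu>) * P \<mu>"
  have "deg_le N (0 + sum_list l) (single 0 (a \<mu>) * P \<mu>)" if "\<mu> \<in> X" for \<mu>
    using P[OF that] that by (intro deg_le_mult) (auto simp: deg_le_def is_eigenfunction_def X_def)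
  then have "p - ?s = 0"
    using p P a
    by (intro symmetric_eq_0[of N _ "sum_list l"] is_symmetric_diff deg_le_diff deg_le_sum is_symmetric_sum
        is_symmetric_const_times) (auto simp: is_eigenfunction_def X_def mcoeff_def lookup_minus lookup_sum)
  then have ps: "p = ?s" by simp
  have a0: "a \<mu> = 0" if "\<mu> \<in> X" "\<mu> \<noteq> l" for \<mu>
    using that
  proof (induction "sum_list \<mu>" arbitrary: \<mu> rule: less_induct)
    case less
    let ?x = "node N (nth_default 0 \<mu>)"
    have \<mu>: "is_partition \<mu>" "length \<mu> \<le> N" "sum_list \<mu> \<le> sum_list l" using less.prems by (auto simp: X_def)
    have "a \<nu> * mpeval ?x (P \<nu>) = 0" if \<nu>: "\<nu> \<in> X - {\<mu>}" for \<nu>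
    proof (cases "sum_list \<nu> < sum_list \<mu>")
      case True
      then have "\<nu> \<noteq> l" using \<mu>(3) by auto
      then show ?thesis using less.hyps[OF True] \<nu> by simp
    next
      case False
      then show ?thesis using \<nu> \<mu> P[of \<nu>] eigenfunction_node_0[of N \<nu> "P \<nu>" \<mu>] by (auto simp: X_def)
    qed
    then have "(\<Sum>\<nu>\<in>X - {\<mu>}. a \<nu> * mpeval ?x (P \<nu>)) = 0" by (intro sum.neutral) blast
    then have "(\<Sum>\<nu>\<in>X. a \<nu> * mpeval ?x (P \<nu>)) = a \<mu> * mpeval ?x (P \<mu>)"
      using sum.remove[OF fin less.prems(1), of "\<lambda>\<nu>. a \<nu> * mpeval ?x (P \<nu>)"] by simp
    moreover have "(\<Sum>\<nu>\<in>X. a \<nu> * mpeval ?x (P \<nu>)) = mpeval ?x p"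
      by (subst ps) (simp add: mpeval.hom_sum mpeval.hom_mult mpeval.hom_single mon_eval_def)
    ultimately have "a \<mu> * mpeval ?x (P \<mu>) = 0" using p0[OF \<mu> less.prems(2)] by simp
    then show ?case using eigenfunction_node_nonzero[OF P[OF less.prems(1)] \<mu>(1)] by simp
  qed
  have lX: "l \<in> X" using l by (simp add: X_def)
  have "(\<Sum>\<mu>\<in>X - {l}. a \<mu> * mcoeff (P \<mu>) l) = 0" using a0 by (intro sum.neutral) simp
  then have "(\<Sum>\<mu>\<in>X. a \<mu> * mcoeff (P \<mu>) l) = a l * mcoeff (P l) l"
    using sum.remove[OF fin lX, of "\<lambda>\<mu>. a \<mu> * mcoeff (P \<mu>) l"] by simp
  then have "a l = 0" using a[OF lX] p(3) P[OF lX] by (simp add: is_eigenfunction_def)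
  then have "a \<mu> = 0" if "\<mu> \<in> X" for \<mu> using a0 that by (cases "\<mu> = l") auto
  then show ?thesis by (subst ps) simp
qed

lemma mpeval_node:
  assumes "in_vars N p"
  shows "mpeval (\<lambda>i. q ^ \<mu> i * t ^ (N - 1 - i)) p = mpeval (node N \<mu>) p"
  by (rule mpeval_cong[OF assms]) (simp add: node_def)

lemma interp_exists:
  assumes l: "is_partition l" "length l \<le> N"
  shows "\<exists>p. is_interp N l p \<and> is_eigenfunction N l p"
proof -
  obtain f where f: "is_eigenfunction N l f" using eigenfunction_exists[OF l] by blast
  then have nz: "mcoeff f l \<noteq> 0" by (simp add: is_eigenfunction_def)
  define p where "p = single 0 (iform l / mcoeff f l) * f"
  have co: "mcoeff p l = iform l" using nz by (simp add: p_def mcoeff_def)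
  have "deg_le N (0 + sum_list l) p"
    unfolding p_def using f by (intro deg_le_mult) (auto simp: is_eigenfunction_def deg_le_def)
  then have p: "is_eigenfunction N l p"
    using f co iform_nonzero[of l]
    by (auto simp: is_eigenfunction_def p_def is_symmetric_const_times eigenop_const_times)
  then have iv: "in_vars N p" by (simp add: is_eigenfunction_def is_symmetric_def)
  have "total_degree p \<le> sum_list l"
    using p total_degree_le_iff[OF iv] by (simp add: is_eigenfunction_def)
  moreover have "sum_list l \<le> total_degree p"
  proof -
    have "deg_le N (total_degree p) p" using total_degree_le_iff[OF iv] by blast
    moreover have "Poly_Mapping.nth l \<in> keys p" using co iform_nonzero by (simp add: mcoeff_def in_keys_iff)
    ultimately have "(\<Sum>i<N. lookup (Poly_Mapping.nth l) i) \<le> total_degree p" unfolding deg_le_def by blast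
    then show ?thesis using sum_nth_default[OF l(2)] by simp
  qed
  ultimately have "is_interp N l p"
    unfolding is_interp_def mpeval_node[OF iv] using co p l eigenfunction_node_0[OF p l]
    by (auto simp: is_eigenfunction_def)
  then show ?thesis using p by blast
qed

lemma interp_unique:
  assumes l: "is_partition l" "length l \<le> N" and "is_interp N l p" "is_interp N l r"
  shows "p = r"
proof -
  have iv: "in_vars N p" "in_vars N r" using assms(3,4) by (auto simp: is_interp_def is_symmetric_def)
  have "p - r = 0"
  proof (rule interpolation_unique_0[OF l])
    show "is_symmetric N (p - r)" using assms(3,4) by (intro is_symmetric_diff) (auto simp: is_interp_def)
    have "deg_le N (sum_list l) p" "deg_le N (sum_list l) r"
      using assms(3,4) total_degree_le_iff[OF iv(1)] total_degree_le_iff[OF iv(2)] by (auto simp: is_interp_def)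
    then show "deg_le N (sum_list l) (p - r)" by (rule deg_le_diff)
    show "mcoeff (p - r) l = 0" using assms(3,4) by (simp add: is_interp_def mcoeff_def lookup_minus)
    fix \<mu> assume "is_partition \<mu>" "length \<mu> \<le> N" "sum_list \<mu> \<le> sum_list l" "\<mu> \<noteq> l"
    then show "mpeval (node N (nth_default 0 \<mu>)) (p - r) = 0"
      using assms(3,4) unfolding is_interp_def mpeval_node[OF iv(1)] mpeval_node[OF iv(2)] mpeval.hom_diff
      by simp
  qed
  then show ?thesis by simp
qed

definition interp :: "nat \<Rightarrow> nat list \<Rightarrow> 'a mpol" where
  "interp N \<nu> = (THE p. is_interp N \<nu> p)"

lemma interp_props:
  assumes "is_partition l" "length l \<le> N"
  shows "is_eigenfunction N l (interp N l)" "mcoeff (interp N l) l = iform l"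
proof -
  obtain p where p: "is_interp N l p" "is_eigenfunction N l p" using interp_exists[OF assms] by blast
  have "interp N l = p"
    unfolding interp_def using p(1) interp_unique[OF assms] by (intro the_equality) auto
  then show "is_eigenfunction N l (interp N l)" "mcoeff (interp N l) l = iform l"
    using p by (auto simp: is_interp_def)
qed

end

section \<open>Cumulants of interpolation polynomials\<close>

context local_qt
begin

definition O_pol :: "nat \<Rightarrow> 'a mpol set" where
  "O_pol n = {p. \<forall>m. lookup p m \<in> O_one n}"

sublocale pols: ring_filtration O_pol
proof
  fix x y :: "'a mpol" and m n assume xy: "x \<in> O_pol m" "y \<in> O_pol n"
  show "x * y \<in> O_pol (m + n)"
    unfolding O_pol_def
  proof (intro CollectI allI)
    fix k show "lookup (x * y) k \<in> O_one (m + n)"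
      unfolding lookup_times using xy
      by (intro scalars.F_sum) (auto simp: O_pol_def scalars.F_zero intro: scalars.F_mult)
  qed
qed (use scalars.F_Suc in \<open>auto simp: O_pol_def lookup_add scalars.F_zero scalars.F_one lookup_one when_def
      intro: scalars.F_add scalars.F_uminus\<close>)

lemma single_O_pol: "c \<in> O_one n \<Longrightarrow> single m c \<in> O_pol n"
  by (auto simp: O_pol_def lookup_single when_def scalars.F_zero)

lemma sdiff_O_pol: "p \<in> O_pol n \<Longrightarrow> sdiff k p \<in> O_pol (Suc n)"
  unfolding O_pol_def using scalars.F_mult[OF inverse_q_power_close] by (auto simp: lookup_sdiff)

lemma twist_shift_var: "twist O_pol (\<lambda>I. shift_var (inverse q) k)"
  by unfold_locales
    (simp_all add: shift_var.hom_add shift_var.hom_mult shift_var.hom_1 sdiff_O_pol flip: sdiff_def)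

lemma character_twist_row: "character_twist O_pol (\<lambda>i. single 0 (inverse q ^ d i))"
proof
  fix i
  have "single 0 (inverse q ^ d i) - 1 = single 0 (inverse q ^ d i - 1)"
    by (simp add: single_diff)
  then show "single 0 (inverse q ^ d i) - 1 \<in> O_pol 1"
    using single_O_pol[OF inverse_q_power_close, of 0 "d i"] by metis
qed

lemma prod_single_0: "(\<Prod>i\<in>I. single 0 (f i)) = (single 0 (\<Prod>i\<in>I. f i) :: 'a mpol)"
  by (induction I rule: infinite_finite_induct) (simp_all add: mult_single)

lemma alternant_shift_O_pol: "alternant_shift N k \<in> O_pol 0"
  unfolding alternant_shift_def
  by (intro pols.F_sum pols.F_diff single_O_pol) (auto simp: O_zero intro: R_mult sign_R R_power t_R)

lemma alternant_O_pol: "alternant N \<in> O_pol 0"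
  unfolding alternant_def by (intro pols.F_sum single_O_pol) (simp add: O_zero sign_R)

text \<open>Degree 0 leaves a constant, and the empty product normalises it to 1. This provides the
  constant term 1 that division of series requires.\<close>

lemma interp_Nil: "interp N [] = 1"
proof (rule poly_mapping_eqI)
  fix m
  have nil: "is_partition []" "length [] \<le> N" by (simp_all add: is_partition_def)
  note p = interp_props[OF nil]
  have iv: "in_vars N (interp N [])" using p(1) by (simp add: is_eigenfunction_def is_symmetric_def)
  show "lookup (interp N []) m = lookup 1 m"
  proof (cases "m = 0")
    case True
    then show ?thesis using p(2) by (simp add: mcoeff_def iform_def)
  next
    case False
    have "m \<notin> keys (interp N [])"
    proof
      assume m: "m \<in> keys (interp N [])"
      have "(\<Sum>i<N. lookup m i) \<le> 0"
        using p(1) m unfolding is_eigenfunction_def deg_le_def by fastforce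
      then have "lookup m i = lookup 0 i" for i
        using in_vars_keys[OF iv m, of i] by (cases "i < N") auto
      then show False using False poly_mapping_eqI[of m 0] by blast
    qed
    then show ?thesis using False by (simp add: in_keys_iff lookup_one when_def)
  qed
qed

text \<open>The family \<open>u I = \<J>\<^bsub>\<lambda>\<^sup>I\<^esub>\<close>. In terms of generating functions its eigenvalue equations become a
  Hamilton-Jacobi type equation for the cumulants.\<close>

context
  fixes N :: nat and A :: "nat set" and \<Lambda> :: "nat \<Rightarrow> nat list"
  assumes fin: "finite A"
    and part: "\<And>i. i \<in> A \<Longrightarrow> is_partition (\<Lambda> i)"
    and len: "\<And>i. i \<in> A \<Longrightarrow> length (\<Lambda> i) \<le> N"
begin

abbreviation fam :: "nat set \<Rightarrow> 'a mpol" where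
  "fam I \<equiv> interp N (oplus_family I \<Lambda>)"

abbreviation lead :: "nat set \<Rightarrow> nat \<Rightarrow>\<^sub>0 nat" where
  "lead I \<equiv> Poly_Mapping.nth (oplus_family I \<Lambda>)"

definition texp_shift :: "nat \<Rightarrow> nat set \<Rightarrow> 'a mpol" where
  "texp_shift k = twist.texp (\<lambda>I. shift_var (inverse q) k) fam"

definition row_char :: "nat \<Rightarrow> nat \<Rightarrow> 'a mpol" where
  "row_char j i = single 0 (inverse q ^ nth_default 0 (\<Lambda> i) j)"

definition texp_char :: "nat \<Rightarrow> nat set \<Rightarrow> 'a mpol" where
  "texp_char j = twist.texp (character_twist.cmul (row_char j)) fam"

lemma character_twist_row_char: "character_twist O_pol (row_char j)"
  unfolding row_char_def by (rule character_twist_row)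

lemma twist_row_char: "twist O_pol (character_twist.cmul (row_char j))"
proof -
  interpret character_twist O_pol "row_char j" by (rule character_twist_row_char)
  show ?thesis by unfold_locales
qed

lemma cmul_row_char:
  "character_twist.cmul (row_char j) I p = single 0 (inverse q ^ (\<Sum>i\<in>I. nth_default 0 (\<Lambda> i) j)) * p"
  unfolding character_twist.cmul_def[OF character_twist_row_char]
  by (simp add: row_char_def prod_single_0 power_sum)

lemma fam_empty: "fam {} = 1"
proof -
  have "oplus_family {} \<Lambda> = []" by (simp add: oplus_family_def)
  then show ?thesis by (simp add: interp_Nil)
qed

lemma
  assumes "I \<subseteq> A"
  shows part_I: "is_partition (oplus_family I \<Lambda>)" and len_I: "length (oplus_family I \<Lambda>) \<le> N"
    and lookup_lead: "lookup (lead I) j = (\<Sum>i\<in>I. nth_default 0 (\<Lambda> i) j)"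
proof -
  have I: "finite I" using assms fin finite_subset by blast
  show "is_partition (oplus_family I \<Lambda>)"
    using assms part by (intro is_partition_oplus_family I) auto
  show "length (oplus_family I \<Lambda>) \<le> N" using assms len by (intro length_oplus_family_le I) auto
  show "lookup (lead I) j = (\<Sum>i\<in>I. nth_default 0 (\<Lambda> i) j)" by (simp add: nth_default_oplus_family[OF I])
qed

lemma fam_eigen: "I \<subseteq> A \<Longrightarrow> is_eigenfunction N (oplus_family I \<Lambda>) (fam I)"
  by (intro interp_props part_I len_I)

lemma in_vars_fam: "I \<subseteq> A \<Longrightarrow> in_vars N (fam I)"
  using fam_eigen unfolding is_eigenfunction_def is_symmetric_def by blast

text \<open>The eigenvalue of a componentwise sum is a combination of characters minus 1, so
  multiplying by it becomes a sum of twists of the same kind as the shifts.\<close>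

lemma const_eigenval_times:
  assumes "I \<subseteq> A"
  shows "single 0 (eigenval N (lookup (lead I))) * p
    = (\<Sum>j<N. single 0 (t ^ j) * (character_twist.cmul (row_char j) I p - p))"
  unfolding eigenval_def lookup_lead[OF assms] cmul_row_char
  by (rule poly_mapping_eqI)
    (simp add: lookup_sum lookup_minus sum_distrib_right left_diff_distrib right_diff_distrib mult.assoc)

lemma fam_equation:
  assumes "I \<subseteq> A"
  shows "(\<Sum>k<N. alternant_shift N k * (shift_var (inverse q) k (fam I) - fam I))
    = (\<Sum>j<N. alternant N * single 0 (t ^ j) * (character_twist.cmul (row_char j) I (fam I) - fam I))"
proof -
  have "eigenop N (eigenval N (lookup (lead I))) (fam I) = 0"
    using fam_eigen[OF assms] unfolding is_eigenfunction_def by blast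
  then have "(\<Sum>k<N. alternant_shift N k * sdiff k (fam I))
      = alternant N * (single 0 (eigenval N (lookup (lead I))) * fam I)"
    by (simp add: eigenop_def mult_ac)
  then show ?thesis
    unfolding const_eigenval_times[OF assms] by (simp add: sdiff_def sum_distrib_left mult.assoc)
qed

text \<open>Multiplying both sides by the series of \<open>fam\<close> gives the eigenvalue
  equations, and this series can be cancelled. The term \<open>?\<delta>\<close> is the constant
  series 1, which vanishes at nonempty \<open>I\<close>.\<close>

lemma texp_equation:
  assumes I: "I \<subseteq> A" "I \<noteq> {}"
  shows "(\<Sum>k<N. alternant_shift N k * texp_shift k I) = (\<Sum>j<N. alternant N * single 0 (t ^ j) * texp_char j I)"
proof -
  let ?\<delta> = "\<lambda>B :: nat set. if B = {} then 1 else 0 :: 'a mpol"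
  let ?L = "\<lambda>B. \<Sum>k<N. alternant_shift N k * (texp_shift k B - ?\<delta> B)"
  let ?R = "\<lambda>B. \<Sum>j<N. alternant N * single 0 (t ^ j) * (texp_char j B - ?\<delta> B)"
  have "?L I = ?R I"
  proof (rule conv_cancel[of I fam])
    show "finite I" using I fin finite_subset by blast
    show "fam {} = 1" by (rule fam_empty)
    fix J assume "J \<subseteq> I"
    then have J: "J \<subseteq> A" using I by blast
    then have finJ: "finite J" using fin by (rule finite_subset)
    have "(?L \<star> fam) J = (\<Sum>k<N. alternant_shift N k * ((texp_shift k \<star> fam) J - (?\<delta> \<star> fam) J))"
      by (simp only: conv_sum_left conv_mult_left conv_diff_left)
    also have "\<dots> = (\<Sum>k<N. alternant_shift N k * (shift_var (inverse q) k (fam J) - fam J))"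
      by (simp only: conv_unit_left[OF finJ] texp_shift_def twist.texp_conv[where u = fam, OF twist_shift_var finJ fam_empty])
    also have "\<dots> = (\<Sum>j<N. alternant N * single 0 (t ^ j) * (character_twist.cmul (row_char j) J (fam J) - fam J))"
      by (rule fam_equation[OF J])
    also have "\<dots> = (\<Sum>j<N. alternant N * single 0 (t ^ j) * ((texp_char j \<star> fam) J - (?\<delta> \<star> fam) J))"
      by (simp only: conv_unit_left[OF finJ] texp_char_def twist.texp_conv[where u = fam, OF twist_row_char finJ fam_empty])
    also have "\<dots> = (?R \<star> fam) J"
      by (simp only: conv_sum_left conv_mult_left conv_diff_left)
    finally show "(?L \<star> fam) J = (?R \<star> fam) J" .
  qed
  then show ?thesis using I(2) by simp
qed

text \<open>Both sides of \<open>texp_equation\<close> are replaced by their linear terms. The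
  difference of these is the operator minus the eigenvalue of \<open>I\<close>, applied to the
  cumulant, and what was dropped has order \<open>card I\<close>.\<close>

lemma eigenop_cumulant_small:
  assumes I: "I \<subseteq> A" "I \<noteq> {}" and small: "\<And>B. B \<subset> I \<Longrightarrow> pols.small_cumulants B fam"
  shows "eigenop N (eigenval N (lookup (lead I))) (cumul fam I) \<in> O_pol (card I)"
proof -
  let ?\<kappa> = "cumul fam I"
  have finI: "finite I" using I fin finite_subset by blast
  have shift: "texp_shift k I - sdiff k ?\<kappa> \<in> O_pol (card I)" for k
    unfolding texp_shift_def sdiff_def
    by (rule twist.texp_first_order[where u = fam, OF twist_shift_var finI I(2) fam_empty small])
  have char: "texp_char j I - (character_twist.cmul (row_char j) I ?\<kappa> - ?\<kappa>) \<in> O_pol (card I)" for j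
    unfolding texp_char_def
    by (rule twist.texp_first_order[where u = fam, OF twist_row_char finI I(2) fam_empty small])
  have "eigenop N (eigenval N (lookup (lead I))) ?\<kappa>
      = (\<Sum>k<N. alternant_shift N k * sdiff k ?\<kappa>)
        - (\<Sum>j<N. alternant N * single 0 (t ^ j) * (character_twist.cmul (row_char j) I ?\<kappa> - ?\<kappa>))"
    unfolding eigenop_def mult.commute[of "single 0 _" "alternant N"] mult.assoc const_eigenval_times[OF I(1)] sum_distrib_left ..
  also have "\<dots> = (\<Sum>j<N. alternant N * single 0 (t ^ j) * (texp_char j I - (character_twist.cmul (row_char j) I ?\<kappa> - ?\<kappa>)))
      - (\<Sum>k<N. alternant_shift N k * (texp_shift k I - sdiff k ?\<kappa>))"
    using texp_equation[OF I] by (simp add: right_diff_distrib sum_subtractf)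
  also have "\<dots> \<in> O_pol (card I)"
  proof (intro pols.F_diff pols.F_sum)
    fix j k
    have "alternant N * single 0 (t ^ j) \<in> O_pol 0"
      by (intro pols.F_mult0 alternant_O_pol single_O_pol) (simp add: O_zero R_power t_R)
    then show "alternant N * single 0 (t ^ j) * (texp_char j I - (character_twist.cmul (row_char j) I ?\<kappa> - ?\<kappa>)) \<in> O_pol (card I)"
      by (rule pols.F_mult0[OF _ char])
    show "alternant_shift N k * (texp_shift k I - sdiff k ?\<kappa>) \<in> O_pol (card I)"
      by (rule pols.F_mult0[OF alternant_shift_O_pol shift])
  qed
  finally show ?thesis .
qed

text \<open>For every set partition the leading exponents of the blocks add up to
  \<open>lead I\<close>, so each product contributes the product of its leading
  coefficients.\<close>

lemma lookup_cumulant_lead: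
  assumes I: "I \<subseteq> A"
  shows "lookup (cumul fam I) (lead I) = cumul (\<lambda>B. iform (oplus_family B \<Lambda>)) I"
  unfolding cumul_def lookup_sum
proof (rule sum.cong[OF refl])
  fix \<pi> assume "\<pi> \<in> {\<pi>. partition_on I \<pi>}"
  then have \<pi>: "partition_on I \<pi>" by simp
  have finI: "finite I" using I fin finite_subset by blast
  have fin\<pi>: "finite \<pi>" by (rule finite_elements[OF finI \<pi>])
  have BA: "B \<subseteq> A" if "B \<in> \<pi>" for B using that \<pi> I by (auto simp: partition_on_def)
  have "lead I = (\<Sum>B\<in>\<pi>. lead B)"
  proof (rule poly_mapping_eqI)
    fix j
    have "lookup (lead I) j = (\<Sum>i\<in>\<Union>\<pi>. nth_default 0 (\<Lambda> i) j)"
      using lookup_lead[OF I] partition_onD1[OF \<pi>] by simp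
    also have "\<dots> = (\<Sum>B\<in>\<pi>. \<Sum>i\<in>B. nth_default 0 (\<Lambda> i) j)"
      using sum.Union_disjoint[of \<pi> "\<lambda>i. nth_default 0 (\<Lambda> i) j"] \<pi> BA fin
      by (auto simp: partition_on_def pairwise_def disjnt_def intro: finite_subset)
    also have "\<dots> = (\<Sum>B\<in>\<pi>. lookup (lead B) j)"
      by (intro sum.cong refl) (simp only: lookup_lead[OF BA])
    finally show "lookup (lead I) j = lookup (\<Sum>B\<in>\<pi>. lead B) j" by (simp only: lookup_sum)
  qed
  moreover have "lookup (\<Prod>B\<in>\<pi>. fam B) (\<Sum>B\<in>\<pi>. lead B) = (\<Prod>B\<in>\<pi>. lookup (fam B) (lead B))"
  proof (rule lookup_prod_lead(1)[OF fin\<pi>])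
    fix B m assume B: "B \<in> \<pi>" and m: "m \<in> keys (fam B)"
    show "m \<le> lead B"
    proof (rule eigenfunction_leading[OF _ _ _ m])
      show "keys (lead B) \<subseteq> {..<N}" by (intro keys_nth_subset len_I BA B)
      show "eigenop N (eigenval N (lookup (lead B))) (fam B) = 0"
        using fam_eigen[OF BA[OF B]] unfolding is_eigenfunction_def by blast
    qed (rule in_vars_fam[OF BA[OF B]])
  qed
  moreover have "lookup (fam B) (lead B) = iform (oplus_family B \<Lambda>)" if "B \<in> \<pi>" for B
    using interp_props(2)[OF part_I len_I] BA[OF that] by (simp add: mcoeff_def)
  ultimately have "lookup (\<Prod>B\<in>\<pi>. fam B) (lead I) = (\<Prod>B\<in>\<pi>. iform (oplus_family B \<Lambda>))"
    by simp
  then show "lookup (of_int (moebius_top \<pi>) * (\<Prod>B\<in>\<pi>. fam B)) (lead I)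
      = of_int (moebius_top \<pi>) * (\<Prod>B\<in>\<pi>. iform (oplus_family B \<Lambda>))"
    unfolding single_of_int[symmetric] lookup_const_times by simp
qed

lemma in_vars_cumulant: "I \<subseteq> A \<Longrightarrow> in_vars N (cumul fam I)"
  unfolding cumul_def single_of_int[symmetric]
  by (intro in_vars_sum in_vars_mult in_vars_prod in_vars_single in_vars_fam) (auto simp: partition_on_def)

theorem small_cumulants_interp: "pols.small_cumulants A fam"
proof -
  have "pols.small_cumulants I fam" if "I \<subseteq> A" for I
    using finite_subset[OF that fin] that
  proof (induction I rule: finite_psubset_induct)
    case (psubset I)
    have "cumul fam I \<in> O_pol (card I - 1)" if "I \<noteq> {}"
    proof -
      have card: "Suc (card I - 1) = card I" using that psubset.hyps by (simp add: card_gt_0_iff)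
      have T: "eigenop N (eigenval N (lookup (lead I))) (cumul fam I) \<in> O_pol (card I)"
        using psubset by (intro eigenop_cumulant_small that) auto
      have "scalars.small_cumulants A (\<lambda>B. iform (oplus_family B \<Lambda>))"
        using part by (rule small_cumulants_iform[OF fin])
      then have lead: "lookup (cumul fam I) (lead I) \<in> O_one (card I - 1)"
        unfolding lookup_cumulant_lead[OF psubset.prems] using psubset.prems that
        by (simp add: scalars.small_cumulants_def)
      have "lookup (cumul fam I) m \<in> O_one (card I - 1)" for m
      proof (rule eigenop_small_imp_small[OF in_vars_cumulant[OF psubset.prems] _ _ lead])
        show "keys (lead I) \<subseteq> {..<N}" by (intro keys_nth_subset len_I psubset.prems)
        fix m show "lookup (eigenop N (eigenval N (lookup (lead I))) (cumul fam I)) m \<in> O_one (Suc (card I - 1))"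
          using T unfolding card O_pol_def by blast
      qed
      then show ?thesis by (simp add: O_pol_def)
    qed
    moreover have "cumul fam B \<in> O_pol (card B - 1)" if "B \<subset> I" "B \<noteq> {}" for B
      using psubset.IH[OF that(1)] psubset.prems that unfolding pols.small_cumulants_def by blast
    ultimately show ?case unfolding pols.small_cumulants_def by (metis psubsetI)
  qed
  then show ?thesis by blast
qed

end

end


section \<open>Rational functions without a pole\<close>

lemma no_pole_at_oneI: "poly b 1 \<noteq> 0 \<Longrightarrow> no_pole_at_one (Fraction_Field.Fract a b)"
  unfolding no_pole_at_one_def by blast

lemma no_pole_at_oneE:
  assumes "no_pole_at_one f"
  obtains a b where "f = Fraction_Field.Fract a b" "poly b 1 \<noteq> 0" "b \<noteq> 0"
  using assms unfolding no_pole_at_one_def by fastforce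

lemma Fract_1_power: "Fraction_Field.Fract a 1 ^ n = (Fraction_Field.Fract (a ^ n) 1 :: 'a::idom fract)"
  by (induction n) (simp_all add: One_fract_def)

lemma Fract_1_eq_0_iff: "Fraction_Field.Fract a 1 = (0 :: 'a::idom fract) \<longleftrightarrow> a = 0"
  by (simp add: Zero_fract_def eq_fract)

lemma Fract_1_eq_1_iff: "Fraction_Field.Fract a 1 = (1 :: 'a::idom fract) \<longleftrightarrow> a = 1"
  by (simp add: One_fract_def eq_fract)

lemma sum_Fract_1: "(\<Sum>i\<in>X. Fraction_Field.Fract (f i) 1) = (Fraction_Field.Fract (\<Sum>i\<in>X. f i) 1 :: 'a::idom fract)"
  by (induction X rule: infinite_finite_induct) (simp_all add: Fract_1_eq_0_iff)

definition tvar :: ratt where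
  "tvar = Fraction_Field.Fract [:0, 1:] 1"

lemma tvar_power_eq_iff: "tvar ^ i = tvar ^ j \<longleftrightarrow> i = j"
proof
  assume "tvar ^ i = tvar ^ j"
  then have "[:0, 1::rat:] ^ i = [:0, 1:] ^ j"
    by (simp add: tvar_def Fract_1_power eq_fract)
  then have "degree ([:0, 1::rat:] ^ i) = degree ([:0, 1::rat:] ^ j)" by simp
  then show "i = j" by (simp add: degree_power_eq)
qed simp

lemma tvar_nonzero: "tvar \<noteq> 0"
  by (simp add: tvar_def Fract_1_eq_0_iff)

lemma tvar_independent:
  assumes "i < N" "d i \<noteq> (0::int)"
  shows "(\<Sum>i<N. tvar ^ i * of_int (d i)) \<noteq> 0"
proof
  assume 0: "(\<Sum>i<N. tvar ^ i * of_int (d i)) = 0"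
  define p :: "rat poly" where "p = (\<Sum>i<N. monom (of_int (d i)) i)"
  have of_int: "of_int z = (Fraction_Field.Fract (of_int z) 1 :: ratt)" for z
    by (cases z rule: int_diff_cases) (simp add: of_nat_fract)
  have "(\<Sum>i<N. tvar ^ i * of_int (d i)) = (\<Sum>i<N. Fraction_Field.Fract (monom (of_int (d i)) i) 1)"
    by (intro sum.cong refl) (simp add: of_int tvar_def Fract_1_power monom_altdef of_int_poly)
  then have "Fraction_Field.Fract p 1 = 0" using 0 by (simp add: sum_Fract_1 p_def)
  then have "p = 0" by (simp add: Fract_1_eq_0_iff)
  moreover have "coeff p i = of_int (d i)"
    using assms(1) by (simp add: p_def coeff_sum)
  ultimately show False using assms(2) by simp
qed

lemma tt_eq: "tt = Fraction_Field.Fract [:tvar:] 1"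
  by (simp add: tt_def tvar_def)

lemma qq_tt_monom: "qq ^ m * tt ^ i = Fraction_Field.Fract (monom (tvar ^ i) m) 1"
  by (simp add: qq_def tt_eq Fract_1_power monom_altdef poly_const_pow mult.commute)

lemma no_pole_inverse:
  assumes "poly a 1 \<noteq> 0"
  shows "\<exists>y. no_pole_at_one y \<and> y * Fraction_Field.Fract a 1 = 1"
proof (intro exI conjI)
  show "no_pole_at_one (Fraction_Field.Fract 1 a)" by (rule no_pole_at_oneI[OF assms])
  have "a \<noteq> 0" using assms by auto
  then show "Fraction_Field.Fract 1 a * Fraction_Field.Fract a 1 = 1"
    by (simp add: One_fract_def eq_fract)
qed

lemma qq_nonzero: "qq \<noteq> 0"
  by (simp add: qq_def Fract_1_eq_0_iff)

text \<open>After clearing denominators the sum is a polynomial P in q with P(1) = 0. Its derivative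
  at 1 is a combination of powers of t with coefficients \<open>\<mu> i - \<nu> i\<close>, hence
  nonzero, so 1 is a simple root.\<close>

lemma separation_qq_tt:
  assumes "i < N" "\<nu> i \<noteq> \<mu> i"
  shows "\<exists>y. no_pole_at_one y \<and> y * (\<Sum>i<N. tt ^ i * (inverse qq ^ \<nu> i - inverse qq ^ \<mu> i)) = qq - 1"
proof -
  \<comment> \<open>The sum is a crude common bound for all exponents of
    \<open>inverse qq\<close>.\<close>
  define M where "M = (\<Sum>i<N. \<nu> i + \<mu> i)"
  have M: "\<nu> i \<le> M" "\<mu> i \<le> M" if "i < N" for i
    using member_le_sum[of i "{..<N}" "\<lambda>i. \<nu> i + \<mu> i"] that by (auto simp: M_def)
  define P where "P = (\<Sum>i<N. monom (tvar ^ i) (M - \<nu> i) - monom (tvar ^ i) (M - \<mu> i))"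
  let ?S = "\<Sum>i<N. tt ^ i * (inverse qq ^ \<nu> i - inverse qq ^ \<mu> i)"
  have inv: "qq ^ M * inverse qq ^ n = qq ^ (M - n)" if "n \<le> M" for n
    using that qq_nonzero by (simp add: power_diff power_inverse field_simps)
  have "qq ^ M * ?S = (\<Sum>i<N. Fraction_Field.Fract (monom (tvar ^ i) (M - \<nu> i) - monom (tvar ^ i) (M - \<mu> i)) 1)"
    unfolding sum_distrib_left
  proof (intro sum.cong refl)
    fix i assume "i \<in> {..<N}"
    then have i: "i < N" by simp
    have "qq ^ M * (tt ^ i * (inverse qq ^ \<nu> i - inverse qq ^ \<mu> i))
      = qq ^ M * inverse qq ^ \<nu> i * tt ^ i - qq ^ M * inverse qq ^ \<mu> i * tt ^ i"
      by (simp add: algebra_simps)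
    also have "\<dots> = Fraction_Field.Fract (monom (tvar ^ i) (M - \<nu> i) - monom (tvar ^ i) (M - \<mu> i)) 1"
      unfolding inv[OF M(1)[OF i]] inv[OF M(2)[OF i]] qq_tt_monom by simp
    finally show "qq ^ M * (tt ^ i * (inverse qq ^ \<nu> i - inverse qq ^ \<mu> i))
      = Fraction_Field.Fract (monom (tvar ^ i) (M - \<nu> i) - monom (tvar ^ i) (M - \<mu> i)) 1" .
  qed
  then have S: "qq ^ M * ?S = Fraction_Field.Fract P 1" by (simp add: sum_Fract_1 P_def)
  have "poly P 1 = 0" by (simp add: P_def poly_sum poly_monom)
  then obtain P' where P': "P = [:-1, 1:] * P'" by (auto simp: poly_eq_0_iff_dvd elim: dvdE)
  have pderiv_sum: "pderiv (sum f X) = (\<Sum>i\<in>X. pderiv (f i))" for X and f :: "nat \<Rightarrow> ratt poly"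
    by (induction X rule: infinite_finite_induct) (simp_all add: pderiv_add)
  have "poly (pderiv P) 1 = (\<Sum>i<N. tvar ^ i * of_int (int (\<mu> i) - int (\<nu> i)))"
    unfolding P_def pderiv_sum poly_sum
  proof (intro sum.cong refl)
    fix i assume "i \<in> {..<N}"
    then have "int (M - \<nu> i) - int (M - \<mu> i) = int (\<mu> i) - int (\<nu> i)" using M[of i] by auto
    then have "of_nat (M - \<nu> i) - of_nat (M - \<mu> i) = (of_int (int (\<mu> i) - int (\<nu> i)) :: ratt)"
      by (metis of_int_diff of_int_of_nat_eq)
    then show "poly (pderiv (monom (tvar ^ i) (M - \<nu> i) - monom (tvar ^ i) (M - \<mu> i))) 1
      = tvar ^ i * of_int (int (\<mu> i) - int (\<nu> i))"
      by (simp add: pderiv_diff pderiv_monom poly_monom right_diff_distrib mult.commute flip: right_diff_distrib)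
  qed
  moreover have "poly (pderiv P) 1 = poly P' 1"
    unfolding P' by (simp add: pderiv_diff pderiv_pCons)
  moreover have "(\<Sum>i<N. tvar ^ i * of_int (int (\<mu> i) - int (\<nu> i))) \<noteq> 0"
    using assms by (intro tvar_independent[of i]) auto
  ultimately have "poly P' 1 \<noteq> 0" by simp
  then obtain z where z: "no_pole_at_one z" "z * Fraction_Field.Fract P' 1 = 1" using no_pole_inverse by blast
  obtain a b where ab: "z = Fraction_Field.Fract a b" "poly b 1 \<noteq> 0" "b \<noteq> 0" using z(1) by (rule no_pole_at_oneE)
  have "no_pole_at_one (z * qq ^ M)"
    using ab by (auto simp: qq_def Fract_1_power intro!: no_pole_at_oneI)
  moreover have "qq - 1 = Fraction_Field.Fract ([:0, 1:] - 1) 1"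
    by (simp add: qq_def One_fract_def[where 'a = "ratt poly"])
  then have "qq - 1 = Fraction_Field.Fract [:-1, 1:] 1"
    by (simp add: one_pCons)
  then have "Fraction_Field.Fract P 1 = (qq - 1) * Fraction_Field.Fract P' 1"
    by (simp only: P' mult_fract mult_1_left)
  then have "z * qq ^ M * ?S = qq - 1"
    using z(2) S by (simp add: mult.assoc mult.left_commute[of z])
  ultimately show ?thesis by blast
qed

section \<open>The rational functions in q and t as an instance\<close>

interpretation ratqt: local_qt qq tt "{f. no_pole_at_one f}"
proof (unfold_locales, unfold mem_Collect_eq)
  show "no_pole_at_one 1" unfolding One_fract_def by (rule no_pole_at_oneI) simp
  show "no_pole_at_one qq" "no_pole_at_one tt" "no_pole_at_one (inverse qq)"
    unfolding qq_def tt_def by (auto intro!: no_pole_at_oneI)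
  show "qq \<noteq> 0" by (rule qq_nonzero)
  show "tt \<noteq> 0" using tvar_nonzero by (simp add: tt_eq Fract_1_eq_0_iff)
  show "qq \<noteq> 1" unfolding qq_def Fract_1_eq_1_iff by (simp add: one_pCons)
  have "(of_nat 2 :: ratt) \<noteq> 0" unfolding of_nat_fract Fract_1_eq_0_iff by simp
  then have "(of_nat 2 :: ratt poly) \<noteq> 0" unfolding of_nat_poly by simp
  then have "(of_nat 2 :: ratqt) \<noteq> 0" unfolding of_nat_fract Fract_1_eq_0_iff .
  then show "(2 :: ratqt) \<noteq> 0" by simp
next
  fix x y :: ratqt assume "no_pole_at_one x" "no_pole_at_one y"
  then show "no_pole_at_one (x + y)" "no_pole_at_one (x * y)"
    by (auto elim!: no_pole_at_oneE intro!: no_pole_at_oneI)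
next
  fix x :: ratqt assume "no_pole_at_one x"
  then show "no_pole_at_one (- x)"
    by (auto elim!: no_pole_at_oneE intro!: no_pole_at_oneI)
next
  fix m i n j assume "qq ^ m * tt ^ i = qq ^ n * tt ^ j"
  then have eq: "monom (tvar ^ i) m = monom (tvar ^ j) n" by (simp add: qq_tt_monom eq_fract)
  then have "m = n" using degree_monom_eq[of "tvar ^ i" m] degree_monom_eq[of "tvar ^ j" n] tvar_nonzero by simp
  then have "tvar ^ i = tvar ^ j" using arg_cong[OF eq, of "\<lambda>p. coeff p m"] by simp
  then show "m = n \<and> i = j" using \<open>m = n\<close> tvar_power_eq_iff by blast
next
  fix k a :: nat assume "k \<noteq> 0"
  then have "tvar ^ k \<noteq> 1" using tvar_power_eq_iff[of k 0] by simp
  then have "poly (1 - monom (tvar ^ k) a) 1 \<noteq> 0" by (simp add: poly_monom)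
  moreover have "1 - qq ^ a * tt ^ k = Fraction_Field.Fract (1 - monom (tvar ^ k) a) 1"
    unfolding qq_tt_monom by (simp add: One_fract_def)
  ultimately show "\<exists>y\<in>{f. no_pole_at_one f}. y * (1 - qq ^ a * tt ^ k) = 1"
    using no_pole_inverse[of "1 - monom (tvar ^ k) a"] by simp
next
  fix i N :: nat and \<nu> \<mu> :: "nat \<Rightarrow> nat" assume "i < N" "\<nu> i \<noteq> \<mu> i"
  then show "\<exists>y\<in>{f. no_pole_at_one f}. y * (\<Sum>i<N. tt ^ i * (inverse qq ^ \<nu> i - inverse qq ^ \<mu> i)) = qq - 1"
    using separation_qq_tt by blast
qed

text \<open>At this instance the abstract conditions are literally the concrete ones, so unfolding
  under \<open>THE\<close> suffices.\<close>

lemma interp_macdonald_eq: "interp_macdonald N \<nu> = ratqt.interp N \<nu>"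
  by (simp only: interp_macdonald_def ratqt.interp_def is_interp_macdonald_def ratqt.is_interp_def
      integral_form_coeff_def ratqt.iform_def)

theorem theorem1p4:
  fixes r N :: nat and \<Lambda> :: "nat \<Rightarrow> nat list"
  assumes "r \<ge> 1"
    and "\<And>i. i \<in> {1..r} \<Longrightarrow> is_partition (\<Lambda> i)"
    and "\<And>i. i \<in> {1..r} \<Longrightarrow> length (\<Lambda> i) \<le> N"
  shows "\<forall>\<mu>. is_partition \<mu> \<and> length \<mu> \<le> N \<longrightarrow>
           no_pole_at_one (mcoeff (cumulant N r \<Lambda>) \<mu> / (qq - 1) ^ (r - 1))"
proof (intro allI impI)
  fix \<mu>
  have "ratqt.pols.small_cumulants {1..r} (\<lambda>I. ratqt.interp N (oplus_family I \<Lambda>))"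
    using assms(2,3) by (intro ratqt.small_cumulants_interp) auto
  then have "cumul (\<lambda>I. ratqt.interp N (oplus_family I \<Lambda>)) {1..r} \<in> ratqt.O_pol (card {1..r} - 1)"
    unfolding ratqt.pols.small_cumulants_def using assms(1) by (elim allE[of _ "{1..r}"]) simp
  then have "cumulant N r \<Lambda> \<in> ratqt.O_pol (r - 1)"
    by (simp add: cumulant_def cumul_def interp_macdonald_eq)
  then have "mcoeff (cumulant N r \<Lambda>) \<mu> \<in> ratqt.O_one (r - 1)"
    by (simp add: ratqt.O_pol_def mcoeff_def)
  then show "no_pole_at_one (mcoeff (cumulant N r \<Lambda>) \<mu> / (qq - 1) ^ (r - 1))"
    using ratqt.O_divide by blast
qed

end
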